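(* Let $K$ be a field, let $X$ be a $K$-scheme, let $y\in X$ be a rational point and let $D$ be a vector field on $X$. Then $exp_{D,y}:\operatorname{Spec}K[x]^*\to X$ is the only morphism of $K$-schemes $f:\operatorname{Spec}K[x]^*\to X$ such that $f(0)=y$ and $f(\delta_\mu)=D_{f(\mu)}$ for every commutative $K$-algebra $S$ and every point $\mu\in(\operatorname{Spec}K[x]^* )(S)$.
   Context: $K[x]^*:=\operatorname{Hom}_K(K[x],K)$ is the commutative $K$-algebra whose product is dual to the comultiplication $x\mapsto x\otimes1+1\otimes x$ of $G_a=\operatorname{Spec}K[x]$: $(ww')(x^n)=\sum_{i}\binom ni w(x^i)w'(x^{n-i})$; $\operatorname{Spec}K[x]^*$ is the usual spectrum. In characteristic $0$, $K[x]^*\simeq K[[z]]$; in characteristic $p>0$, $K[x]^*\simeq K[[x_0,\dots,x_n,\dots]]/(x_0^p,\dots,x_n^p,\dots):=\varprojlim_n K[x_0,\dots,x_n]/(x_0^p,\dots,x_n^p)$. The point $0$ of $\operatorname{Spec}K[x]^*$ is $K[x]^*\to K$, $w\mapsto w(1)$. For a scheme $Y$ over $K$ and $\mu\in Y(S)$, the tangent vectors at $\mu$ are $T_\mu Y=\{v\in Y(S[\epsilon]) : v\mapsto\mu \text{ under }\epsilon\mapsto0\}$, $S[\epsilon]=S[t]/(t^2)$. A morphism $f:Y\to Z$ maps $T_\mu Y$ to $T_{f(\mu)}Z$. A vector field on $Y$ is a $K$-linear derivation $D$ of the structure sheaf $\mathcal O_Y$, equivalently a functorial assignment $\mu\mapsto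 D_\mu\in T_\mu Y$ (for $\mu$ factoring locally through $\operatorname{Spec}A\subset Y$, i.e. given by $\mu:A\to S$, $D_\mu$ is $a\mapsto\mu(a)+\epsilon\,\mu(Da)$). $\delta$ is the vector field on $\operatorname{Spec}K[x]^*$ given by the derivation $\delta$ of $K[x]^*$, $\delta(w)(q)=w(xq)$ for $q\in K[x]$ (the invariant field): in characteristic zero $\delta=\partial_z$, in characteristic $p>0$, $\delta=\partial_{x_0}+\frac{x_0^{p-1}}{(p-1)!}\partial_{x_1}+\frac{x_0^{p-1}x_1^{p-1}}{(p-1)!^2}\partial_{x_2}+\cdots$. $exp_{D,y}$, the analytic integral curve of $D$ through $y$: let $G_a^\vee(S)=\{\mu(x)\in S[x]:\mu(0)=1,\ \mu(x+x')=\mu(x)\mu(x')\}$ (a functor of abelian groups under multiplication, contained in $\operatorname{Spec}K[x]^*$ through $w\mapsto w(\mu)$). $exp_D:G_a^\vee\to\mathbb{E}nd\,X$ is the morphism of functors of monoids sending $\mu\in G_a^\vee(S)$ to the endomorphism of $X_S$ given on functions by $a\mapsto\mu(D)(a)$; $exp_{D,y}(\mu):=exp_D(\mu)(y)$ defines a morphism $G_a^\vee\to X$, which factors uniquely through a morphism $\operatorname{Spec}K[x]^*\to X$, again denoted $exp_{D,y}$. Explicitly, if $U=\operatorname{Spec}A$ is an affine open set containing $y$, $exp_{D,y}$ is the composite $\operatorname{Spec}K[x]^*\to U\subset X$ given by the ring morphism $A\to K[x]^*$, $a\mapsto\big(q(x)\mapsto (q(D)a)(y)\big)$. *)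

theory Defs
  imports "HOL-Algebra.UnivPoly" "HOL-Analysis.Abstract_Topology"
begin

section \<open>Locally ringed spaces\<close>

text \<open>
  The value of \<open>sec\<close> and \<open>res\<close> is meaningful on open sets only, and \<open>res X U V\<close> is
  the restriction from \<open>U\<close> to a smaller open set \<open>V\<close>.
\<close>

record ('a, 'b) ringed_space =
  space_of :: "'a topology"
  sec :: "'a set \<Rightarrow> 'b ring"
  res :: "'a set \<Rightarrow> 'a set \<Rightarrow> 'b \<Rightarrow> 'b"

abbreviation pts :: "('a, 'b, 'm) ringed_space_scheme \<Rightarrow> 'a set"
  where "pts X \<equiv> topspace (space_of X)"

abbreviation opn :: "('a, 'b, 'm) ringed_space_scheme \<Rightarrow> 'a set \<Rightarrow> bool"
  where "opn X \<equiv> openin (space_of X)"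

definition sheaf_of_rings :: "('a, 'b, 'm) ringed_space_scheme \<Rightarrow> bool" where
  "sheaf_of_rings X \<longleftrightarrow>
     (\<forall>U. opn X U \<longrightarrow> cring (sec X U)) \<and>
     (\<forall>U V. opn X U \<and> opn X V \<and> V \<subseteq> U \<longrightarrow> res X U V \<in> ring_hom (sec X U) (sec X V)) \<and>
     (\<forall>U. opn X U \<longrightarrow> (\<forall>s\<in>carrier (sec X U). res X U U s = s)) \<and>
     (\<forall>U V W. opn X U \<and> opn X V \<and> opn X W \<and> W \<subseteq> V \<and> V \<subseteq> U \<longrightarrow>
        (\<forall>s\<in>carrier (sec X U). res X V W (res X U V s) = res X U W s)) \<and>
     (\<forall>\<U>. (\<forall>U\<in>\<U>. opn X U) \<longrightarrow>
        (\<forall>s\<in>carrier (sec X (\<Union>\<U>)). \<forall>t\<in>carrier (sec X (\<Union>\<U>)).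
           (\<forall>U\<in>\<U>. res X (\<Union>\<U>) U s = res X (\<Union>\<U>) U t) \<longrightarrow> s = t)) \<and>
     (\<forall>\<U> \<sigma>. (\<forall>U\<in>\<U>. opn X U \<and> \<sigma> U \<in> carrier (sec X U)) \<and>
        (\<forall>U\<in>\<U>. \<forall>V\<in>\<U>. res X U (U \<inter> V) (\<sigma> U) = res X V (U \<inter> V) (\<sigma> V)) \<longrightarrow>
        (\<exists>s\<in>carrier (sec X (\<Union>\<U>)). \<forall>U\<in>\<U>. res X (\<Union>\<U>) U s = \<sigma> U))"

text \<open>A germ is the equivalence class of a pair of an open neighbourhood and a section on it.\<close>

definition germ ::
  "('a, 'b, 'm) ringed_space_scheme \<Rightarrow> 'a \<Rightarrow> 'a set \<Rightarrow> 'b \<Rightarrow> ('a set \<times> 'b) set" where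
  "germ X p U s = {(V, t). opn X V \<and> p \<in> V \<and> t \<in> carrier (sec X V) \<and>
     (\<exists>W. opn X W \<and> p \<in> W \<and> W \<subseteq> U \<inter> V \<and> res X U W s = res X V W t)}"

definition stalk :: "('a, 'b, 'm) ringed_space_scheme \<Rightarrow> 'a \<Rightarrow> ('a set \<times> 'b) set ring" where
  "stalk X p = \<lparr>
     carrier = {germ X p U s |U s. opn X U \<and> p \<in> U \<and> s \<in> carrier (sec X U)},
     mult = (\<lambda>g h. \<Union>(U, s)\<in>g. \<Union>(V, t)\<in>h.
        germ X p (U \<inter> V) (res X U (U \<inter> V) s \<otimes>\<^bsub>sec X (U \<inter> V)\<^esub> res X V (U \<inter> V) t)),
     one = germ X p (pts X) \<one>\<^bsub>sec X (pts X)\<^esub>,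
     zero = germ X p (pts X) \<zero>\<^bsub>sec X (pts X)\<^esub>,
     add = (\<lambda>g h. \<Union>(U, s)\<in>g. \<Union>(V, t)\<in>h.
        germ X p (U \<inter> V) (res X U (U \<inter> V) s \<oplus>\<^bsub>sec X (U \<inter> V)\<^esub> res X V (U \<inter> V) t))\<rparr>"

definition local_cring :: "('a, 'm) ring_scheme \<Rightarrow> bool" where
  "local_cring R \<longleftrightarrow> cring R \<and> (\<exists>!M. maximalideal M R)"

definition local_hom ::
  "('a, 'm) ring_scheme \<Rightarrow> ('b, 'n) ring_scheme \<Rightarrow> ('a \<Rightarrow> 'b) \<Rightarrow> bool" where
  "local_hom A B h \<longleftrightarrow> h \<in> ring_hom A B \<and>
     (\<forall>M N. maximalideal M A \<and> maximalideal N B \<longrightarrow> h ` M \<subseteq> N)"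

definition locally_ringed_space :: "('a, 'b, 'm) ringed_space_scheme \<Rightarrow> bool" where
  "locally_ringed_space X \<longleftrightarrow> sheaf_of_rings X \<and> (\<forall>p\<in>pts X. local_cring (stalk X p))"

text \<open>
  A morphism consists of a map on points and, for each open set \<open>V\<close> of the target, a map
  \<open>co f V\<close> from the sections over \<open>V\<close> to the sections over the preimage of \<open>V\<close>.
\<close>

record ('a, 'b, 'c, 'd) lrs_map =
  pt :: "'a \<Rightarrow> 'c"
  co :: "'c set \<Rightarrow> 'd \<Rightarrow> 'b"

definition preim ::
  "('a, 'b, 'm) ringed_space_scheme \<Rightarrow> ('a, 'b, 'c, 'd) lrs_map \<Rightarrow> 'c set \<Rightarrow> 'a set" where
  "preim X f V = {p \<in> pts X. pt f p \<in> V}"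

definition stalk_map ::
  "('a, 'b, 'm) ringed_space_scheme \<Rightarrow> ('a, 'b, 'c, 'd) lrs_map \<Rightarrow> 'a
     \<Rightarrow> ('c set \<times> 'd) set \<Rightarrow> ('a set \<times> 'b) set" where
  "stalk_map X f p g = (\<Union>(V, t)\<in>g. germ X p (preim X f V) (co f V t))"

definition lrs_morphism ::
  "('a, 'b, 'm) ringed_space_scheme \<Rightarrow> ('c, 'd, 'n) ringed_space_scheme
     \<Rightarrow> ('a, 'b, 'c, 'd) lrs_map \<Rightarrow> bool" where
  "lrs_morphism X Y f \<longleftrightarrow>
     continuous_map (space_of X) (space_of Y) (pt f) \<and>
     (\<forall>V. opn Y V \<longrightarrow> co f V \<in> ring_hom (sec Y V) (sec X (preim X f V))) \<and>
     (\<forall>V W. opn Y V \<and> opn Y W \<and> W \<subseteq> V \<longrightarrow>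
        (\<forall>s\<in>carrier (sec Y V).
           co f W (res Y V W s) = res X (preim X f V) (preim X f W) (co f V s))) \<and>
     (\<forall>p\<in>pts X. local_hom (stalk Y (pt f p)) (stalk X p) (stalk_map X f p))"

text \<open>
  Equality of morphisms from \<open>X\<close> to \<open>Y\<close>, disregarding the values of the representing HOL
  functions outside the points, open sets and sections.
\<close>

definition eq_map ::
  "('a, 'b, 'm) ringed_space_scheme \<Rightarrow> ('c, 'd, 'n) ringed_space_scheme
     \<Rightarrow> ('a, 'b, 'c, 'd) lrs_map \<Rightarrow> ('a, 'b, 'c, 'd) lrs_map \<Rightarrow> bool" where
  "eq_map X Y f g \<longleftrightarrow> (\<forall>p\<in>pts X. pt f p = pt g p) \<and>
     (\<forall>V. opn Y V \<longrightarrow> (\<forall>s\<in>carrier (sec Y V). co f V s = co g V s))"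

definition id_map :: "('a, 'b, 'a, 'b) lrs_map" where
  "id_map = \<lparr>pt = (\<lambda>p. p), co = (\<lambda>_ s. s)\<rparr>"

text \<open>\<open>comp_map Y g f\<close> is \<open>g\<close> after \<open>f\<close>, where \<open>Y\<close> is the target of \<open>f\<close> and the source of \<open>g\<close>.\<close>

definition comp_map ::
  "('c, 'd, 'm) ringed_space_scheme \<Rightarrow> ('c, 'd, 'e, 'f) lrs_map \<Rightarrow> ('a, 'b, 'c, 'd) lrs_map
     \<Rightarrow> ('a, 'b, 'e, 'f) lrs_map" where
  "comp_map Y g f = \<lparr>pt = (\<lambda>p. pt g (pt f p)), co = (\<lambda>V s. co f (preim Y g V) (co g V s))\<rparr>"

definition open_sub ::
  "('a, 'b, 'm) ringed_space_scheme \<Rightarrow> 'a set \<Rightarrow> ('a, 'b) ringed_space" where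
  "open_sub X U = \<lparr>space_of = subtopology (space_of X) U, sec = sec X, res = res X\<rparr>"

definition incl_map ::
  "('a, 'b, 'm) ringed_space_scheme \<Rightarrow> 'a set \<Rightarrow> ('a, 'b, 'a, 'b) lrs_map" where
  "incl_map X U = \<lparr>pt = (\<lambda>p. p), co = (\<lambda>V. res X V (U \<inter> V))\<rparr>"


section \<open>Localization and the spectrum of a ring\<close>

text \<open>\<open>fraction R M a s\<close> is the fraction \<open>a/s\<close> in the localization of \<open>R\<close> at the multiplicative set \<open>M\<close>.\<close>

definition fraction :: "('r, 'm) ring_scheme \<Rightarrow> 'r set \<Rightarrow> 'r \<Rightarrow> 'r \<Rightarrow> ('r \<times> 'r) set" where
  "fraction R M a s = {(b, t). b \<in> carrier R \<and> t \<in> M \<and>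
     (\<exists>u\<in>M. u \<otimes>\<^bsub>R\<^esub> (t \<otimes>\<^bsub>R\<^esub> a \<ominus>\<^bsub>R\<^esub> s \<otimes>\<^bsub>R\<^esub> b) = \<zero>\<^bsub>R\<^esub>)}"

definition localize :: "('r, 'm) ring_scheme \<Rightarrow> 'r set \<Rightarrow> ('r \<times> 'r) set ring" where
  "localize R M = \<lparr>
     carrier = {fraction R M a s |a s. a \<in> carrier R \<and> s \<in> M},
     mult = (\<lambda>x y. \<Union>(a, s)\<in>x. \<Union>(b, t)\<in>y. fraction R M (a \<otimes>\<^bsub>R\<^esub> b) (s \<otimes>\<^bsub>R\<^esub> t)),
     one = fraction R M \<one>\<^bsub>R\<^esub> \<one>\<^bsub>R\<^esub>,
     zero = fraction R M \<zero>\<^bsub>R\<^esub> \<one>\<^bsub>R\<^esub>,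
     add = (\<lambda>x y. \<Union>(a, s)\<in>x. \<Union>(b, t)\<in>y.
        fraction R M (t \<otimes>\<^bsub>R\<^esub> a \<oplus>\<^bsub>R\<^esub> s \<otimes>\<^bsub>R\<^esub> b) (s \<otimes>\<^bsub>R\<^esub> t))\<rparr>"

abbreviation fraction_at :: "('r, 'm) ring_scheme \<Rightarrow> 'r set \<Rightarrow> 'r \<Rightarrow> 'r \<Rightarrow> ('r \<times> 'r) set" where
  "fraction_at R P \<equiv> fraction R (carrier R - P)"

abbreviation localize_at :: "('r, 'm) ring_scheme \<Rightarrow> 'r set \<Rightarrow> ('r \<times> 'r) set ring" where
  "localize_at R P \<equiv> localize R (carrier R - P)"

definition zariski :: "('r, 'm) ring_scheme \<Rightarrow> 'r set topology" where
  "zariski R = topology_generated_by {{P. primeideal P R \<and> a \<notin> P} |a. a \<in> carrier R}"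

text \<open>
  Sections over \<open>U\<close> are functions \<open>\<sigma>\<close> on \<open>U\<close>, with \<open>\<sigma> P\<close> in the local ring at \<open>P\<close>, that are
  locally given by one fraction.
\<close>

definition spec_sec :: "('r, 'm) ring_scheme \<Rightarrow> 'r set set \<Rightarrow> ('r set \<Rightarrow> ('r \<times> 'r) set) ring" where
  "spec_sec R U = \<lparr>
     carrier = {\<sigma> \<in> (\<Pi>\<^sub>E P\<in>U. carrier (localize_at R P)).
        \<forall>P\<in>U. \<exists>V a s. openin (zariski R) V \<and> P \<in> V \<and> V \<subseteq> U \<and> a \<in> carrier R \<and> s \<in> carrier R \<and>
          (\<forall>Q\<in>V. s \<notin> Q \<and> \<sigma> Q = fraction_at R Q a s)},
     mult = (\<lambda>\<sigma> \<tau>. \<lambda>P\<in>U. \<sigma> P \<otimes>\<^bsub>localize_at R P\<^esub> \<tau> P),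
     one = (\<lambda>P\<in>U. \<one>\<^bsub>localize_at R P\<^esub>),
     zero = (\<lambda>P\<in>U. \<zero>\<^bsub>localize_at R P\<^esub>),
     add = (\<lambda>\<sigma> \<tau>. \<lambda>P\<in>U. \<sigma> P \<oplus>\<^bsub>localize_at R P\<^esub> \<tau> P)\<rparr>"

definition spec :: "('r, 'm) ring_scheme \<Rightarrow> ('r set, 'r set \<Rightarrow> ('r \<times> 'r) set) ringed_space" where
  "spec R = \<lparr>space_of = zariski R, sec = spec_sec R, res = (\<lambda>U V \<sigma>. restrict \<sigma> V)\<rparr>"

type_synonym ('r, 's) spec_map =
  "('r set, 'r set \<Rightarrow> ('r \<times> 'r) set, 's set, 's set \<Rightarrow> ('s \<times> 's) set) lrs_map"

text \<open>The morphism \<open>spec B \<rightarrow> spec A\<close> induced by a ring homomorphism \<open>\<phi>: A \<rightarrow> B\<close>.\<close>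

definition spec_map ::
  "('s, 'm) ring_scheme \<Rightarrow> ('r, 'n) ring_scheme \<Rightarrow> ('s \<Rightarrow> 'r) \<Rightarrow> ('r, 's) spec_map" where
  "spec_map A B \<phi> = \<lparr>
     pt = (\<lambda>P. {a \<in> carrier A. \<phi> a \<in> P}),
     co = (\<lambda>V \<sigma>. \<lambda>P\<in>{P \<in> pts (spec B). {a \<in> carrier A. \<phi> a \<in> P} \<in> V}.
        \<Union>(a, s)\<in>\<sigma> {a \<in> carrier A. \<phi> a \<in> P}. fraction_at B P (\<phi> a) (\<phi> s))\<rparr>"

definition spec_const ::
  "('r, 'm) ring_scheme \<Rightarrow> 'r set set \<Rightarrow> 'r \<Rightarrow> 'r set \<Rightarrow> ('r \<times> 'r) set" where
  "spec_const R U a = (\<lambda>P\<in>U. fraction_at R P a \<one>\<^bsub>R\<^esub>)"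

text \<open>
  \<open>affine_chart X U A \<theta> \<theta>'\<close> identifies the open subspace \<open>U\<close> with \<open>spec A\<close>.  In
  \<open>scheme\<close> below it is no restriction that \<open>A\<close> has the same element type as the sections
  of \<open>X\<close>, because \<open>A\<close> is isomorphic to the ring of sections over \<open>U\<close>.
\<close>

definition affine_chart ::
  "('a, 'b, 'm) ringed_space_scheme \<Rightarrow> 'a set \<Rightarrow> 'r ring
     \<Rightarrow> ('a, 'b, 'r set, 'r set \<Rightarrow> ('r \<times> 'r) set) lrs_map
     \<Rightarrow> ('r set, 'r set \<Rightarrow> ('r \<times> 'r) set, 'a, 'b) lrs_map \<Rightarrow> bool" where
  "affine_chart X U A \<theta> \<theta>' \<longleftrightarrow> opn X U \<and> cring A \<and>
     lrs_morphism (open_sub X U) (spec A) \<theta> \<and> lrs_morphism (spec A) (open_sub X U) \<theta>' \<and>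
     eq_map (open_sub X U) (open_sub X U) (comp_map (spec A) \<theta>' \<theta>) id_map \<and>
     eq_map (spec A) (spec A) (comp_map (open_sub X U) \<theta> \<theta>') id_map"

definition scheme :: "('a, 'b, 'm) ringed_space_scheme \<Rightarrow> bool" where
  "scheme X \<longleftrightarrow> locally_ringed_space X \<and>
     (\<forall>p\<in>pts X. \<exists>U (A :: 'b ring) \<theta> \<theta>'. p \<in> U \<and> affine_chart X U A \<theta> \<theta>')"


section \<open>Schemes over a field\<close>

record ('a, 'b, 'k) space_over = "('a, 'b) ringed_space" +
  str :: "('a, 'b, 'k set, 'k set \<Rightarrow> ('k \<times> 'k) set) lrs_map"

definition with_str ::
  "('a, 'b) ringed_space \<Rightarrow> ('a, 'b, 'k set, 'k set \<Rightarrow> ('k \<times> 'k) set) lrs_map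
     \<Rightarrow> ('a, 'b, 'k) space_over" where
  "with_str X \<pi> = \<lparr>space_of = space_of X, sec = sec X, res = res X, str = \<pi>\<rparr>"

definition scheme_over :: "'k ring \<Rightarrow> ('a, 'b, 'k) space_over \<Rightarrow> bool" where
  "scheme_over K X \<longleftrightarrow> scheme X \<and> lrs_morphism X (spec K) (str X)"

definition morphism_over ::
  "'k ring \<Rightarrow> ('a, 'b, 'k) space_over \<Rightarrow> ('c, 'd, 'k) space_over
     \<Rightarrow> ('a, 'b, 'c, 'd) lrs_map \<Rightarrow> bool" where
  "morphism_over K X Y f \<longleftrightarrow> lrs_morphism X Y f \<and>
     eq_map X (spec K) (comp_map Y (str Y) f) (str X)"

definition base_scheme :: "'k ring \<Rightarrow> ('k set, 'k set \<Rightarrow> ('k \<times> 'k) set, 'k) space_over" where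
  "base_scheme K = with_str (spec K) id_map"

definition spec_over ::
  "'k ring \<Rightarrow> ('k, 's, 'm) module_scheme \<Rightarrow> ('s set, 's set \<Rightarrow> ('s \<times> 's) set, 'k) space_over" where
  "spec_over K S = with_str (spec S) (spec_map K S (\<lambda>c. c \<odot>\<^bsub>S\<^esub> \<one>\<^bsub>S\<^esub>))"

text \<open>The image of a scalar in the sections over \<open>U\<close> under the structure morphism.\<close>

definition scalar :: "'k ring \<Rightarrow> ('a, 'b, 'k) space_over \<Rightarrow> 'a set \<Rightarrow> 'k \<Rightarrow> 'b" where
  "scalar K X U c = res X (pts X) U (co (str X) (pts (spec K)) (spec_const K (pts (spec K)) c))"

text \<open>A rational point is given as a \<open>K\<close>-valued point.\<close>

abbreviation rational_point ::
  "'k ring \<Rightarrow> ('a, 'b, 'k) space_over \<Rightarrow> ('k set, 'k set \<Rightarrow> ('k \<times> 'k) set, 'a, 'b) lrs_map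
     \<Rightarrow> bool" where
  "rational_point K X y \<equiv> morphism_over K (base_scheme K) X y"

definition value_at ::
  "'k ring \<Rightarrow> ('k set, 'k set \<Rightarrow> ('k \<times> 'k) set, 'a, 'b) lrs_map \<Rightarrow> 'a set \<Rightarrow> 'b \<Rightarrow> 'k" where
  "value_at K y U a =
     (THE c. c \<in> carrier K \<and> co y U a = spec_const K (preim (spec K) y U) c)"


section \<open>Vector fields\<close>

definition vector_field ::
  "'k ring \<Rightarrow> ('a, 'b, 'k) space_over \<Rightarrow> ('a set \<Rightarrow> 'b \<Rightarrow> 'b) \<Rightarrow> bool" where
  "vector_field K X D \<longleftrightarrow>
     (\<forall>U. opn X U \<longrightarrow>
        D U \<in> carrier (sec X U) \<rightarrow> carrier (sec X U) \<and>
        (\<forall>a\<in>carrier (sec X U). \<forall>b\<in>carrier (sec X U).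
           D U (a \<oplus>\<^bsub>sec X U\<^esub> b) = D U a \<oplus>\<^bsub>sec X U\<^esub> D U b \<and>
           D U (a \<otimes>\<^bsub>sec X U\<^esub> b) = a \<otimes>\<^bsub>sec X U\<^esub> D U b \<oplus>\<^bsub>sec X U\<^esub> D U a \<otimes>\<^bsub>sec X U\<^esub> b) \<and>
        (\<forall>c\<in>carrier K. \<forall>a\<in>carrier (sec X U).
           D U (scalar K X U c \<otimes>\<^bsub>sec X U\<^esub> a) = scalar K X U c \<otimes>\<^bsub>sec X U\<^esub> D U a)) \<and>
     (\<forall>U V. opn X U \<and> opn X V \<and> V \<subseteq> U \<longrightarrow>
        (\<forall>a\<in>carrier (sec X U). D V (res X U V a) = res X U V (D U a)))"

text \<open>The vector field on \<open>spec R\<close> given by a derivation \<open>d\<close> of \<open>R\<close>, via the quotient rule.\<close>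

definition spec_vector_field ::
  "('r, 'm) ring_scheme \<Rightarrow> ('r \<Rightarrow> 'r) \<Rightarrow> 'r set set
     \<Rightarrow> ('r set \<Rightarrow> ('r \<times> 'r) set) \<Rightarrow> 'r set \<Rightarrow> ('r \<times> 'r) set" where
  "spec_vector_field R d U \<sigma> = (\<lambda>P\<in>U.
     \<Union>(a, s)\<in>\<sigma> P. fraction_at R P (s \<otimes>\<^bsub>R\<^esub> d a \<ominus>\<^bsub>R\<^esub> a \<otimes>\<^bsub>R\<^esub> d s) (s \<otimes>\<^bsub>R\<^esub> s))"

text \<open>\<open>(a, b)\<close> stands for \<open>a + b\<epsilon>\<close>.\<close>

definition dual_numbers :: "('k, 's, 'm) module_scheme \<Rightarrow> ('k, 's \<times> 's) module" where
  "dual_numbers S = \<lparr>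
     carrier = carrier S \<times> carrier S,
     mult = (\<lambda>(a, b) (c, d). (a \<otimes>\<^bsub>S\<^esub> c, a \<otimes>\<^bsub>S\<^esub> d \<oplus>\<^bsub>S\<^esub> b \<otimes>\<^bsub>S\<^esub> c)),
     one = (\<one>\<^bsub>S\<^esub>, \<zero>\<^bsub>S\<^esub>),
     zero = (\<zero>\<^bsub>S\<^esub>, \<zero>\<^bsub>S\<^esub>),
     add = (\<lambda>(a, b) (c, d). (a \<oplus>\<^bsub>S\<^esub> c, b \<oplus>\<^bsub>S\<^esub> d)),
     smult = (\<lambda>c (a, b). (c \<odot>\<^bsub>S\<^esub> a, c \<odot>\<^bsub>S\<^esub> b))\<rparr>"

text \<open>
  The tangent vector \<open>D\<^sub>\<mu>\<close> at \<open>\<mu> : spec S \<rightarrow> Y\<close>, as a morphism \<open>spec S[\<epsilon>] \<rightarrow> Y\<close>: on sections it is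
  \<open>a \<mapsto> \<mu>(a) + \<epsilon> \<mu>(D a)\<close>, on points it is \<open>\<mu>\<close> after the homeomorphism \<open>\<rho>\<close> induced by the inclusion
  of \<open>S\<close> into \<open>S[\<epsilon>]\<close>.
\<close>

definition tangent_at ::
  "('k, 's) module \<Rightarrow> ('a set \<Rightarrow> 'b \<Rightarrow> 'b) \<Rightarrow> ('s set, 's set \<Rightarrow> ('s \<times> 's) set, 'a, 'b) lrs_map
     \<Rightarrow> (('s \<times> 's) set, ('s \<times> 's) set \<Rightarrow> (('s \<times> 's) \<times> ('s \<times> 's)) set, 'a, 'b) lrs_map" where
  "tangent_at S D \<mu> =
     (let E = dual_numbers S; \<rho> = spec_map S E (\<lambda>s. (s, \<zero>\<^bsub>S\<^esub>)) in
      \<lparr>pt = (\<lambda>P. pt \<mu> (pt \<rho> P)),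
       co = (\<lambda>V a. let W = preim (spec S) \<mu> V; W' = preim (spec E) \<rho> W in
          co \<rho> W (co \<mu> V a) \<oplus>\<^bsub>sec (spec E) W'\<^esub>
          spec_const E W' (\<zero>\<^bsub>S\<^esub>, \<one>\<^bsub>S\<^esub>) \<otimes>\<^bsub>sec (spec E) W'\<^esub> co \<rho> W (co \<mu> V (D V a)))\<rparr>)"


section \<open>The dual of the polynomial ring\<close>

definition xpow :: "'k ring \<Rightarrow> nat \<Rightarrow> nat \<Rightarrow> 'k" where
  "xpow K n = monom (UP K) \<one>\<^bsub>K\<^esub> n"

definition poly_dual :: "'k ring \<Rightarrow> ('k, (nat \<Rightarrow> 'k) \<Rightarrow> 'k) module" where
  "poly_dual K = \<lparr>
     carrier = {w \<in> carrier (UP K) \<rightarrow>\<^sub>E carrier K.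
        (\<forall>p\<in>carrier (UP K). \<forall>q\<in>carrier (UP K). w (p \<oplus>\<^bsub>UP K\<^esub> q) = w p \<oplus>\<^bsub>K\<^esub> w q) \<and>
        (\<forall>c\<in>carrier K. \<forall>p\<in>carrier (UP K). w (c \<odot>\<^bsub>UP K\<^esub> p) = c \<otimes>\<^bsub>K\<^esub> w p)},
     mult = (\<lambda>w w'. \<lambda>q\<in>carrier (UP K). \<Oplus>\<^bsub>K\<^esub>n\<in>{..deg K q}. coeff (UP K) q n \<otimes>\<^bsub>K\<^esub>
        (\<Oplus>\<^bsub>K\<^esub>i\<in>{..n}. add_pow K (n choose i) (w (xpow K i) \<otimes>\<^bsub>K\<^esub> w' (xpow K (n - i))))),
     one = (\<lambda>q\<in>carrier (UP K). coeff (UP K) q 0),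
     zero = (\<lambda>q\<in>carrier (UP K). \<zero>\<^bsub>K\<^esub>),
     add = (\<lambda>w w'. \<lambda>q\<in>carrier (UP K). w q \<oplus>\<^bsub>K\<^esub> w' q),
     smult = (\<lambda>c w. \<lambda>q\<in>carrier (UP K). c \<otimes>\<^bsub>K\<^esub> w q)\<rparr>"

definition dual_der :: "'k ring \<Rightarrow> ((nat \<Rightarrow> 'k) \<Rightarrow> 'k) \<Rightarrow> (nat \<Rightarrow> 'k) \<Rightarrow> 'k" where
  "dual_der K w = (\<lambda>q\<in>carrier (UP K). w (xpow K 1 \<otimes>\<^bsub>UP K\<^esub> q))"

abbreviation dual_space ::
  "'k ring \<Rightarrow> (((nat \<Rightarrow> 'k) \<Rightarrow> 'k) set,
     ((nat \<Rightarrow> 'k) \<Rightarrow> 'k) set \<Rightarrow> (((nat \<Rightarrow> 'k) \<Rightarrow> 'k) \<times> ((nat \<Rightarrow> 'k) \<Rightarrow> 'k)) set, 'k) space_over" where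
  "dual_space K \<equiv> spec_over K (poly_dual K)"

definition invariant_field ::
  "'k ring \<Rightarrow> ((nat \<Rightarrow> 'k) \<Rightarrow> 'k) set set
     \<Rightarrow> (((nat \<Rightarrow> 'k) \<Rightarrow> 'k) set \<Rightarrow> (((nat \<Rightarrow> 'k) \<Rightarrow> 'k) \<times> ((nat \<Rightarrow> 'k) \<Rightarrow> 'k)) set)
     \<Rightarrow> ((nat \<Rightarrow> 'k) \<Rightarrow> 'k) set \<Rightarrow> (((nat \<Rightarrow> 'k) \<Rightarrow> 'k) \<times> ((nat \<Rightarrow> 'k) \<Rightarrow> 'k)) set" where
  "invariant_field K = spec_vector_field (poly_dual K) (dual_der K)"

definition origin :: "'k ring \<Rightarrow> ('k, (nat \<Rightarrow> 'k) \<Rightarrow> 'k) spec_map" where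
  "origin K = spec_map (poly_dual K) K (\<lambda>w. w \<one>\<^bsub>UP K\<^esub>)"


section \<open>Analytic integral curves\<close>

definition poly_of_field ::
  "'k ring \<Rightarrow> ('a, 'b, 'k) space_over \<Rightarrow> ('a set \<Rightarrow> 'b \<Rightarrow> 'b) \<Rightarrow> 'a set \<Rightarrow> (nat \<Rightarrow> 'k) \<Rightarrow> 'b \<Rightarrow> 'b" where
  "poly_of_field K X D U q a =
     (\<Oplus>\<^bsub>sec X U\<^esub>n\<in>{..deg K q}. scalar K X U (coeff (UP K) q n) \<otimes>\<^bsub>sec X U\<^esub> (D U ^^ n) a)"

text \<open>
  The composite \<open>Spec K[x]\<^sup>* \<rightarrow> spec A \<rightarrow> U \<rightarrow> X\<close> whose first arrow is given by the ring
  morphism \<open>a \<mapsto> (q \<mapsto> (q(D) a)(y))\<close>; here \<open>a\<close> is viewed as a section over \<open>U\<close> by means of \<open>\<theta>\<close>.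
\<close>

definition exp_on ::
  "'k ring \<Rightarrow> ('a, 'b, 'k) space_over \<Rightarrow> ('a set \<Rightarrow> 'b \<Rightarrow> 'b)
     \<Rightarrow> ('k set, 'k set \<Rightarrow> ('k \<times> 'k) set, 'a, 'b) lrs_map
     \<Rightarrow> 'a set \<Rightarrow> 'r ring
     \<Rightarrow> ('a, 'b, 'r set, 'r set \<Rightarrow> ('r \<times> 'r) set) lrs_map
     \<Rightarrow> ('r set, 'r set \<Rightarrow> ('r \<times> 'r) set, 'a, 'b) lrs_map
     \<Rightarrow> (((nat \<Rightarrow> 'k) \<Rightarrow> 'k) set,
         ((nat \<Rightarrow> 'k) \<Rightarrow> 'k) set \<Rightarrow> (((nat \<Rightarrow> 'k) \<Rightarrow> 'k) \<times> ((nat \<Rightarrow> 'k) \<Rightarrow> 'k)) set, 'a, 'b) lrs_map" where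
  "exp_on K X D y U A \<theta> \<theta>' =
     comp_map (open_sub X U) (incl_map X U) (comp_map (spec A) \<theta>'
       (spec_map A (poly_dual K) (\<lambda>a. \<lambda>q\<in>carrier (UP K).
          value_at K y U (poly_of_field K X D U q
            (co \<theta> (pts (spec A)) (spec_const A (pts (spec A)) a))))))"

text \<open>\<open>exp\<^bsub>D,y\<^esub>\<close>: the morphism equal to the above composite for every affine chart around \<open>y\<close>.\<close>

definition exp_curve ::
  "'k ring \<Rightarrow> ('a, 'b, 'k) space_over \<Rightarrow> ('a set \<Rightarrow> 'b \<Rightarrow> 'b)
     \<Rightarrow> ('k set, 'k set \<Rightarrow> ('k \<times> 'k) set, 'a, 'b) lrs_map
     \<Rightarrow> (((nat \<Rightarrow> 'k) \<Rightarrow> 'k) set,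
         ((nat \<Rightarrow> 'k) \<Rightarrow> 'k) set \<Rightarrow> (((nat \<Rightarrow> 'k) \<Rightarrow> 'k) \<times> ((nat \<Rightarrow> 'k) \<Rightarrow> 'k)) set, 'a, 'b) lrs_map" where
  "exp_curve K X D y = (SOME e. \<forall>U (A :: 'b ring) \<theta> \<theta>'.
     affine_chart X U A \<theta> \<theta>' \<and> pt y ` pts (base_scheme K) \<subseteq> U \<longrightarrow>
     eq_map (dual_space K) X e (exp_on K X D y U A \<theta> \<theta>'))"

text \<open>
  The conditions \<open>f(0) = y\<close> and \<open>f(\<delta>\<^sub>\<mu>) = D\<^bsub>f(\<mu>)\<^esub>\<close> on a morphism \<open>f : Spec K[x]\<^sup>* \<rightarrow> X\<close>.  HOL cannot
  quantify over types within a formula, so the element type \<open>'s\<close> of the algebras \<open>S\<close> is a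
  parameter: a property of a given curve is stated for every \<open>'s\<close>, while a hypothesis on a curve is
  needed only for one \<open>'s\<close>, for instance the element type of \<open>K[x]\<^sup>*\<close>.
\<close>

definition integral_curve ::
  "'s itself \<Rightarrow> 'k ring \<Rightarrow> ('a, 'b, 'k) space_over \<Rightarrow> ('a set \<Rightarrow> 'b \<Rightarrow> 'b)
     \<Rightarrow> ('k set, 'k set \<Rightarrow> ('k \<times> 'k) set, 'a, 'b) lrs_map
     \<Rightarrow> (((nat \<Rightarrow> 'k) \<Rightarrow> 'k) set,
         ((nat \<Rightarrow> 'k) \<Rightarrow> 'k) set \<Rightarrow> (((nat \<Rightarrow> 'k) \<Rightarrow> 'k) \<times> ((nat \<Rightarrow> 'k) \<Rightarrow> 'k)) set, 'a, 'b) lrs_map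
     \<Rightarrow> bool" where
  "integral_curve _ K X D y f \<longleftrightarrow>
     morphism_over K (dual_space K) X f \<and>
     eq_map (base_scheme K) X (comp_map (dual_space K) f (origin K)) y \<and>
     (\<forall>(S :: ('k, 's) module) \<mu>.
        algebra K S \<and> morphism_over K (spec_over K S) (dual_space K) \<mu> \<longrightarrow>
        eq_map (spec_over K (dual_numbers S)) X
          (comp_map (dual_space K) f (tangent_at S (invariant_field K) \<mu>))
          (tangent_at S D (comp_map (dual_space K) f \<mu>)))"

end

theory Submission
  imports Defs "HOL-Algebra.Ring_Divisibility"
begin

text \<open>
  The ring \<open>B = K[x]\<^sup>*\<close> is local, with maximal ideal \<open>m0\<close> the kernel of \<open>w \<mapsto> w(1)\<close>, so every
  neighbourhood of the closed point \<open>0\<close> of \<open>Spec B\<close> is the whole of \<open>Spec B\<close>, and a morphism \<open>f\<close>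
  with \<open>f(0) = y\<close> factors through every neighbourhood \<open>U\<close> of \<open>y\<close>.  The tangent vector condition for
  all points \<open>\<mu>\<close> amounts to \<open>\<delta>(f\<^sup>*a) = f\<^sup>*(D a)\<close> for all sections \<open>a\<close>, and it suffices to test the
  identity point of \<open>Spec B\<close>.  An element \<open>w\<close> of \<open>B\<close> is determined by the scalars
  \<open>w(x\<^sup>n) = (\<delta>\<^sup>n w)(1)\<close>, whence \<open>(f\<^sup>*a)(x\<^sup>n) = (f\<^sup>*(D\<^sup>n a))(1) = (D\<^sup>n a)(y)\<close>.  This
  determines \<open>f\<^sup>*\<close> on an affine \<open>U\<close>, hence \<open>f\<close>, and the same formula defines the curve: it is a
  ring homomorphism by the Leibniz rule and intertwines \<open>D\<close> and \<open>\<delta>\<close> on \<open>U\<close>, hence on fractions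
  by the quotient rule.
\<close>

section \<open>Localization\<close>

text \<open>Two obstacles shape the proof. In positive characteristic one cannot divide by
  factorials, so an element of \<open>B\<close> is handled through its sequence of values at the
  monomials: the product becomes the binomial convolution \<open>conv\<close>, whose laws rest on
  one Leibniz recursion, and inversion divides only by the value at \<open>1\<close>. The second
  obstacle is locality, which \<open>lrs_morphism\<close> states through maximal ideals of stalks.
  It is traded for \<open>reflects\<close>: a section whose pullback is invertible near a point is
  invertible near the image point. For maps out of a spectrum the two agree, because its stalks are
  nontrivial and their non-units are closed under addition. In this form locality also governs
  points: in an affine chart the prime of a point consists of the functions that are not invertible
  there. Hence a map from a spectrum into a chart is determined by its effect on functions, all
  other sections being locally fractions of them. Uniqueness serves a second time at the end: curves
  built in different charts agree by it, which makes the choice in \<open>exp_curve\<close>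
  meaningful.\<close>

lemma (in abelian_group) minus_eq_zero_iff:
  assumes "x \<in> carrier G" "y \<in> carrier G"
  shows "x \<ominus> y = \<zero> \<longleftrightarrow> x = y"
proof
  assume "x \<ominus> y = \<zero>"
  then have "\<ominus> (\<ominus> y) = x" using assms by (intro minus_equality) (simp_all add: minus_eq)
  then show "x = y" using assms by simp
qed (use assms in \<open>simp add: minus_eq r_neg\<close>)

locale mult_set = cring R for R (structure) +
  fixes M
  assumes M_sub: "M \<subseteq> carrier R"
    and M_one: "\<one> \<in> M"
    and M_mult: "\<lbrakk>s \<in> M; t \<in> M\<rbrakk> \<Longrightarrow> s \<otimes> t \<in> M"
begin

lemma M_closed: "s \<in> M \<Longrightarrow> s \<in> carrier R"
  using M_sub by blast

text \<open>
  Not a global simplification rule: it loops when \<open>M\<close> is instantiated with a complement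
  \<open>carrier R - P\<close>.
\<close>

context
  notes M_closed [simp]
begin

text \<open>Turning the vanishing difference of the definition into an equation makes the relation
  visibly symmetric in the two fractions and keeps later computations free of subtraction.\<close>

lemma mem_fraction_iff:
  assumes "a \<in> carrier R" "s \<in> M"
  shows "(b, t) \<in> fraction R M a s \<longleftrightarrow>
    b \<in> carrier R \<and> t \<in> M \<and> (\<exists>u\<in>M. u \<otimes> (t \<otimes> a) = u \<otimes> (s \<otimes> b))"
proof -
  have "u \<otimes> (t \<otimes> a \<ominus> s \<otimes> b) = \<zero> \<longleftrightarrow> u \<otimes> (t \<otimes> a) = u \<otimes> (s \<otimes> b)"
    if "u \<in> M" "t \<in> M" "b \<in> carrier R" for u
  proof -
    have "u \<otimes> (t \<otimes> a \<ominus> s \<otimes> b) = u \<otimes> (t \<otimes> a) \<ominus> u \<otimes> (s \<otimes> b)"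
      using that assms by (simp add: a_minus_def r_distr r_minus)
    then show ?thesis using that assms by (simp add: minus_eq_zero_iff)
  qed
  then show ?thesis by (auto simp: fraction_def)
qed

lemma fraction_self: "\<lbrakk>a \<in> carrier R; s \<in> M\<rbrakk> \<Longrightarrow> (a, s) \<in> fraction R M a s"
  using M_one by (auto simp: mem_fraction_iff)

text \<open>This is transitivity of the fraction relation. One inclusion is enough, since the
  hypothesis is symmetric in the two fractions and swapping them gives the other.\<close>

lemma fraction_subset:
  assumes "a \<in> carrier R" "b \<in> carrier R" "s \<in> M" "t \<in> M" "u \<in> M"
    and eq: "u \<otimes> (t \<otimes> a) = u \<otimes> (s \<otimes> b)"
  shows "fraction R M a s \<subseteq> fraction R M b t"
proof safe
  fix c v assume cv: "(c, v) \<in> fraction R M a s"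
  then obtain w where w: "c \<in> carrier R" "v \<in> M" "w \<in> M" "w \<otimes> (v \<otimes> a) = w \<otimes> (s \<otimes> c)"
    using assms by (auto simp: mem_fraction_iff)
  \<comment> \<open>The multiplier \<open>w \<otimes> u \<otimes> s\<close> combines those of the
    two given equations with the middle denominator \<open>s\<close>, through which the comparison
    passes.\<close>
  have "(w \<otimes> u \<otimes> s) \<otimes> (v \<otimes> b) = (w \<otimes> v) \<otimes> (u \<otimes> (s \<otimes> b))"
    using w(1-3) assms(1-5) by (simp add: m_ac)
  also have "\<dots> = (w \<otimes> v) \<otimes> (u \<otimes> (t \<otimes> a))" by (simp add: eq)
  also have "\<dots> = (u \<otimes> t) \<otimes> (w \<otimes> (v \<otimes> a))" using w(1-3) assms(1-5) by (simp add: m_ac)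
  also have "\<dots> = (u \<otimes> t) \<otimes> (w \<otimes> (s \<otimes> c))" by (simp add: w)
  also have "\<dots> = (w \<otimes> u \<otimes> s) \<otimes> (t \<otimes> c)" using w(1-3) assms(1-5) by (simp add: m_ac)
  finally show "(c, v) \<in> fraction R M b t"
    using w assms M_mult by (auto simp: mem_fraction_iff)
qed

lemma fraction_eqI:
  assumes "a \<in> carrier R" "b \<in> carrier R" "s \<in> M" "t \<in> M" "u \<in> M"
    and eq: "u \<otimes> (t \<otimes> a) = u \<otimes> (s \<otimes> b)"
  shows "fraction R M a s = fraction R M b t"
  using fraction_subset[of a b s t u] fraction_subset[of b a t s u] assms by auto

lemma fraction_eqI1:
  assumes "a \<in> carrier R" "b \<in> carrier R" "s \<in> M" "t \<in> M" "t \<otimes> a = s \<otimes> b"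
  shows "fraction R M a s = fraction R M b t"
  using fraction_eqI[of a b s t \<one>] assms M_one by simp

lemma fraction_eqD:
  assumes "a \<in> carrier R" "b \<in> carrier R" "s \<in> M" "t \<in> M"
    and "fraction R M a s = fraction R M b t"
  shows "\<exists>u\<in>M. u \<otimes> (t \<otimes> a) = u \<otimes> (s \<otimes> b)"
proof -
  have "(b, t) \<in> fraction R M a s" using fraction_self[of b t] assms by simp
  then show ?thesis using assms(1,3) by (simp add: mem_fraction_iff)
qed

lemma fraction_memD:
  assumes "a \<in> carrier R" "s \<in> M" "(b, t) \<in> fraction R M a s"
  shows "b \<in> carrier R" "t \<in> M" "fraction R M b t = fraction R M a s"
  using assms fraction_eqI[of a b s t] by (auto simp: mem_fraction_iff)

lemma fraction_closed: "\<lbrakk>a \<in> carrier R; s \<in> M\<rbrakk> \<Longrightarrow> fraction R M a s \<in> carrier (localize R M)"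
  by (auto simp: localize_def)

lemma fraction_cases:
  assumes "x \<in> carrier (localize R M)"
  obtains a s where "a \<in> carrier R" "s \<in> M" "x = fraction R M a s"
  using assms by (auto simp: localize_def)

text \<open>The operations of \<open>localize\<close> are unions over all representatives, so
  well-definedness takes this shape: constant terms over nonempty index sets collapse to one
  set.\<close>

lemma UN_fraction2:
  assumes "a \<in> carrier R" "s \<in> M" "b \<in> carrier R" "t \<in> M"
    and "\<And>a' s' b' t'. \<lbrakk>(a', s') \<in> fraction R M a s; (b', t') \<in> fraction R M b t\<rbrakk> \<Longrightarrow> F a' s' b' t' = X"
  shows "(\<Union>(a', s')\<in>fraction R M a s. \<Union>(b', t')\<in>fraction R M b t. F a' s' b' t') = X"
  using assms(5) fraction_self[OF assms(1,2)] fraction_self[OF assms(3,4)] by fast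

lemma UN_fraction:
  assumes "a \<in> carrier R" "s \<in> M"
    and "\<And>a' s'. (a', s') \<in> fraction R M a s \<Longrightarrow> F a' s' = X"
  shows "(\<Union>(a', s')\<in>fraction R M a s. F a' s') = X"
  using assms(3) fraction_self[OF assms(1,2)] by fast

lemma fraction_mult:
  assumes "a \<in> carrier R" "s \<in> M" "b \<in> carrier R" "t \<in> M"
  shows "fraction R M a s \<otimes>\<^bsub>localize R M\<^esub> fraction R M b t = fraction R M (a \<otimes> b) (s \<otimes> t)"
proof -
  have "fraction R M (a' \<otimes> b') (s' \<otimes> t') = fraction R M (a \<otimes> b) (s \<otimes> t)"
    if h: "(a', s') \<in> fraction R M a s" "(b', t') \<in> fraction R M b t" for a' s' b' t'
  proof -
    obtain u v where u: "a' \<in> carrier R" "s' \<in> M" "u \<in> M" "u \<otimes> (s' \<otimes> a) = u \<otimes> (s \<otimes> a')"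
      and v: "b' \<in> carrier R" "t' \<in> M" "v \<in> M" "v \<otimes> (t' \<otimes> b) = v \<otimes> (t \<otimes> b')"
      using h assms by (auto simp: mem_fraction_iff)
    have "(u \<otimes> v) \<otimes> ((s \<otimes> t) \<otimes> (a' \<otimes> b')) = (u \<otimes> (s \<otimes> a')) \<otimes> (v \<otimes> (t \<otimes> b'))"
      using u(1-3) v(1-3) assms by (simp add: m_ac)
    also have "\<dots> = (u \<otimes> (s' \<otimes> a)) \<otimes> (v \<otimes> (t' \<otimes> b))" by (simp add: u v)
    also have "\<dots> = (u \<otimes> v) \<otimes> ((s' \<otimes> t') \<otimes> (a \<otimes> b))"
      using u(1-3) v(1-3) assms by (simp add: m_ac)
    finally show ?thesis
      using u v assms M_mult by (intro fraction_eqI[of _ _ _ _ "u \<otimes> v"]) auto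
  qed
  then show ?thesis using assms by (simp add: localize_def UN_fraction2)
qed

lemma fraction_add:
  assumes "a \<in> carrier R" "s \<in> M" "b \<in> carrier R" "t \<in> M"
  shows "fraction R M a s \<oplus>\<^bsub>localize R M\<^esub> fraction R M b t
    = fraction R M (t \<otimes> a \<oplus> s \<otimes> b) (s \<otimes> t)"
proof -
  have "fraction R M (t' \<otimes> a' \<oplus> s' \<otimes> b') (s' \<otimes> t') = fraction R M (t \<otimes> a \<oplus> s \<otimes> b) (s \<otimes> t)"
    if h: "(a', s') \<in> fraction R M a s" "(b', t') \<in> fraction R M b t" for a' s' b' t'
  proof -
    obtain u v where u: "a' \<in> carrier R" "s' \<in> M" "u \<in> M" "u \<otimes> (s' \<otimes> a) = u \<otimes> (s \<otimes> a')"
      and v: "b' \<in> carrier R" "t' \<in> M" "v \<in> M" "v \<otimes> (t' \<otimes> b) = v \<otimes> (t \<otimes> b')"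
      using h assms by (auto simp: mem_fraction_iff)
    have "(u \<otimes> v) \<otimes> ((s \<otimes> t) \<otimes> (t' \<otimes> a' \<oplus> s' \<otimes> b'))
        = (v \<otimes> t \<otimes> t') \<otimes> (u \<otimes> (s \<otimes> a')) \<oplus> (u \<otimes> s \<otimes> s') \<otimes> (v \<otimes> (t \<otimes> b'))"
      using u(1-3) v(1-3) assms by (simp add: m_ac r_distr)
    also have "\<dots> = (v \<otimes> t \<otimes> t') \<otimes> (u \<otimes> (s' \<otimes> a)) \<oplus> (u \<otimes> s \<otimes> s') \<otimes> (v \<otimes> (t' \<otimes> b))"
      by (simp add: u v)
    also have "\<dots> = (u \<otimes> v) \<otimes> ((s' \<otimes> t') \<otimes> (t \<otimes> a \<oplus> s \<otimes> b))"
      using u(1-3) v(1-3) assms by (simp add: m_ac r_distr)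
    finally show ?thesis
      using u v assms M_mult by (intro fraction_eqI[of _ _ _ _ "u \<otimes> v"]) auto
  qed
  then show ?thesis using assms by (simp add: localize_def UN_fraction2)
qed

lemma localize_one: "\<one>\<^bsub>localize R M\<^esub> = fraction R M \<one> \<one>"
  by (simp add: localize_def)

lemma localize_zero: "\<zero>\<^bsub>localize R M\<^esub> = fraction R M \<zero> \<one>"
  by (simp add: localize_def)

lemma cring_localize: "cring (localize R M)"
proof (rule cringI)
  let ?L = "localize R M"
  show "abelian_group ?L"
  proof (rule abelian_groupI)
    fix x y assume "x \<in> carrier ?L" "y \<in> carrier ?L"
    then show "x \<oplus>\<^bsub>?L\<^esub> y \<in> carrier ?L"
      by (elim fraction_cases) (simp add: fraction_add fraction_closed M_mult)
  next
    fix x y z assume "x \<in> carrier ?L" "y \<in> carrier ?L" "z \<in> carrier ?L"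
    then show "x \<oplus>\<^bsub>?L\<^esub> y \<oplus>\<^bsub>?L\<^esub> z = x \<oplus>\<^bsub>?L\<^esub> (y \<oplus>\<^bsub>?L\<^esub> z)"
      by (elim fraction_cases) (simp add: fraction_add M_mult m_ac r_distr a_ac)
  next
    fix x y assume "x \<in> carrier ?L" "y \<in> carrier ?L"
    then show "x \<oplus>\<^bsub>?L\<^esub> y = y \<oplus>\<^bsub>?L\<^esub> x"
      by (elim fraction_cases) (simp add: fraction_add M_mult m_ac a_ac)
  next
    show "\<zero>\<^bsub>?L\<^esub> \<in> carrier ?L" by (simp add: localize_zero fraction_closed M_one)
  next
    fix x assume "x \<in> carrier ?L"
    then show "\<zero>\<^bsub>?L\<^esub> \<oplus>\<^bsub>?L\<^esub> x = x"
      by (elim fraction_cases) (simp add: localize_zero fraction_add M_one)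
  next
    fix x assume "x \<in> carrier ?L"
    then obtain a s where as: "a \<in> carrier R" "s \<in> M" "x = fraction R M a s"
      by (rule fraction_cases)
    have "fraction R M (\<ominus> a) s \<oplus>\<^bsub>?L\<^esub> x = fraction R M \<zero> (s \<otimes> s)"
      using as by (simp add: fraction_add r_minus l_neg)
    also have "\<dots> = \<zero>\<^bsub>?L\<^esub>"
      using as unfolding localize_zero by (intro fraction_eqI1) (auto simp: M_mult M_one)
    finally show "\<exists>y\<in>carrier ?L. y \<oplus>\<^bsub>?L\<^esub> x = \<zero>\<^bsub>?L\<^esub>"
      using as fraction_closed[of "\<ominus> a" s] by auto
  qed
  show "comm_monoid ?L"
  proof (rule comm_monoidI)
    fix x y assume "x \<in> carrier ?L" "y \<in> carrier ?L"
    then show "x \<otimes>\<^bsub>?L\<^esub> y \<in> carrier ?L"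
      by (elim fraction_cases) (simp add: fraction_mult fraction_closed M_mult)
  next
    show "\<one>\<^bsub>?L\<^esub> \<in> carrier ?L" by (simp add: localize_one fraction_closed M_one)
  next
    fix x y z assume "x \<in> carrier ?L" "y \<in> carrier ?L" "z \<in> carrier ?L"
    then show "x \<otimes>\<^bsub>?L\<^esub> y \<otimes>\<^bsub>?L\<^esub> z = x \<otimes>\<^bsub>?L\<^esub> (y \<otimes>\<^bsub>?L\<^esub> z)"
      by (elim fraction_cases) (simp add: fraction_mult M_mult m_ac)
  next
    fix x assume "x \<in> carrier ?L"
    then show "\<one>\<^bsub>?L\<^esub> \<otimes>\<^bsub>?L\<^esub> x = x"
      by (elim fraction_cases) (simp add: localize_one fraction_mult M_one)
  next
    fix x y assume "x \<in> carrier ?L" "y \<in> carrier ?L"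
    then show "x \<otimes>\<^bsub>?L\<^esub> y = y \<otimes>\<^bsub>?L\<^esub> x"
      by (elim fraction_cases) (simp add: fraction_mult M_mult m_ac)
  qed
  fix x y z assume "x \<in> carrier ?L" "y \<in> carrier ?L" "z \<in> carrier ?L"
  then obtain a s b t c v where h: "a \<in> carrier R" "s \<in> M" "x = fraction R M a s"
    "b \<in> carrier R" "t \<in> M" "y = fraction R M b t" "c \<in> carrier R" "v \<in> M" "z = fraction R M c v"
    by (elim fraction_cases) auto
  have c: "s \<in> carrier R" "t \<in> carrier R" "v \<in> carrier R" using h by auto
  \<comment> \<open>Adding the two products gives the denominator
    \<open>(s \<otimes> v) \<otimes> (t \<otimes> v)\<close>, with one \<open>v\<close> more than on
    the left; cross multiplication absorbs it.\<close>
  have "((s \<otimes> v) \<otimes> (t \<otimes> v)) \<otimes> ((t \<otimes> a \<oplus> s \<otimes> b) \<otimes> c)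
    = ((s \<otimes> t) \<otimes> v) \<otimes> ((t \<otimes> v) \<otimes> (a \<otimes> c) \<oplus> (s \<otimes> v) \<otimes> (b \<otimes> c))"
    using c h(1,4,7) by algebra
  then have "fraction R M ((t \<otimes> a \<oplus> s \<otimes> b) \<otimes> c) ((s \<otimes> t) \<otimes> v) =
    fraction R M ((t \<otimes> v) \<otimes> (a \<otimes> c) \<oplus> (s \<otimes> v) \<otimes> (b \<otimes> c)) ((s \<otimes> v) \<otimes> (t \<otimes> v))"
    using c h by (intro fraction_eqI1) (simp_all add: M_mult)
  then show "(x \<oplus>\<^bsub>?L\<^esub> y) \<otimes>\<^bsub>?L\<^esub> z = x \<otimes>\<^bsub>?L\<^esub> z \<oplus>\<^bsub>?L\<^esub> y \<otimes>\<^bsub>?L\<^esub> z"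
    using h by (simp add: fraction_add fraction_mult M_mult)
qed

lemma fraction_const_mult:
  assumes "a \<in> carrier R" "b \<in> carrier R"
  shows "fraction R M a \<one> \<otimes>\<^bsub>localize R M\<^esub> fraction R M b \<one> = fraction R M (a \<otimes> b) \<one>"
  using assms by (simp add: fraction_mult M_one)

lemma fraction_const_add:
  assumes "a \<in> carrier R" "b \<in> carrier R"
  shows "fraction R M a \<one> \<oplus>\<^bsub>localize R M\<^esub> fraction R M b \<one> = fraction R M (a \<oplus> b) \<one>"
  using assms by (simp add: fraction_add M_one)

end

end

lemma mult_set_prime: "primeideal P R \<Longrightarrow> mult_set R (carrier R - P)"
proof -
  assume "primeideal P R"
  then interpret primeideal P R .
  show ?thesis
    by unfold_locales (use I_prime I_notcarr one_imp_carrier in auto)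
qed

lemma (in primeideal) mult_set_at: "mult_set R (carrier R - I)"
  by (rule mult_set_prime) (rule primeideal_axioms)

text \<open>If \<open>a/s\<close> times \<open>b/t\<close> is one, some \<open>u\<close> outside
  \<open>I\<close> gives \<open>u \<otimes> (a \<otimes> b) = u \<otimes> (s \<otimes> t)\<close>
  with right side outside \<open>I\<close>, so \<open>a\<close> cannot lie in the ideal
  \<open>I\<close>; conversely \<open>s/a\<close> is an inverse. In effect this describes the
  non-units of the local ring at \<open>I\<close>.\<close>

lemma (in primeideal) Units_localize_iff:
  assumes "a \<in> carrier R" "s \<in> carrier R - I"
  shows "fraction_at R I a s \<in> Units (localize_at R I) \<longleftrightarrow> a \<notin> I"
proof -
  interpret L: mult_set R "carrier R - I" by (rule mult_set_at)
  let ?L = "localize_at R I"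
  show ?thesis
  proof
    assume "fraction_at R I a s \<in> Units ?L"
    then obtain x where x: "x \<in> carrier ?L" "fraction_at R I a s \<otimes>\<^bsub>?L\<^esub> x = \<one>\<^bsub>?L\<^esub>"
      by (auto simp: Units_def)
    from x(1) obtain b t where b: "b \<in> carrier R" "t \<in> carrier R - I"
      and xe: "x = fraction_at R I b t"
      by (rule L.fraction_cases)
    have "fraction_at R I (a \<otimes> b) (s \<otimes> t) = fraction_at R I \<one> \<one>"
      using x(2) unfolding xe L.fraction_mult[OF assms b] L.localize_one .
    then have "\<exists>u\<in>carrier R - I. u \<otimes> (\<one> \<otimes> (a \<otimes> b)) = u \<otimes> (s \<otimes> t \<otimes> \<one>)"
      using assms b by (intro L.fraction_eqD) (simp_all only: m_closed L.M_mult L.M_one one_closed)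
    then obtain u where u: "u \<in> carrier R - I" "u \<otimes> (\<one> \<otimes> (a \<otimes> b)) = u \<otimes> (s \<otimes> t \<otimes> \<one>)"
      by blast
    have "u \<otimes> (s \<otimes> t) \<in> carrier R - I" using u b assms L.M_mult by blast
    then have "u \<otimes> (a \<otimes> b) \<notin> I" using u assms b by simp
    then show "a \<notin> I" using I_l_closed[of "a \<otimes> b" u] I_r_closed[of a b] u(1) b(1) by blast
  next
    assume "a \<notin> I"
    then have a: "a \<in> carrier R - I" using assms by auto
    then have as: "a \<otimes> s \<in> carrier R - I" "s \<otimes> a \<in> carrier R - I"
      using assms L.M_mult by blast+
    have "fraction_at R I (a \<otimes> s) (s \<otimes> a) = fraction_at R I \<one> \<one>"
      using a as assms L.M_one by (intro L.fraction_eqI1) (simp_all add: m_comm)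
    moreover have "fraction_at R I (s \<otimes> a) (a \<otimes> s) = fraction_at R I \<one> \<one>"
      using a as assms L.M_one by (intro L.fraction_eqI1) (simp_all add: m_comm)
    moreover have "fraction_at R I a s \<in> carrier ?L" "fraction_at R I s a \<in> carrier ?L"
      using a assms(2) by (auto intro!: L.fraction_closed)
    ultimately show "fraction_at R I a s \<in> Units ?L"
      unfolding Units_def using L.fraction_mult[of a s s a] L.fraction_mult[of s a a s] a assms
      by (intro CollectI conjI bexI[of _ "fraction_at R I s a"]) (simp_all add: L.localize_one)
  qed
qed

section \<open>The structure sheaf of a spectrum\<close>

text \<open>The axioms on restriction maps alone; the calculus of germs and stalks below is built on
  them, for \<open>X\<close> and for spectra alike.\<close>

definition presheaf_of_rings :: "('a, 'b, 'm) ringed_space_scheme \<Rightarrow> bool" where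
  "presheaf_of_rings X \<longleftrightarrow>
     (\<forall>U. opn X U \<longrightarrow> cring (sec X U)) \<and>
     (\<forall>U V. opn X U \<and> opn X V \<and> V \<subseteq> U \<longrightarrow> res X U V \<in> ring_hom (sec X U) (sec X V)) \<and>
     (\<forall>U. opn X U \<longrightarrow> (\<forall>s\<in>carrier (sec X U). res X U U s = s)) \<and>
     (\<forall>U V W. opn X U \<and> opn X V \<and> opn X W \<and> W \<subseteq> V \<and> V \<subseteq> U \<longrightarrow>
        (\<forall>s\<in>carrier (sec X U). res X V W (res X U V s) = res X U W s))"

lemma sheaf_imp_presheaf: "sheaf_of_rings X \<Longrightarrow> presheaf_of_rings X"
  unfolding sheaf_of_rings_def presheaf_of_rings_def by (elim conjE) (intro conjI)

lemma spec_simps [simp]: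
  "space_of (spec R) = zariski R" "sec (spec R) = spec_sec R" "res (spec R) U V \<sigma> = restrict \<sigma> V"
  by (simp_all add: spec_def)

lemma spec_sec_simps:
  "one (spec_sec R U) = (\<lambda>P\<in>U. \<one>\<^bsub>localize_at R P\<^esub>)"
  "zero (spec_sec R U) = (\<lambda>P\<in>U. \<zero>\<^bsub>localize_at R P\<^esub>)"
  "\<sigma> \<otimes>\<^bsub>spec_sec R U\<^esub> \<tau> = (\<lambda>P\<in>U. \<sigma> P \<otimes>\<^bsub>localize_at R P\<^esub> \<tau> P)"
  "add (spec_sec R U) \<sigma> \<tau> = (\<lambda>P\<in>U. \<sigma> P \<oplus>\<^bsub>localize_at R P\<^esub> \<tau> P)"
  by (simp_all add: spec_sec_def)

lemma spec_sec_ops_at: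
  assumes "P \<in> U"
  shows "one (spec_sec R U) P = \<one>\<^bsub>localize_at R P\<^esub>"
    "zero (spec_sec R U) P = \<zero>\<^bsub>localize_at R P\<^esub>"
    "(\<sigma> \<otimes>\<^bsub>spec_sec R U\<^esub> \<tau>) P = \<sigma> P \<otimes>\<^bsub>localize_at R P\<^esub> \<tau> P"
    "add (spec_sec R U) \<sigma> \<tau> P = \<sigma> P \<oplus>\<^bsub>localize_at R P\<^esub> \<tau> P"
  using assms by (simp_all add: spec_sec_simps)

definition basic_open :: "('r, 'm) ring_scheme \<Rightarrow> 'r \<Rightarrow> 'r set set" where
  "basic_open R a = {P. primeideal P R \<and> a \<notin> P}"

context cring
begin

lemma openin_basic_open: "a \<in> carrier R \<Longrightarrow> openin (zariski R) (basic_open R a)"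
  unfolding zariski_def openin_topology_generated_by_iff basic_open_def
  by (rule generate_topology_on.Basis) blast

lemma one_notin_prime: "primeideal P R \<Longrightarrow> \<one> \<notin> P"
  using mult_set.M_one[OF mult_set_prime] by blast

lemma topspace_zariski: "topspace (zariski R) = {P. primeideal P R}"
proof -
  have "topspace (zariski R) = \<Union>{{P. primeideal P R \<and> a \<notin> P} |a. a \<in> carrier R}"
    unfolding zariski_def topology_generated_by_topspace ..
  also have "\<dots> = {P. primeideal P R}"
    using one_notin_prime by (intro equalityI subsetI) blast+
  finally show ?thesis .
qed

lemma zariski_prime: "\<lbrakk>openin (zariski R) U; P \<in> U\<rbrakk> \<Longrightarrow> primeideal P R"
  using openin_subset[of "zariski R" U] unfolding topspace_zariski by blast

text \<open>True of each generating set, as \<open>Q \<subseteq> P\<close> and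
  \<open>a \<notin> P\<close> give \<open>a \<notin> Q\<close>, and inherited by intersections and
  unions. It is the reason why a neighbourhood of the closed point of a local spectrum is
  everything.\<close>

lemma zariski_generization:
  assumes "openin (zariski R) U" "P \<in> U" "primeideal Q R" "Q \<subseteq> P"
  shows "Q \<in> U"
proof -
  have "generate_topology_on {{P. primeideal P R \<and> a \<notin> P} |a. a \<in> carrier R} U"
    using assms(1) by (simp add: zariski_def openin_topology_generated_by_iff)
  then have "P \<in> U \<longrightarrow> Q \<in> U"
    by induction (use assms(3,4) in auto)
  then show ?thesis using assms(2) by simp
qed

lemma fraction_at_closed:
  assumes "primeideal P R" "a \<in> carrier R" "s \<in> carrier R" "s \<notin> P"
  shows "fraction_at R P a s \<in> carrier (localize_at R P)"
  using mult_set.fraction_closed[OF mult_set_prime[OF assms(1)]] assms by blast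

lemma cring_localize_at: "primeideal P R \<Longrightarrow> cring (localize_at R P)"
  using mult_set.cring_localize mult_set_prime by blast

text \<open>Membership of the values in the local rings comes for free, since a local representation
  exhibits each value as a fraction.\<close>

lemma spec_secI:
  assumes U: "openin (zariski R) U" and ext: "\<sigma> \<in> extensional U"
    and loc: "\<And>P. P \<in> U \<Longrightarrow> \<exists>V a s. openin (zariski R) V \<and> P \<in> V \<and> V \<subseteq> U \<and> a \<in> carrier R \<and>
      s \<in> carrier R \<and> (\<forall>Q\<in>V. s \<notin> Q \<and> \<sigma> Q = fraction_at R Q a s)"
  shows "\<sigma> \<in> carrier (spec_sec R U)"
proof -
  have "\<sigma> P \<in> carrier (localize_at R P)" if P: "P \<in> U" for P
  proof -
    obtain a s where "a \<in> carrier R" "s \<in> carrier R" "s \<notin> P" "\<sigma> P = fraction_at R P a s"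
      using loc[OF P] by blast
    then show ?thesis using fraction_at_closed[OF zariski_prime[OF U P]] by simp
  qed
  then have "\<sigma> \<in> (\<Pi>\<^sub>E P\<in>U. carrier (localize_at R P))" using ext by (simp add: PiE_def Pi_def)
  with loc show ?thesis unfolding spec_sec_def by (simp del: PiE_iff)
qed

lemma spec_sec_ext: "\<sigma> \<in> carrier (spec_sec R U) \<Longrightarrow> \<sigma> \<in> extensional U"
  by (simp add: spec_sec_def PiE_def)

lemma spec_sec_at: "\<lbrakk>\<sigma> \<in> carrier (spec_sec R U); P \<in> U\<rbrakk> \<Longrightarrow> \<sigma> P \<in> carrier (localize_at R P)"
  by (simp add: spec_sec_def) (blast dest: PiE_mem)

lemma spec_sec_eqI:
  assumes "\<sigma> \<in> carrier (spec_sec R U)" "\<tau> \<in> carrier (spec_sec R U)" "\<And>P. P \<in> U \<Longrightarrow> \<sigma> P = \<tau> P"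
  shows "\<sigma> = \<tau>"
  using assms spec_sec_ext by (metis extensionalityI)

lemma spec_sec_local:
  assumes "\<sigma> \<in> carrier (spec_sec R U)" "P \<in> U"
  obtains V a s where "openin (zariski R) V" "P \<in> V" "V \<subseteq> U" "a \<in> carrier R" "s \<in> carrier R"
    "\<forall>Q\<in>V. s \<notin> Q \<and> \<sigma> Q = fraction_at R Q a s"
proof -
  have "\<forall>P\<in>U. \<exists>V a s. openin (zariski R) V \<and> P \<in> V \<and> V \<subseteq> U \<and> a \<in> carrier R \<and> s \<in> carrier R \<and>
      (\<forall>Q\<in>V. s \<notin> Q \<and> \<sigma> Q = fraction_at R Q a s)"
    using assms(1) by (simp add: spec_sec_def del: PiE_iff)
  from bspec[OF this assms(2)] show thesis using that by (elim exE conjE)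
qed

text \<open>A common neighbourhood lets sums and products of two sections be computed with fixed
  numerators and denominators.\<close>

lemma spec_sec_local2:
  assumes "openin (zariski R) U" "\<sigma> \<in> carrier (spec_sec R U)" "\<tau> \<in> carrier (spec_sec R U)" "P \<in> U"
  obtains V a s b t where "openin (zariski R) V" "P \<in> V" "V \<subseteq> U" "a \<in> carrier R" "s \<in> carrier R"
    "b \<in> carrier R" "t \<in> carrier R"
    "\<And>Q. Q \<in> V \<Longrightarrow> primeideal Q R" "\<And>Q. Q \<in> V \<Longrightarrow> s \<notin> Q" "\<And>Q. Q \<in> V \<Longrightarrow> t \<notin> Q"
    "\<And>Q. Q \<in> V \<Longrightarrow> \<sigma> Q = fraction_at R Q a s" "\<And>Q. Q \<in> V \<Longrightarrow> \<tau> Q = fraction_at R Q b t"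
proof (rule spec_sec_local[OF assms(2,4)], rule spec_sec_local[OF assms(3,4)])
  fix V a s W b t
  assume V: "openin (zariski R) V" "P \<in> V" "V \<subseteq> U" "a \<in> carrier R" "s \<in> carrier R"
    "\<forall>Q\<in>V. s \<notin> Q \<and> \<sigma> Q = fraction_at R Q a s"
    and W: "openin (zariski R) W" "P \<in> W" "W \<subseteq> U" "b \<in> carrier R" "t \<in> carrier R"
    "\<forall>Q\<in>W. t \<notin> Q \<and> \<tau> Q = fraction_at R Q b t"
  show thesis
  proof (rule that[of "V \<inter> W" a s b t])
    show "openin (zariski R) (V \<inter> W)" using V(1) W(1) by (rule openin_Int)
    show "primeideal Q R" if "Q \<in> V \<inter> W" for Q
      using that V(1) by (intro zariski_prime) auto
  qed (use V W in auto)
qed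

lemma restrict_spec_sec:
  assumes U: "openin (zariski R) U" and V: "openin (zariski R) V" "V \<subseteq> U"
    and \<sigma>: "\<sigma> \<in> carrier (spec_sec R U)"
  shows "restrict \<sigma> V \<in> carrier (spec_sec R V)"
proof (rule spec_secI[OF V(1)])
  fix P assume P: "P \<in> V"
  have PU: "P \<in> U" using P V by blast
  show "\<exists>W a s. openin (zariski R) W \<and> P \<in> W \<and> W \<subseteq> V \<and> a \<in> carrier R \<and>
      s \<in> carrier R \<and> (\<forall>Q\<in>W. s \<notin> Q \<and> restrict \<sigma> V Q = fraction_at R Q a s)"
  proof (rule spec_sec_local[OF \<sigma> PU])
    fix W a s
    assume W: "openin (zariski R) W" "P \<in> W" "W \<subseteq> U" "a \<in> carrier R" "s \<in> carrier R"
      "\<forall>Q\<in>W. s \<notin> Q \<and> \<sigma> Q = fraction_at R Q a s"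
    then have "\<forall>Q\<in>W \<inter> V. s \<notin> Q \<and> restrict \<sigma> V Q = fraction_at R Q a s" by simp
    moreover have "openin (zariski R) (W \<inter> V)" using W(1) V(1) by (rule openin_Int)
    ultimately show ?thesis using W(2,4,5) P by blast
  qed
qed simp

lemma fraction_section_closed:
  assumes "openin (zariski R) U" "a \<in> carrier R" "s \<in> carrier R" "\<And>Q. Q \<in> U \<Longrightarrow> s \<notin> Q"
  shows "(\<lambda>P\<in>U. fraction_at R P a s) \<in> carrier (spec_sec R U)"
proof (rule spec_secI[OF assms(1)])
  fix P assume "P \<in> U"
  then show "\<exists>V b t. openin (zariski R) V \<and> P \<in> V \<and> V \<subseteq> U \<and> b \<in> carrier R \<and> t \<in> carrier R \<and>
      (\<forall>Q\<in>V. t \<notin> Q \<and> (\<lambda>P\<in>U. fraction_at R P a s) Q = fraction_at R Q b t)"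
    using assms by (intro exI[of _ U] exI[of _ a] exI[of _ s]) simp
qed simp

lemma spec_const_closed:
  assumes "openin (zariski R) U" "a \<in> carrier R"
  shows "spec_const R U a \<in> carrier (spec_sec R U)"
  unfolding spec_const_def
  by (rule fraction_section_closed[OF assms one_closed]) (rule one_notin_prime[OF zariski_prime[OF assms(1)]])

lemma fraction_mult_at:
  assumes "primeideal P R" "a \<in> carrier R" "s \<in> carrier R" "s \<notin> P" "b \<in> carrier R" "t \<in> carrier R" "t \<notin> P"
  shows "fraction_at R P a s \<otimes>\<^bsub>localize_at R P\<^esub> fraction_at R P b t = fraction_at R P (a \<otimes> b) (s \<otimes> t)"
  using mult_set.fraction_mult[OF mult_set_prime[OF assms(1)]] assms by blast

lemma fraction_add_at:
  assumes "primeideal P R" "a \<in> carrier R" "s \<in> carrier R" "s \<notin> P" "b \<in> carrier R" "t \<in> carrier R" "t \<notin> P"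
  shows "fraction_at R P a s \<oplus>\<^bsub>localize_at R P\<^esub> fraction_at R P b t
    = fraction_at R P (t \<otimes> a \<oplus> s \<otimes> b) (s \<otimes> t)"
  using mult_set.fraction_add[OF mult_set_prime[OF assms(1)]] assms by blast

lemma mult_notin_prime:
  assumes "primeideal P R" "s \<in> carrier R" "s \<notin> P" "t \<in> carrier R" "t \<notin> P"
  shows "s \<otimes> t \<notin> P"
  using mult_set.M_mult[OF mult_set_prime[OF assms(1)]] assms by blast

lemma fraction_eqI_at:
  assumes "primeideal P R" "a \<in> carrier R" "b \<in> carrier R" "s \<in> carrier R" "t \<in> carrier R"
    and "s \<notin> P" "t \<notin> P" "t \<otimes> a = s \<otimes> b"
  shows "fraction_at R P a s = fraction_at R P b t"
  using mult_set.fraction_eqI1[OF mult_set_prime[OF assms(1)]] assms by blast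

lemma fraction_memD_at:
  assumes "primeideal P R" "a \<in> carrier R" "s \<in> carrier R" "s \<notin> P" "(b, t) \<in> fraction_at R P a s"
  shows "b \<in> carrier R" "t \<in> carrier R" "t \<notin> P" "fraction_at R P b t = fraction_at R P a s"
  using mult_set.fraction_memD[OF mult_set_prime[OF assms(1)], of a s b t] assms by auto

lemma spec_sec_mult_closed:
  assumes U: "openin (zariski R) U" and \<sigma>: "\<sigma> \<in> carrier (spec_sec R U)" "\<tau> \<in> carrier (spec_sec R U)"
  shows "\<sigma> \<otimes>\<^bsub>spec_sec R U\<^esub> \<tau> \<in> carrier (spec_sec R U)"
proof (rule spec_secI[OF U])
  fix P assume P: "P \<in> U"
  show "\<exists>V a s. openin (zariski R) V \<and> P \<in> V \<and> V \<subseteq> U \<and> a \<in> carrier R \<and>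
      s \<in> carrier R \<and> (\<forall>Q\<in>V. s \<notin> Q \<and> (\<sigma> \<otimes>\<^bsub>spec_sec R U\<^esub> \<tau>) Q = fraction_at R Q a s)"
  proof (rule spec_sec_local2[OF U \<sigma> P])
    fix V a s b t
    assume *: "openin (zariski R) V" "P \<in> V" "V \<subseteq> U" "a \<in> carrier R" "s \<in> carrier R"
      "b \<in> carrier R" "t \<in> carrier R"
      "\<And>Q. Q \<in> V \<Longrightarrow> primeideal Q R" "\<And>Q. Q \<in> V \<Longrightarrow> s \<notin> Q" "\<And>Q. Q \<in> V \<Longrightarrow> t \<notin> Q"
      "\<And>Q. Q \<in> V \<Longrightarrow> \<sigma> Q = fraction_at R Q a s" "\<And>Q. Q \<in> V \<Longrightarrow> \<tau> Q = fraction_at R Q b t"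
    have "s \<otimes> t \<notin> Q \<and> (\<sigma> \<otimes>\<^bsub>spec_sec R U\<^esub> \<tau>) Q = fraction_at R Q (a \<otimes> b) (s \<otimes> t)" if "Q \<in> V" for Q
      using subsetD[OF *(3) that] mult_notin_prime[OF *(8)[OF that] *(5) *(9)[OF that] *(7) *(10)[OF that]]
      by (simp add: spec_sec_simps *(11,12)[OF that]
          fraction_mult_at[OF *(8)[OF that] *(4,5) *(9)[OF that] *(6,7) *(10)[OF that]])
    then show ?thesis
      using *(1-7) by (intro exI[of _ V] exI[of _ "a \<otimes> b"] exI[of _ "s \<otimes> t"]) simp
  qed
qed (simp add: spec_sec_simps)

lemma spec_sec_add_closed:
  assumes U: "openin (zariski R) U" and \<sigma>: "\<sigma> \<in> carrier (spec_sec R U)" "\<tau> \<in> carrier (spec_sec R U)"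
  shows "\<sigma> \<oplus>\<^bsub>spec_sec R U\<^esub> \<tau> \<in> carrier (spec_sec R U)"
proof (rule spec_secI[OF U])
  fix P assume P: "P \<in> U"
  show "\<exists>V a s. openin (zariski R) V \<and> P \<in> V \<and> V \<subseteq> U \<and> a \<in> carrier R \<and>
      s \<in> carrier R \<and> (\<forall>Q\<in>V. s \<notin> Q \<and> (\<sigma> \<oplus>\<^bsub>spec_sec R U\<^esub> \<tau>) Q = fraction_at R Q a s)"
  proof (rule spec_sec_local2[OF U \<sigma> P])
    fix V a s b t
    assume *: "openin (zariski R) V" "P \<in> V" "V \<subseteq> U" "a \<in> carrier R" "s \<in> carrier R"
      "b \<in> carrier R" "t \<in> carrier R"
      "\<And>Q. Q \<in> V \<Longrightarrow> primeideal Q R" "\<And>Q. Q \<in> V \<Longrightarrow> s \<notin> Q" "\<And>Q. Q \<in> V \<Longrightarrow> t \<notin> Q"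
      "\<And>Q. Q \<in> V \<Longrightarrow> \<sigma> Q = fraction_at R Q a s" "\<And>Q. Q \<in> V \<Longrightarrow> \<tau> Q = fraction_at R Q b t"
    have "s \<otimes> t \<notin> Q \<and> (\<sigma> \<oplus>\<^bsub>spec_sec R U\<^esub> \<tau>) Q = fraction_at R Q (t \<otimes> a \<oplus> s \<otimes> b) (s \<otimes> t)"
      if "Q \<in> V" for Q
      using subsetD[OF *(3) that] mult_notin_prime[OF *(8)[OF that] *(5) *(9)[OF that] *(7) *(10)[OF that]]
      by (simp add: spec_sec_simps *(11,12)[OF that]
          fraction_add_at[OF *(8)[OF that] *(4,5) *(9)[OF that] *(6,7) *(10)[OF that]])
    then show ?thesis
      using *(1-7) by (intro exI[of _ V] exI[of _ "t \<otimes> a \<oplus> s \<otimes> b"] exI[of _ "s \<otimes> t"]) simp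
  qed
qed (simp add: spec_sec_simps)

lemma spec_const_one: "one (spec_sec R U) = spec_const R U \<one>"
  and spec_const_zero: "zero (spec_sec R U) = spec_const R U \<zero>"
  by (simp_all add: spec_sec_simps spec_const_def localize_def)

lemma spec_const_mult:
  assumes "openin (zariski R) U" "a \<in> carrier R" "b \<in> carrier R"
  shows "spec_const R U a \<otimes>\<^bsub>spec_sec R U\<^esub> spec_const R U b = spec_const R U (a \<otimes> b)"
  using assms zariski_prime one_notin_prime
  by (auto simp: spec_const_def spec_sec_simps fraction_mult_at intro!: restrict_ext)

lemma spec_const_add:
  assumes "openin (zariski R) U" "a \<in> carrier R" "b \<in> carrier R"
  shows "spec_const R U a \<oplus>\<^bsub>spec_sec R U\<^esub> spec_const R U b = spec_const R U (a \<oplus> b)"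
  using assms zariski_prime one_notin_prime
  by (auto simp: spec_const_def spec_sec_simps fraction_add_at intro!: restrict_ext)

lemma cring_spec_sec:
  assumes U: "openin (zariski R) U"
  shows "cring (spec_sec R U)"
proof -
  let ?S = "spec_sec R U"
  have L: "cring (localize_at R P)" if "P \<in> U" for P
    using that cring_localize_at zariski_prime[OF U] by blast
  have LA: "abelian_group (localize_at R P)" if "P \<in> U" for P
    using L[OF that] by (simp add: cring_def ring_def)
  have LM: "comm_monoid (localize_at R P)" if "P \<in> U" for P
    using L[OF that] by (simp add: cring_def)
  have LR: "ring (localize_at R P)" if "P \<in> U" for P
    using L[OF that] by (simp add: cring_def)
  note c = spec_sec_at spec_sec_mult_closed[OF U] spec_sec_add_closed[OF U]
  have zero: "\<zero>\<^bsub>?S\<^esub> \<in> carrier ?S" and one: "\<one>\<^bsub>?S\<^esub> \<in> carrier ?S"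
    by (simp_all add: spec_const_zero spec_const_one spec_const_closed[OF U])
  show ?thesis
  proof (rule cringI)
    show "abelian_group ?S"
    proof (rule abelian_groupI)
      fix x y z assume "x \<in> carrier ?S" "y \<in> carrier ?S" "z \<in> carrier ?S"
      then show "x \<oplus>\<^bsub>?S\<^esub> y \<oplus>\<^bsub>?S\<^esub> z = x \<oplus>\<^bsub>?S\<^esub> (y \<oplus>\<^bsub>?S\<^esub> z)"
        by (auto simp: spec_sec_simps abelian_monoid.a_assoc[OF abelian_group.axioms(1)[OF LA]] c(1)
            intro!: restrict_ext)
    next
      fix x y assume xy: "x \<in> carrier ?S" "y \<in> carrier ?S"
      then show "x \<oplus>\<^bsub>?S\<^esub> y = y \<oplus>\<^bsub>?S\<^esub> x"
        by (auto simp: spec_sec_simps abelian_monoid.a_comm[OF abelian_group.axioms(1)[OF LA]] c(1)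
            intro!: restrict_ext)
      show "x \<oplus>\<^bsub>?S\<^esub> y \<in> carrier ?S" using xy by (rule c)
    next
      fix x assume x: "x \<in> carrier ?S"
      show "\<zero>\<^bsub>?S\<^esub> \<oplus>\<^bsub>?S\<^esub> x = x"
        using x c(2,3) zero
        by (intro spec_sec_eqI[of _ U])
          (auto simp: spec_sec_ops_at abelian_monoid.l_zero[OF abelian_group.axioms(1)[OF LA]] c(1))
      \<comment> \<open>Negatives are obtained as products with the constant section
        \<open>\<ominus> \<one>\<close>, which reduces their existence to closure under
        multiplication.\<close>
      let ?m = "spec_const R U (\<ominus> \<one>)"
      have m: "?m \<in> carrier ?S" using spec_const_closed[OF U] by simp
      have "?m P \<otimes>\<^bsub>localize_at R P\<^esub> x P \<oplus>\<^bsub>localize_at R P\<^esub> x P = \<zero>\<^bsub>localize_at R P\<^esub>"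
        if P: "P \<in> U" for P
      proof -
        interpret L: cring "localize_at R P" by (rule L[OF P])
        have p: "primeideal P R" using zariski_prime[OF U P] .
        have xP: "x P \<in> carrier (localize_at R P)" using x P by (rule c)
        have mP: "?m P \<in> carrier (localize_at R P)" using m P by (rule c)
        have "?m P \<oplus>\<^bsub>localize_at R P\<^esub> \<one>\<^bsub>localize_at R P\<^esub> = \<zero>\<^bsub>localize_at R P\<^esub>"
          using P p one_notin_prime[OF p] fraction_add_at[OF p, of "\<ominus> \<one>" \<one> \<one> \<one>]
          by (simp add: spec_const_def localize_def l_neg)
        then have "(?m P \<oplus>\<^bsub>localize_at R P\<^esub> \<one>\<^bsub>localize_at R P\<^esub>) \<otimes>\<^bsub>localize_at R P\<^esub> x P
          = \<zero>\<^bsub>localize_at R P\<^esub>" using xP by simp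
        then show ?thesis using xP mP by (simp add: L.l_distr)
      qed
      then have "(?m \<otimes>\<^bsub>?S\<^esub> x) \<oplus>\<^bsub>?S\<^esub> x = \<zero>\<^bsub>?S\<^esub>"
        using x m c(2,3) zero by (intro spec_sec_eqI[of _ U]) (auto simp: spec_sec_ops_at)
      then show "\<exists>y\<in>carrier ?S. y \<oplus>\<^bsub>?S\<^esub> x = \<zero>\<^bsub>?S\<^esub>"
        using c(2)[OF m x] by blast
    qed (rule zero)
    show "comm_monoid ?S"
    proof (rule comm_monoidI)
      fix x y z assume "x \<in> carrier ?S" "y \<in> carrier ?S" "z \<in> carrier ?S"
      then show "x \<otimes>\<^bsub>?S\<^esub> y \<otimes>\<^bsub>?S\<^esub> z = x \<otimes>\<^bsub>?S\<^esub> (y \<otimes>\<^bsub>?S\<^esub> z)"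
        by (auto simp: spec_sec_simps monoid.m_assoc[OF comm_monoid.axioms(1)[OF LM]] c(1)
            intro!: restrict_ext)
    next
      fix x y assume xy: "x \<in> carrier ?S" "y \<in> carrier ?S"
      then show "x \<otimes>\<^bsub>?S\<^esub> y = y \<otimes>\<^bsub>?S\<^esub> x"
        by (auto simp: spec_sec_simps comm_monoid.m_comm[OF LM] c(1) intro!: restrict_ext)
      show "x \<otimes>\<^bsub>?S\<^esub> y \<in> carrier ?S" using xy by (rule c)
    next
      fix x assume x: "x \<in> carrier ?S"
      show "\<one>\<^bsub>?S\<^esub> \<otimes>\<^bsub>?S\<^esub> x = x"
        using x c(2,3) one
        by (intro spec_sec_eqI[of _ U])
          (auto simp: spec_sec_ops_at monoid.l_one[OF comm_monoid.axioms(1)[OF LM]] c(1))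
    qed (rule one)
    fix x y z assume "x \<in> carrier ?S" "y \<in> carrier ?S" "z \<in> carrier ?S"
    then show "(x \<oplus>\<^bsub>?S\<^esub> y) \<otimes>\<^bsub>?S\<^esub> z = x \<otimes>\<^bsub>?S\<^esub> z \<oplus>\<^bsub>?S\<^esub> y \<otimes>\<^bsub>?S\<^esub> z"
      by (auto simp: spec_sec_simps ring.ring_simprules(13)[OF LR] c(1) intro!: restrict_ext)
  qed
qed

lemma restrict_spec_sec_hom:
  assumes U: "openin (zariski R) U" and V: "openin (zariski R) V" and "V \<subseteq> U"
  shows "(\<lambda>\<sigma>. restrict \<sigma> V) \<in> ring_hom (spec_sec R U) (spec_sec R V)"
proof (rule ring_hom_memI)
  fix \<sigma> assume "\<sigma> \<in> carrier (spec_sec R U)"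
  then show "restrict \<sigma> V \<in> carrier (spec_sec R V)" using restrict_spec_sec assms by blast
qed (use assms in \<open>auto simp: spec_sec_simps fun_eq_iff\<close>)

lemma presheaf_spec: "presheaf_of_rings (spec R)"
proof -
  have "res (spec R) U V \<in> ring_hom (spec_sec R U) (spec_sec R V)"
    if "openin (zariski R) U" "openin (zariski R) V" "V \<subseteq> U" for U V
    using restrict_spec_sec_hom[OF that] by (simp add: spec_def)
  moreover have "restrict \<sigma> U = \<sigma>" if "\<sigma> \<in> carrier (spec_sec R U)" for \<sigma> U
    using spec_sec_ext[OF that] by (rule extensional_restrict)
  ultimately show ?thesis
    unfolding presheaf_of_rings_def by (auto simp: cring_spec_sec Int_absorb1)
qed

end

section \<open>Stalks and local homomorphisms\<close>

lemma ring_hom_Units: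
  fixes A (structure) and B (structure)
  assumes "h \<in> ring_hom A B" "x \<in> Units A"
  shows "h x \<in> Units B"
proof -
  obtain y where y: "y \<in> carrier A" "y \<otimes>\<^bsub>A\<^esub> x = \<one>\<^bsub>A\<^esub>" "x \<otimes>\<^bsub>A\<^esub> y = \<one>\<^bsub>A\<^esub>" and x: "x \<in> carrier A"
    using assms(2) by (auto simp: Units_def)
  have "h y \<otimes>\<^bsub>B\<^esub> h x = \<one>\<^bsub>B\<^esub>" "h x \<otimes>\<^bsub>B\<^esub> h y = \<one>\<^bsub>B\<^esub>"
    using y ring_hom_mult[OF assms(1) y(1) x] ring_hom_mult[OF assms(1) x y(1)] ring_hom_one[OF assms(1)]
    by simp_all
  then show ?thesis
    unfolding Units_def using ring_hom_closed[OF assms(1)] x y(1) by blast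
qed

lemma (in cring) UnitsI: "\<lbrakk>x \<in> carrier R; y \<in> carrier R; x \<otimes> y = \<one>\<rbrakk> \<Longrightarrow> x \<in> Units R"
  unfolding Units_def using m_comm[of x y] by auto

lemma (in maximalideal) no_Units: "x \<in> I \<Longrightarrow> x \<notin> Units R"
proof
  assume "x \<in> I" "x \<in> Units R"
  then obtain y where "y \<in> carrier R" "y \<otimes> x = \<one>" by (auto simp: Units_def)
  then have "\<one> \<in> I" using \<open>x \<in> I\<close> I_l_closed[of x y] by simp
  then show False using one_imp_carrier I_notcarr by simp
qed

text \<open>Zorn's lemma on the ideals that contain \<open>x\<close> but not \<open>\<one>\<close>;
  the principal ideal of \<open>x\<close> is one of them because \<open>x\<close> is not a unit. A
  maximal member of this family is a maximal ideal, since a larger ideal either stays in the family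
  or contains \<open>\<one>\<close>.\<close>

lemma (in cring) nonunit_in_maximalideal:
  assumes x: "x \<in> carrier R" "x \<notin> Units R"
  obtains M where "maximalideal M R" "x \<in> M"
proof -
  let ?\<A> = "{I. ideal I R \<and> x \<in> I \<and> \<one> \<notin> I}"
  have "\<one> \<notin> PIdl x"
  proof
    assume "\<one> \<in> PIdl x"
    then obtain y where "y \<in> carrier R" "\<one> = y \<otimes> x" by (auto simp: cgenideal_def)
    then show False using UnitsI[of x y] x m_comm[of x y] by simp
  qed
  then have "PIdl x \<in> ?\<A>" using x cgenideal_ideal cgenideal_self by simp
  then have ne: "?\<A> \<noteq> {}" by blast
  have "\<exists>M\<in>?\<A>. \<forall>J\<in>?\<A>. M \<subseteq> J \<longrightarrow> J = M"
  proof (rule subset_Zorn_nonempty[OF ne])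
    fix C assume C: "C \<noteq> {}" "subset.chain ?\<A> C"
    then have "subset.chain {I. ideal I R} C" by (auto simp: pred_on.chain_def)
    then have "ideal (\<Union>C) R" using chain_Union_is_ideal[of C] C(1) by simp
    then show "\<Union>C \<in> ?\<A>" using C by (auto simp: pred_on.chain_def)
  qed
  then obtain M where M: "ideal M R" "x \<in> M" "\<one> \<notin> M"
    and max: "\<And>J. \<lbrakk>ideal J R; x \<in> J; \<one> \<notin> J; M \<subseteq> J\<rbrakk> \<Longrightarrow> J = M" by blast
  have "maximalideal M R"
  proof (rule maximalidealI[OF M(1)])
    show "carrier R \<noteq> M" using M(3) by auto
    fix J assume J: "ideal J R" "M \<subseteq> J" "J \<subseteq> carrier R"
    show "J = M \<or> J = carrier R"
    proof (cases "\<one> \<in> J")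
      case True then show ?thesis using ideal.one_imp_carrier[OF J(1)] by simp
    next
      case False then show ?thesis using max[OF J(1)] J(2) M(2) by blast
    qed
  qed
  then show thesis using that M(2) by blast
qed

text \<open>If \<open>x\<close> were outside \<open>N\<close>, then \<open>N + (x)\<close> would be
  the whole ring and \<open>\<one>\<close> would be the sum of an element of \<open>N\<close> and a
  multiple of \<open>x\<close>, two non-units. This is how any maximal ideal of a stalk is shown to
  contain all non-units.\<close>

lemma (in cring) nonunits_in_maximalideal:
  assumes add: "\<And>x y. \<lbrakk>x \<in> carrier R; y \<in> carrier R; x \<notin> Units R; y \<notin> Units R\<rbrakk> \<Longrightarrow> x \<oplus> y \<notin> Units R"
    and N: "maximalideal N R" and x: "x \<in> carrier R" "x \<notin> Units R"
  shows "x \<in> N"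
proof -
  interpret N: maximalideal N R by (rule N)
  let ?J = "N <+>\<^bsub>R\<^esub> PIdl x"
  have J: "ideal ?J R" using N.is_ideal cgenideal_ideal[OF x(1)] by (rule add_ideals)
  have xJ: "x \<in> PIdl x" using x by (intro cgenideal_self)
  interpret J: ideal ?J R by (rule J)
  have "n \<in> ?J" if "n \<in> N" for n
  proof -
    have "n = n \<oplus> \<zero>" using that N.a_subset by auto
    moreover have "\<zero> \<in> PIdl x"
      using cgenideal_ideal[OF x(1)] by (simp add: additive_subgroup.zero_closed ideal.axioms(1))
    ultimately show ?thesis using that unfolding set_add_def' by blast
  qed
  then have "?J = N \<or> ?J = carrier R" using N.I_maximal[OF J] J.a_subset by blast
  moreover have "\<one> \<notin> ?J"
  proof
    assume "\<one> \<in> ?J"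
    then obtain n k where "n \<in> N" "k \<in> PIdl x" "\<one> = n \<oplus> k"
      unfolding set_add_def' by blast
    then obtain r where nr: "n \<in> N" "r \<in> carrier R" "\<one> = n \<oplus> r \<otimes> x"
      unfolding cgenideal_def by blast
    have "r \<otimes> x \<notin> Units R"
    proof
      assume "r \<otimes> x \<in> Units R"
      then obtain y where "y \<in> carrier R" "y \<otimes> (r \<otimes> x) = \<one>" by (auto simp: Units_def)
      then have "x \<otimes> (y \<otimes> r) = \<one>" using nr(2) x by (simp add: m_ac)
      then show False using UnitsI[of x "y \<otimes> r"] x \<open>y \<in> carrier R\<close> nr(2) by simp
    qed
    then have "n \<oplus> r \<otimes> x \<notin> Units R"
      using N.no_Units[OF nr(1)] nr(1,2) x N.a_subset by (intro add) auto
    then show False unfolding nr(3)[symmetric] by simp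
  qed
  moreover have "x \<in> ?J"
  proof -
    have "x = \<zero> \<oplus> x" using x by simp
    then show ?thesis using xJ by (auto simp: set_add_def')
  qed
  ultimately show ?thesis by auto
qed

text \<open>An invertibility test on sections that stands for the germ of \<open>s\<close> at
  \<open>p\<close> being a unit of the stalk, see \<open>germ_Units_iff\<close>. It spares later
  arguments the handling of germs.\<close>

definition inv_at :: "('a, 'b, 'm) ringed_space_scheme \<Rightarrow> 'a \<Rightarrow> 'a set \<Rightarrow> 'b \<Rightarrow> bool" where
  "inv_at X p U s \<longleftrightarrow> (\<exists>W. opn X W \<and> p \<in> W \<and> W \<subseteq> U \<and> res X U W s \<in> Units (sec X W))"

section \<open>Germs and stalks of a presheaf of rings\<close>

locale presheaf =
  fixes X :: "('a, 'b, 'm) ringed_space_scheme"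
  assumes presheaf: "presheaf_of_rings X"
begin

lemma cring_sec: "opn X U \<Longrightarrow> cring (sec X U)"
  using presheaf by (auto simp: presheaf_of_rings_def)

lemma res_hom: "\<lbrakk>opn X U; opn X V; V \<subseteq> U\<rbrakk> \<Longrightarrow> res X U V \<in> ring_hom (sec X U) (sec X V)"
  using presheaf by (auto simp: presheaf_of_rings_def)

lemma res_id: "\<lbrakk>opn X U; s \<in> carrier (sec X U)\<rbrakk> \<Longrightarrow> res X U U s = s"
  using presheaf by (auto simp: presheaf_of_rings_def)

lemma res_res:
  "\<lbrakk>opn X U; opn X V; opn X W; W \<subseteq> V; V \<subseteq> U; s \<in> carrier (sec X U)\<rbrakk>
    \<Longrightarrow> res X V W (res X U V s) = res X U W s"
  using presheaf unfolding presheaf_of_rings_def by blast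

lemma res_closed: "\<lbrakk>opn X U; opn X V; V \<subseteq> U; s \<in> carrier (sec X U)\<rbrakk> \<Longrightarrow> res X U V s \<in> carrier (sec X V)"
  using ring_hom_closed[OF res_hom] by blast

lemma res_zero: "\<lbrakk>opn X U; opn X V; V \<subseteq> U\<rbrakk> \<Longrightarrow> res X U V \<zero>\<^bsub>sec X U\<^esub> = \<zero>\<^bsub>sec X V\<^esub>"
  using ring_hom_zero[OF res_hom] cring_sec by (simp add: cring_def)

text \<open>Transitivity of agreement near \<open>p\<close>: two sections that agree with
  \<open>s\<close> on neighbourhoods \<open>W\<close> and \<open>W'\<close> agree with each other on
  \<open>W \<inter> W'\<close>. The hypotheses are symmetric, so swapping gives equality of
  germs.\<close>

lemma germ_subset:
  assumes o: "opn X U" "opn X V" "opn X W" and p: "p \<in> W" "W \<subseteq> U \<inter> V"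
    and s: "s \<in> carrier (sec X U)" "t \<in> carrier (sec X V)"
    and eq: "res X U W s = res X V W t"
  shows "germ X p U s \<subseteq> germ X p V t"
proof safe
  fix Z r assume "(Z, r) \<in> germ X p U s"
  then obtain W' where Z: "opn X Z" "p \<in> Z" "r \<in> carrier (sec X Z)" and W': "opn X W'" "p \<in> W'"
    "W' \<subseteq> U \<inter> Z" "res X U W' s = res X Z W' r"
    by (auto simp: germ_def)
  have o': "opn X (W \<inter> W')" using o W' by blast
  have "res X V (W \<inter> W') t = res X W (W \<inter> W') (res X V W t)"
    using o o' p s by (intro res_res[symmetric]) auto
  also have "\<dots> = res X U (W \<inter> W') s"
    unfolding eq[symmetric] using o o' p s by (intro res_res) auto
  also have "\<dots> = res X W' (W \<inter> W') (res X U W' s)"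
    using o o' W' s by (intro res_res[symmetric]) auto
  also have "\<dots> = res X Z (W \<inter> W') r"
    unfolding W'(4) using o' W' Z by (intro res_res) auto
  finally show "(Z, r) \<in> germ X p V t"
    unfolding germ_def using Z o' p W' by (auto intro!: exI[of _ "W \<inter> W'"])
qed

lemma germ_eqI:
  assumes "opn X U" "opn X V" "opn X W" "p \<in> W" "W \<subseteq> U \<inter> V"
    and "s \<in> carrier (sec X U)" "t \<in> carrier (sec X V)" "res X U W s = res X V W t"
  shows "germ X p U s = germ X p V t"
  using germ_subset[of U V W p s t] germ_subset[of V U W p t s] assms by (auto simp: Int_commute)

lemma germ_self: "\<lbrakk>opn X U; p \<in> U; s \<in> carrier (sec X U)\<rbrakk> \<Longrightarrow> (U, s) \<in> germ X p U s"
  by (auto simp: germ_def)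

lemma germ_memD:
  assumes "(V, t) \<in> germ X p U s"
  obtains W where "opn X V" "p \<in> V" "t \<in> carrier (sec X V)"
    "opn X W" "p \<in> W" "W \<subseteq> U" "W \<subseteq> V" "res X U W s = res X V W t"
  using assms by (auto simp: germ_def)

lemma germ_eqD:
  assumes "opn X V" "p \<in> V" "t \<in> carrier (sec X V)" and eq: "germ X p U s = germ X p V t"
  obtains W where "opn X W" "p \<in> W" "W \<subseteq> U" "W \<subseteq> V" "res X U W s = res X V W t"
proof -
  have "(V, t) \<in> germ X p U s" unfolding eq using assms by (intro germ_self)
  then show thesis using that by (auto simp: germ_def)
qed

lemma germ_res:
  assumes "opn X U" "opn X V" "p \<in> V" "V \<subseteq> U" "s \<in> carrier (sec X U)"
  shows "germ X p V (res X U V s) = germ X p U s"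
  using assms by (intro germ_eqI[of _ _ V]) (auto intro: res_closed simp: res_id res_closed)

lemma germ_closed:
  "\<lbrakk>opn X U; p \<in> U; s \<in> carrier (sec X U)\<rbrakk> \<Longrightarrow> germ X p U s \<in> carrier (stalk X p)"
  by (auto simp: stalk_def)

lemma stalk_cases:
  assumes "x \<in> carrier (stalk X p)"
  obtains U s where "opn X U" "p \<in> U" "s \<in> carrier (sec X U)" "x = germ X p U s"
  using assms by (auto simp: stalk_def)

lemma stalk_cases2:
  assumes "x \<in> carrier (stalk X p)" "y \<in> carrier (stalk X p)"
  obtains U s t where "opn X U" "p \<in> U" "s \<in> carrier (sec X U)" "t \<in> carrier (sec X U)"
    "x = germ X p U s" "y = germ X p U t"
proof (rule stalk_cases[OF assms(1)], rule stalk_cases[OF assms(2)])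
  fix U s V t
  assume *: "opn X U" "p \<in> U" "s \<in> carrier (sec X U)" "x = germ X p U s"
    "opn X V" "p \<in> V" "t \<in> carrier (sec X V)" "y = germ X p V t"
  then have o: "opn X (U \<inter> V)" by blast
  show thesis
    using * o germ_res[of U "U \<inter> V" p s] germ_res[of V "U \<inter> V" p t]
    by (intro that[of "U \<inter> V" "res X U (U \<inter> V) s" "res X V (U \<inter> V) t"]) (auto intro: res_closed)
qed

lemma stalk_cases3:
  assumes "x \<in> carrier (stalk X p)" "y \<in> carrier (stalk X p)" "z \<in> carrier (stalk X p)"
  obtains U s t r where "opn X U" "p \<in> U" "s \<in> carrier (sec X U)" "t \<in> carrier (sec X U)"
    "r \<in> carrier (sec X U)" "x = germ X p U s" "y = germ X p U t" "z = germ X p U r"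
proof (rule stalk_cases2[OF assms(1,2)], rule stalk_cases[OF assms(3)])
  fix U s t V r
  assume *: "opn X U" "p \<in> U" "s \<in> carrier (sec X U)" "t \<in> carrier (sec X U)"
    "x = germ X p U s" "y = germ X p U t"
    "opn X V" "p \<in> V" "r \<in> carrier (sec X V)" "z = germ X p V r"
  then have o: "opn X (U \<inter> V)" by blast
  show thesis
    using * o germ_res[of U "U \<inter> V" p s] germ_res[of U "U \<inter> V" p t] germ_res[of V "U \<inter> V" p r]
    by (intro that[of "U \<inter> V" "res X U (U \<inter> V) s" "res X U (U \<inter> V) t" "res X V (U \<inter> V) r"])
      (auto intro: res_closed)
qed

text \<open>Addition and multiplication of germs are both unions over pairs of representatives.
  Abstracting the operation to a family \<open>f\<close> compatible with restriction proves both
  independent of representatives at once.\<close>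

lemma germ_op:
  assumes W: "opn X W" "p \<in> W" "s \<in> carrier (sec X W)" "t \<in> carrier (sec X W)"
    and closed: "\<And>U x y. \<lbrakk>opn X U; x \<in> carrier (sec X U); y \<in> carrier (sec X U)\<rbrakk> \<Longrightarrow> f U x y \<in> carrier (sec X U)"
    and res: "\<And>U V x y. \<lbrakk>opn X U; opn X V; V \<subseteq> U; x \<in> carrier (sec X U); y \<in> carrier (sec X U)\<rbrakk>
      \<Longrightarrow> res X U V (f U x y) = f V (res X U V x) (res X U V y)"
  shows "(\<Union>(U, s)\<in>germ X p W s. \<Union>(V, t)\<in>germ X p W t.
      germ X p (U \<inter> V) (f (U \<inter> V) (res X U (U \<inter> V) s) (res X V (U \<inter> V) t))) = germ X p W (f W s t)"
proof -
  have "germ X p (U \<inter> V) (f (U \<inter> V) (res X U (U \<inter> V) s') (res X V (U \<inter> V) t')) = germ X p W (f W s t)"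
    if h: "(U, s') \<in> germ X p W s" "(V, t') \<in> germ X p W t" for U s' V t'
  proof (rule germ_memD[OF h(1)], rule germ_memD[OF h(2)])
    fix W1 W2
    assume U: "opn X U" "p \<in> U" "s' \<in> carrier (sec X U)" "opn X W1" "p \<in> W1" "W1 \<subseteq> W" "W1 \<subseteq> U"
        "res X W W1 s = res X U W1 s'"
      and V: "opn X V" "p \<in> V" "t' \<in> carrier (sec X V)" "opn X W2" "p \<in> W2" "W2 \<subseteq> W" "W2 \<subseteq> V"
        "res X W W2 t = res X V W2 t'"
    let ?Z = "W1 \<inter> W2"
    have o: "opn X (U \<inter> V)" "opn X ?Z" and z: "?Z \<subseteq> U \<inter> V" using U V by blast+
    have 1: "res X U ?Z s' = res X W ?Z s"
      using res_res[of U W1 ?Z s'] res_res[of W W1 ?Z s] U V W o by auto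
    have 2: "res X V ?Z t' = res X W ?Z t"
      using res_res[of V W2 ?Z t'] res_res[of W W2 ?Z t] U V W o by auto
    have c: "res X U (U \<inter> V) s' \<in> carrier (sec X (U \<inter> V))" "res X V (U \<inter> V) t' \<in> carrier (sec X (U \<inter> V))"
      using U V o by (auto intro: res_closed)
    have "res X (U \<inter> V) ?Z (f (U \<inter> V) (res X U (U \<inter> V) s') (res X V (U \<inter> V) t'))
       = f ?Z (res X (U \<inter> V) ?Z (res X U (U \<inter> V) s')) (res X (U \<inter> V) ?Z (res X V (U \<inter> V) t'))"
      using o c U V by (intro res) auto
    also have "\<dots> = f ?Z (res X W ?Z s) (res X W ?Z t)"
      using res_res[OF U(1) o z Int_lower1 U(3)] res_res[OF V(1) o z Int_lower2 V(3)] 1 2 by simp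
    also have "\<dots> = res X W ?Z (f W s t)" using o W U V by (intro res[symmetric]) auto
    finally show ?thesis
      using o U V W c by (intro germ_eqI[of _ _ ?Z]) (auto intro: closed)
  qed
  moreover have "(W, s) \<in> germ X p W s" "(W, t) \<in> germ X p W t" using W germ_self by blast+
  ultimately show ?thesis by fast
qed

lemma germ_mult:
  assumes "opn X W" "p \<in> W" "s \<in> carrier (sec X W)" "t \<in> carrier (sec X W)"
  shows "germ X p W s \<otimes>\<^bsub>stalk X p\<^esub> germ X p W t = germ X p W (s \<otimes>\<^bsub>sec X W\<^esub> t)"
  unfolding stalk_def using assms
  by (simp, intro germ_op[where f="\<lambda>U x y. x \<otimes>\<^bsub>sec X U\<^esub> y"])
    (auto intro: ring_hom_mult[OF res_hom] monoid.m_closed cring_sec[unfolded cring_def comm_monoid_def, THEN conjunct2, THEN conjunct1])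

lemma germ_add:
  assumes "opn X W" "p \<in> W" "s \<in> carrier (sec X W)" "t \<in> carrier (sec X W)"
  shows "germ X p W s \<oplus>\<^bsub>stalk X p\<^esub> germ X p W t = germ X p W (s \<oplus>\<^bsub>sec X W\<^esub> t)"
  unfolding stalk_def using assms
  by (simp, intro germ_op[where f="\<lambda>U x y. x \<oplus>\<^bsub>sec X U\<^esub> y"])
    (auto intro: ring_hom_add[OF res_hom] ring.ring_simprules(1) cring_sec[unfolded cring_def, THEN conjunct1])

lemma germ_one:
  assumes "opn X W" "p \<in> W"
  shows "\<one>\<^bsub>stalk X p\<^esub> = germ X p W \<one>\<^bsub>sec X W\<^esub>"
proof -
  interpret S: cring "sec X (pts X)" by (rule cring_sec) simp
  have "W \<subseteq> pts X" using assms(1) by (rule openin_subset)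
  then show ?thesis
    using germ_res[of "pts X" W p "\<one>\<^bsub>sec X (pts X)\<^esub>"] assms ring_hom_one[OF res_hom[of "pts X" W]]
    by (simp add: stalk_def)
qed

lemma germ_zero:
  assumes "opn X W" "p \<in> W"
  shows "\<zero>\<^bsub>stalk X p\<^esub> = germ X p W \<zero>\<^bsub>sec X W\<^esub>"
proof -
  interpret S: cring "sec X (pts X)" by (rule cring_sec) simp
  have "W \<subseteq> pts X" using assms(1) by (rule openin_subset)
  then show ?thesis
    using germ_res[of "pts X" W p "\<zero>\<^bsub>sec X (pts X)\<^esub>"] assms res_zero[of "pts X" W]
    by (simp add: stalk_def)
qed

lemma cring_stalk:
  assumes p: "p \<in> pts X"
  shows "cring (stalk X p)"
proof (rule cringI)
  let ?S = "stalk X p"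
  note ops = germ_mult germ_add germ_closed
  show "abelian_group ?S"
  proof (rule abelian_groupI)
    fix x y z assume "x \<in> carrier ?S" "y \<in> carrier ?S" "z \<in> carrier ?S"
    then show "x \<oplus>\<^bsub>?S\<^esub> y \<oplus>\<^bsub>?S\<^esub> z = x \<oplus>\<^bsub>?S\<^esub> (y \<oplus>\<^bsub>?S\<^esub> z)"
      by (rule stalk_cases3) (simp add: ops cring.cring_simprules(1,7)[OF cring_sec])
  next
    fix x y assume xy: "x \<in> carrier ?S" "y \<in> carrier ?S"
    then show "x \<oplus>\<^bsub>?S\<^esub> y = y \<oplus>\<^bsub>?S\<^esub> x"
      by (rule stalk_cases2) (simp add: ops cring.cring_simprules(10)[OF cring_sec])
    show "x \<oplus>\<^bsub>?S\<^esub> y \<in> carrier ?S"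
      using xy by (rule stalk_cases2) (simp add: ops cring.cring_simprules(1)[OF cring_sec])
  next
    fix x assume "x \<in> carrier ?S"
    then obtain U s where U: "opn X U" "p \<in> U" "s \<in> carrier (sec X U)" "x = germ X p U s"
      by (rule stalk_cases)
    interpret S: cring "sec X U" using U(1) by (rule cring_sec)
    show "\<zero>\<^bsub>?S\<^esub> \<oplus>\<^bsub>?S\<^esub> x = x" using U by (simp add: germ_zero[OF U(1,2)] germ_add)
    have "germ X p U (\<ominus>\<^bsub>sec X U\<^esub> s) \<oplus>\<^bsub>?S\<^esub> x = \<zero>\<^bsub>?S\<^esub>"
      using U by (simp add: germ_zero[OF U(1,2)] germ_add S.l_neg)
    then show "\<exists>y\<in>carrier ?S. y \<oplus>\<^bsub>?S\<^esub> x = \<zero>\<^bsub>?S\<^esub>"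
      using germ_closed[OF U(1,2), of "\<ominus>\<^bsub>sec X U\<^esub> s"] U(3) by auto
  next
    show "\<zero>\<^bsub>?S\<^esub> \<in> carrier ?S"
      using germ_closed[of "pts X" p] germ_zero[of "pts X" p] p cring.cring_simprules(2)[OF cring_sec, of "pts X"]
      by simp
  qed
  show "comm_monoid ?S"
  proof (rule comm_monoidI)
    fix x y z assume "x \<in> carrier ?S" "y \<in> carrier ?S" "z \<in> carrier ?S"
    then show "x \<otimes>\<^bsub>?S\<^esub> y \<otimes>\<^bsub>?S\<^esub> z = x \<otimes>\<^bsub>?S\<^esub> (y \<otimes>\<^bsub>?S\<^esub> z)"
      by (rule stalk_cases3) (simp add: ops cring.cring_simprules(5,11)[OF cring_sec])
  next
    fix x y assume xy: "x \<in> carrier ?S" "y \<in> carrier ?S"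
    then show "x \<otimes>\<^bsub>?S\<^esub> y = y \<otimes>\<^bsub>?S\<^esub> x"
      by (rule stalk_cases2) (simp add: ops cring.cring_simprules(14)[OF cring_sec])
    show "x \<otimes>\<^bsub>?S\<^esub> y \<in> carrier ?S"
      using xy by (rule stalk_cases2) (simp add: ops cring.cring_simprules(5)[OF cring_sec])
  next
    fix x assume "x \<in> carrier ?S"
    then obtain U s where U: "opn X U" "p \<in> U" "s \<in> carrier (sec X U)" "x = germ X p U s"
      by (rule stalk_cases)
    interpret S: cring "sec X U" using U(1) by (rule cring_sec)
    show "\<one>\<^bsub>?S\<^esub> \<otimes>\<^bsub>?S\<^esub> x = x" using U by (simp add: germ_one[OF U(1,2)] germ_mult)
  next
    show "\<one>\<^bsub>?S\<^esub> \<in> carrier ?S"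
      using germ_closed[of "pts X" p] germ_one[of "pts X" p] p cring.cring_simprules(6)[OF cring_sec, of "pts X"]
      by simp
  qed
  fix x y z assume "x \<in> carrier ?S" "y \<in> carrier ?S" "z \<in> carrier ?S"
  then show "(x \<oplus>\<^bsub>?S\<^esub> y) \<otimes>\<^bsub>?S\<^esub> z = x \<otimes>\<^bsub>?S\<^esub> z \<oplus>\<^bsub>?S\<^esub> y \<otimes>\<^bsub>?S\<^esub> z"
    by (rule stalk_cases3) (simp add: ops cring.cring_simprules(1,5,13)[OF cring_sec])
qed

text \<open>An inverse germ is represented by a section \<open>t\<close> on some \<open>V\<close>,
  but its product with \<open>s\<close> becomes one only after restriction to a smaller
  \<open>Z\<close>; there the restriction of \<open>s\<close> is a unit.\<close>

lemma germ_Units_iff: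
  assumes U: "opn X U" "p \<in> U" "s \<in> carrier (sec X U)"
  shows "germ X p U s \<in> Units (stalk X p) \<longleftrightarrow> inv_at X p U s"
proof -
  have p: "p \<in> pts X" using openin_subset[OF U(1)] U(2) by blast
  interpret S: cring "stalk X p" by (rule cring_stalk[OF p])
  show ?thesis
  proof
    assume "germ X p U s \<in> Units (stalk X p)"
    then obtain y where y: "y \<in> carrier (stalk X p)" "germ X p U s \<otimes>\<^bsub>stalk X p\<^esub> y = \<one>\<^bsub>stalk X p\<^esub>"
      by (auto simp: Units_def)
    from y(1) obtain V t where V: "opn X V" "p \<in> V" "t \<in> carrier (sec X V)" "y = germ X p V t"
      by (rule stalk_cases)
    let ?W = "U \<inter> V"
    have o: "opn X ?W" "p \<in> ?W" using U V by blast+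
    have c: "res X U ?W s \<in> carrier (sec X ?W)" "res X V ?W t \<in> carrier (sec X ?W)"
      using U V o by (auto intro: res_closed)
    interpret W: cring "sec X ?W" by (rule cring_sec[OF o(1)])
    have "germ X p ?W (res X U ?W s \<otimes>\<^bsub>sec X ?W\<^esub> res X V ?W t) = germ X p ?W \<one>\<^bsub>sec X ?W\<^esub>"
      using y(2) germ_res[of U ?W p s] germ_res[of V ?W p t] U V o germ_mult[OF o c]
      by (simp add: germ_one[OF o])
    then obtain Z where Z: "opn X Z" "p \<in> Z" "Z \<subseteq> ?W"
      "res X ?W Z (res X U ?W s \<otimes>\<^bsub>sec X ?W\<^esub> res X V ?W t) = res X ?W Z \<one>\<^bsub>sec X ?W\<^esub>"
      using germ_eqD[OF o W.one_closed] by metis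
    interpret Z: cring "sec X Z" by (rule cring_sec[OF Z(1)])
    note h = res_hom[OF o(1) Z(1,3)]
    have "res X U Z s \<otimes>\<^bsub>sec X Z\<^esub> res X ?W Z (res X V ?W t) = \<one>\<^bsub>sec X Z\<^esub>"
      using Z(4) ring_hom_mult[OF h c] ring_hom_one[OF h] res_res[of U ?W Z s] U V o Z by simp
    moreover have "res X U Z s \<in> carrier (sec X Z)" using U Z by (intro res_closed) auto
    moreover have "res X ?W Z (res X V ?W t) \<in> carrier (sec X Z)"
      by (rule res_closed[OF o(1) Z(1,3) c(2)])
    ultimately have "res X U Z s \<in> Units (sec X Z)" by (intro Z.UnitsI)
    then show "inv_at X p U s" using Z by (auto simp: inv_at_def)
  next
    assume "inv_at X p U s"
    then obtain W where W: "opn X W" "p \<in> W" "W \<subseteq> U" "res X U W s \<in> Units (sec X W)"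
      by (auto simp: inv_at_def)
    interpret W: cring "sec X W" by (rule cring_sec[OF W(1)])
    from W(4) obtain t where t: "t \<in> carrier (sec X W)" "res X U W s \<otimes>\<^bsub>sec X W\<^esub> t = \<one>\<^bsub>sec X W\<^esub>"
      by (auto simp: Units_def)
    have "germ X p U s \<otimes>\<^bsub>stalk X p\<^esub> germ X p W t = \<one>\<^bsub>stalk X p\<^esub>"
      using germ_res[of U W p s] U W t germ_mult[OF W(1,2), of "res X U W s" t]
      by (simp add: germ_one[OF W(1,2)] res_closed)
    then show "germ X p U s \<in> Units (stalk X p)"
      using germ_closed U W t by (intro S.UnitsI)
  qed
qed

lemma inv_at_res_iff:
  assumes "opn X U" "opn X V" "p \<in> V" "V \<subseteq> U" "s \<in> carrier (sec X U)"
  shows "inv_at X p V (res X U V s) \<longleftrightarrow> inv_at X p U s"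
  using germ_Units_iff[of V p "res X U V s"] germ_Units_iff[of U p s] germ_res[of U V p s]
    res_closed[of U V s] assms by auto

end

section \<open>Morphisms of ringed spaces, with locality phrased through units\<close>

definition premorphism ::
  "('a, 'b, 'm) ringed_space_scheme \<Rightarrow> ('c, 'd, 'n) ringed_space_scheme
     \<Rightarrow> ('a, 'b, 'c, 'd) lrs_map \<Rightarrow> bool" where
  "premorphism X Y f \<longleftrightarrow>
     continuous_map (space_of X) (space_of Y) (pt f) \<and>
     (\<forall>V. opn Y V \<longrightarrow> co f V \<in> ring_hom (sec Y V) (sec X (preim X f V))) \<and>
     (\<forall>V W. opn Y V \<and> opn Y W \<and> W \<subseteq> V \<longrightarrow>
        (\<forall>s\<in>carrier (sec Y V).
           co f W (res Y V W s) = res X (preim X f V) (preim X f W) (co f V s)))"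

text \<open>Locality of the stalk maps, read as: what becomes a unit was already a unit. Without
  maximal ideals in the statement it composes directly and passes along
  \<open>eq_map\<close>.\<close>

definition reflects ::
  "('a, 'b, 'm) ringed_space_scheme \<Rightarrow> ('c, 'd, 'n) ringed_space_scheme
     \<Rightarrow> ('a, 'b, 'c, 'd) lrs_map \<Rightarrow> bool" where
  "reflects X Y f \<longleftrightarrow> (\<forall>V t p. opn Y V \<and> t \<in> carrier (sec Y V) \<and> p \<in> preim X f V \<and>
     inv_at X p (preim X f V) (co f V t) \<longrightarrow> inv_at Y (pt f p) V t)"

lemma mem_preim: "p \<in> preim X f V \<longleftrightarrow> p \<in> pts X \<and> pt f p \<in> V"
  by (auto simp: preim_def)

lemma preim_mono: "W \<subseteq> V \<Longrightarrow> preim X f W \<subseteq> preim X f V"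
  by (auto simp: preim_def)

lemma premorphism_pt: "\<lbrakk>premorphism X Y f; p \<in> pts X\<rbrakk> \<Longrightarrow> pt f p \<in> pts Y"
  unfolding premorphism_def continuous_map_def Pi_iff by blast

lemma preim_open: "\<lbrakk>premorphism X Y f; opn Y V\<rbrakk> \<Longrightarrow> opn X (preim X f V)"
  by (simp add: premorphism_def continuous_map_def preim_def)

lemma preim_pts: "premorphism X Y f \<Longrightarrow> preim X f (pts Y) = pts X"
  using premorphism_pt by (auto simp: preim_def)

lemma co_hom: "\<lbrakk>premorphism X Y f; opn Y V\<rbrakk> \<Longrightarrow> co f V \<in> ring_hom (sec Y V) (sec X (preim X f V))"
  by (simp add: premorphism_def)

lemma co_closed:
  "\<lbrakk>premorphism X Y f; opn Y V; s \<in> carrier (sec Y V)\<rbrakk> \<Longrightarrow> co f V s \<in> carrier (sec X (preim X f V))"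
  by (rule ring_hom_closed[OF co_hom])

lemma co_res:
  "\<lbrakk>premorphism X Y f; opn Y V; opn Y W; W \<subseteq> V; s \<in> carrier (sec Y V)\<rbrakk>
    \<Longrightarrow> co f W (res Y V W s) = res X (preim X f V) (preim X f W) (co f V s)"
  by (simp add: premorphism_def)

lemma lrs_imp_premorphism: "lrs_morphism X Y f \<Longrightarrow> premorphism X Y f"
  by (simp add: lrs_morphism_def premorphism_def)

lemma preim_comp_map:
  "premorphism X Y f \<Longrightarrow> preim X (comp_map Y g f) V = preim X f (preim Y g V)"
  using premorphism_pt by (auto simp: preim_def comp_map_def)

lemma premorphism_comp:
  assumes f: "premorphism X Y f" and g: "premorphism Y Z g"
  shows "premorphism X Z (comp_map Y g f)"
  unfolding premorphism_def
proof (intro conjI allI impI ballI)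
  show "continuous_map (space_of X) (space_of Z) (pt (comp_map Y g f))"
    using f g continuous_map_compose[of "space_of X" "space_of Y" "pt f" "space_of Z" "pt g"]
    by (simp add: premorphism_def comp_map_def comp_def)
next
  fix V assume V: "opn Z V"
  show "co (comp_map Y g f) V \<in> ring_hom (sec Z V) (sec X (preim X (comp_map Y g f) V))"
    using ring_hom_trans[OF co_hom[OF g V] co_hom[OF f preim_open[OF g V]]]
    unfolding preim_comp_map[OF f] by (simp add: comp_map_def comp_def)
next
  fix V W s assume VW: "opn Z V \<and> opn Z W \<and> W \<subseteq> V" and s: "s \<in> carrier (sec Z V)"
  then show "co (comp_map Y g f) W (res Z V W s) =
      res X (preim X (comp_map Y g f) V) (preim X (comp_map Y g f) W) (co (comp_map Y g f) V s)"
    using co_res[OF g, of V W s] co_closed[OF g, of V s] preim_open[OF g] preim_mono[of W V Y g]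
      co_res[OF f, of "preim Y g V" "preim Y g W" "co g V s"]
    unfolding preim_comp_map[OF f] by (simp add: comp_map_def)
qed

lemma reflects_comp:
  assumes f: "premorphism X Y f" and g: "premorphism Y Z g" and "reflects X Y f" "reflects Y Z g"
  shows "reflects X Z (comp_map Y g f)"
  unfolding reflects_def
proof (intro allI impI, elim conjE)
  fix V t p
  assume V: "opn Z V" "t \<in> carrier (sec Z V)" and p: "p \<in> preim X (comp_map Y g f) V"
    and inv: "inv_at X p (preim X (comp_map Y g f) V) (co (comp_map Y g f) V t)"
  have p': "p \<in> preim X f (preim Y g V)" using p by (simp add: preim_comp_map[OF f])
  have "inv_at X p (preim X f (preim Y g V)) (co f (preim Y g V) (co g V t))"
    using inv by (simp add: preim_comp_map[OF f]) (simp add: comp_map_def)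
  then have "inv_at Y (pt f p) (preim Y g V) (co g V t)"
    using assms(3) preim_open[OF g V(1)] co_closed[OF g V] p' unfolding reflects_def by blast
  moreover have "pt f p \<in> preim Y g V" using p' by (simp add: mem_preim)
  ultimately have "inv_at Z (pt g (pt f p)) V t"
    using assms(4) V unfolding reflects_def by blast
  then show "inv_at Z (pt (comp_map Y g f) p) V t" by (simp add: comp_map_def)
qed

lemma inv_at_co:
  assumes f: "premorphism X Y f" and V: "opn Y V" "t \<in> carrier (sec Y V)" "p \<in> preim X f V"
    and inv: "inv_at Y (pt f p) V t"
  shows "inv_at X p (preim X f V) (co f V t)"
proof -
  obtain W where W: "opn Y W" "pt f p \<in> W" "W \<subseteq> V" "res Y V W t \<in> Units (sec Y W)"
    using inv unfolding inv_at_def by blast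
  have "co f W (res Y V W t) \<in> Units (sec X (preim X f W))"
    using ring_hom_Units[OF co_hom[OF f W(1)] W(4)] .
  then have "res X (preim X f V) (preim X f W) (co f V t) \<in> Units (sec X (preim X f W))"
    using co_res[OF f V(1) W(1) W(3) V(2)] by simp
  moreover have "p \<in> preim X f W" using V(3) W(2) by (simp add: mem_preim)
  ultimately show ?thesis
    unfolding inv_at_def using preim_open[OF f W(1)] preim_mono[OF W(3), of X f]
    by (intro exI[of _ "preim X f W"]) simp
qed

text \<open>\<open>stalk_map\<close> is a union over all representatives of a germ; compatibility of
  \<open>f\<close> with restriction makes all its terms equal.\<close>

lemma stalk_map_germ:
  assumes X: "presheaf X" and Y: "presheaf Y" and f: "premorphism X Y f"
    and V: "opn Y V" "t \<in> carrier (sec Y V)" "p \<in> preim X f V"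
  shows "stalk_map X f p (germ Y (pt f p) V t) = germ X p (preim X f V) (co f V t)"
proof -
  interpret X: presheaf X by (rule X)
  interpret Y: presheaf Y by (rule Y)
  have fp: "pt f p \<in> V" using V(3) by (simp add: mem_preim)
  have "germ X p (preim X f V') (co f V' t') = germ X p (preim X f V) (co f V t)"
    if h: "(V', t') \<in> germ Y (pt f p) V t" for V' t'
  proof (rule Y.germ_memD[OF h])
    fix W
    assume W: "opn Y V'" "pt f p \<in> V'" "t' \<in> carrier (sec Y V')" "opn Y W" "pt f p \<in> W"
      "W \<subseteq> V" "W \<subseteq> V'" "res Y V W t = res Y V' W t'"
    have "res X (preim X f V') (preim X f W) (co f V' t') = res X (preim X f V) (preim X f W) (co f V t)"
      using co_res[OF f W(1,4,7,3)] co_res[OF f V(1) W(4,6) V(2)] W(8) by simp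
    moreover have "p \<in> preim X f W" using V(3) W(5) by (simp add: mem_preim)
    moreover have "preim X f W \<subseteq> preim X f V' \<inter> preim X f V"
      using preim_mono[OF W(6), of X f] preim_mono[OF W(7), of X f] by blast
    ultimately show ?thesis
      using preim_open[OF f] W V co_closed[OF f] by (intro X.germ_eqI[of _ _ "preim X f W"])
  qed
  then show ?thesis
    unfolding stalk_map_def using Y.germ_self[OF V(1) fp V(2)] by fast
qed

text \<open>A non-unit germ lies in some maximal ideal \<open>M\<close> of the stalk at the image
  point. \<open>nz\<close> supplies a maximal ideal \<open>N\<close> of the stalk at
  \<open>p\<close>, without which \<open>local_hom\<close> would say nothing; \<open>M\<close> is
  sent into \<open>N\<close>, so the pulled back germ is a non-unit.\<close>

lemma lrs_imp_reflects:
  assumes X: "presheaf X" and Y: "presheaf Y" and f: "lrs_morphism X Y f"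
    and nz: "\<And>p. p \<in> pts X \<Longrightarrow> \<zero>\<^bsub>stalk X p\<^esub> \<notin> Units (stalk X p)"
  shows "reflects X Y f"
  unfolding reflects_def
proof (intro allI impI, elim conjE)
  fix V t p
  assume V: "opn Y V" "t \<in> carrier (sec Y V)" and p: "p \<in> preim X f V"
    and inv: "inv_at X p (preim X f V) (co f V t)"
  interpret X: presheaf X by (rule X)
  interpret Y: presheaf Y by (rule Y)
  have pm: "premorphism X Y f" using f by (rule lrs_imp_premorphism)
  have pX: "p \<in> pts X" and fp: "pt f p \<in> V" using p by (auto simp: mem_preim)
  have fY: "pt f p \<in> pts Y" using premorphism_pt[OF pm pX] .
  interpret A: cring "stalk Y (pt f p)" by (rule Y.cring_stalk[OF fY])
  interpret B: cring "stalk X p" by (rule X.cring_stalk[OF pX])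
  let ?g = "germ Y (pt f p) V t"
  have gc: "?g \<in> carrier (stalk Y (pt f p))" using Y.germ_closed[OF V(1) fp V(2)] .
  have loc: "local_hom (stalk Y (pt f p)) (stalk X p) (stalk_map X f p)"
    using f pX by (simp add: lrs_morphism_def)
  have u: "stalk_map X f p ?g \<in> Units (stalk X p)"
    unfolding stalk_map_germ[OF X Y pm V p]
    using X.germ_Units_iff[OF preim_open[OF pm V(1)] p co_closed[OF pm V]] inv by blast
  show "inv_at Y (pt f p) V t"
  proof (rule ccontr)
    assume "\<not> inv_at Y (pt f p) V t"
    then have "?g \<notin> Units (stalk Y (pt f p))" using Y.germ_Units_iff[OF V(1) fp V(2)] by blast
    then obtain M where M: "maximalideal M (stalk Y (pt f p))" "?g \<in> M"
      using A.nonunit_in_maximalideal[OF gc] by blast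
    obtain N where N: "maximalideal N (stalk X p)"
      using B.nonunit_in_maximalideal[OF B.zero_closed nz[OF pX]] by blast
    have "stalk_map X f p ?g \<in> N" using loc M N unfolding local_hom_def by blast
    then show False using maximalideal.no_Units[OF N] u by blast
  qed
qed

text \<open>Elements of a maximal ideal \<open>M\<close> are non-units, hence by
  \<open>reflects\<close> so are their images, and by \<open>loc\<close> every maximal ideal
  \<open>N\<close> of the stalk at \<open>p\<close> contains all non-units.\<close>

lemma reflects_imp_lrs:
  assumes X: "presheaf X" and Y: "presheaf Y" and f: "premorphism X Y f" and r: "reflects X Y f"
    and loc: "\<And>p x y. \<lbrakk>p \<in> pts X; x \<in> carrier (stalk X p); y \<in> carrier (stalk X p);
      x \<notin> Units (stalk X p); y \<notin> Units (stalk X p)\<rbrakk> \<Longrightarrow> x \<oplus>\<^bsub>stalk X p\<^esub> y \<notin> Units (stalk X p)"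
  shows "lrs_morphism X Y f"
proof -
  interpret X: presheaf X by (rule X)
  interpret Y: presheaf Y by (rule Y)
  have "local_hom (stalk Y (pt f p)) (stalk X p) (stalk_map X f p)" if p: "p \<in> pts X" for p
  proof -
    have fY: "pt f p \<in> pts Y" using premorphism_pt[OF f p] .
    interpret B: cring "stalk X p" by (rule X.cring_stalk[OF p])
    have sm: "stalk_map X f p (germ Y (pt f p) V t) = germ X p (preim X f V) (co f V t)"
      and pV: "p \<in> preim X f V"
      if "opn Y V" "pt f p \<in> V" "t \<in> carrier (sec Y V)" for V t
      using stalk_map_germ[OF X Y f, of V t p] that p by (auto simp: mem_preim)
    have hom: "stalk_map X f p \<in> ring_hom (stalk Y (pt f p)) (stalk X p)"
    proof (rule ring_hom_memI)
      fix x assume "x \<in> carrier (stalk Y (pt f p))"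
      then obtain V t where V: "opn Y V" "pt f p \<in> V" "t \<in> carrier (sec Y V)" "x = germ Y (pt f p) V t"
        by (rule Y.stalk_cases)
      then show "stalk_map X f p x \<in> carrier (stalk X p)"
        using X.germ_closed[OF preim_open[OF f V(1)] pV[OF V(1-3)] co_closed[OF f V(1,3)]] sm by simp
    next
      fix x y assume "x \<in> carrier (stalk Y (pt f p))" "y \<in> carrier (stalk Y (pt f p))"
      then obtain V s t where V: "opn Y V" "pt f p \<in> V" and s: "s \<in> carrier (sec Y V)"
        and t: "t \<in> carrier (sec Y V)" and xy: "x = germ Y (pt f p) V s" "y = germ Y (pt f p) V t"
        by (rule Y.stalk_cases2)
      interpret S: cring "sec Y V" by (rule Y.cring_sec[OF V(1)])
      note c = preim_open[OF f V(1)] pV[OF V s] co_closed[OF f V(1) s] co_closed[OF f V(1) t]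
      show "stalk_map X f p (x \<otimes>\<^bsub>stalk Y (pt f p)\<^esub> y) = stalk_map X f p x \<otimes>\<^bsub>stalk X p\<^esub> stalk_map X f p y"
        unfolding xy Y.germ_mult[OF V s t] sm[OF V s] sm[OF V t] sm[OF V S.m_closed[OF s t]] X.germ_mult[OF c]
        by (simp add: ring_hom_mult[OF co_hom[OF f V(1)] s t])
      show "stalk_map X f p (x \<oplus>\<^bsub>stalk Y (pt f p)\<^esub> y) = stalk_map X f p x \<oplus>\<^bsub>stalk X p\<^esub> stalk_map X f p y"
        unfolding xy Y.germ_add[OF V s t] sm[OF V s] sm[OF V t] sm[OF V S.a_closed[OF s t]] X.germ_add[OF c]
        by (simp add: ring_hom_add[OF co_hom[OF f V(1)] s t])
    next
      interpret S: cring "sec Y (pts Y)" by (rule Y.cring_sec) simp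
      have "stalk_map X f p (germ Y (pt f p) (pts Y) \<one>\<^bsub>sec Y (pts Y)\<^esub>)
        = germ X p (pts X) \<one>\<^bsub>sec X (pts X)\<^esub>"
        using sm[of "pts Y" "\<one>\<^bsub>sec Y (pts Y)\<^esub>"] fY ring_hom_one[OF co_hom[OF f, of "pts Y"]]
        by (simp add: preim_pts[OF f])
      then show "stalk_map X f p \<one>\<^bsub>stalk Y (pt f p)\<^esub> = \<one>\<^bsub>stalk X p\<^esub>"
        using Y.germ_one[of "pts Y" "pt f p"] X.germ_one[of "pts X" p] fY p by simp
    qed
    have "stalk_map X f p x \<in> N"
      if M: "maximalideal M (stalk Y (pt f p))" "x \<in> M" and N: "maximalideal N (stalk X p)" for M N x
    proof -
      interpret M: maximalideal M "stalk Y (pt f p)" by (rule M(1))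
      have xc: "x \<in> carrier (stalk Y (pt f p))" using M(2) M.a_subset by blast
      then obtain V t where V: "opn Y V" "pt f p \<in> V" "t \<in> carrier (sec Y V)" "x = germ Y (pt f p) V t"
        by (rule Y.stalk_cases)
      have "\<not> inv_at Y (pt f p) V t"
        using M.no_Units[OF M(2)] Y.germ_Units_iff[OF V(1-3)] V(4) by blast
      then have "\<not> inv_at X p (preim X f V) (co f V t)"
        using r V pV[OF V(1-3)] unfolding reflects_def by blast
      then have "stalk_map X f p x \<notin> Units (stalk X p)"
        using X.germ_Units_iff[OF preim_open[OF f V(1)] pV[OF V(1-3)] co_closed[OF f V(1,3)]]
          sm[OF V(1-3)] V(4) by simp
      then show ?thesis
        using B.nonunits_in_maximalideal[OF loc[OF p] N] ring_hom_closed[OF hom xc] by blast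
    qed
    then show ?thesis unfolding local_hom_def using hom by blast
  qed
  then show ?thesis using f by (simp add: lrs_morphism_def premorphism_def)
qed

section \<open>Stalks of a spectrum\<close>

context cring
begin

lemma presheaf_locale_spec: "presheaf (spec R)"
  by (rule presheaf.intro) (rule presheaf_spec)

lemma spec_sec_fraction_at:
  assumes "openin (zariski R) U" "\<sigma> \<in> carrier (spec_sec R U)" "P \<in> U"
  obtains a s where "a \<in> carrier R" "s \<in> carrier R" "s \<notin> P" "\<sigma> P = fraction_at R P a s"
  using spec_sec_local[OF assms(2,3)] by metis

text \<open>The value at \<open>P\<close> alone decides. A numerator \<open>b\<close> valid around
  \<open>P\<close> is outside \<open>P\<close> because \<open>b/t\<close> and \<open>a/s\<close> are
  the same unit at \<open>P\<close>, and then \<open>t/b\<close> is an inverse section on the part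
  of the neighbourhood where \<open>b\<close> is outside the prime.\<close>

lemma inv_at_spec_iff:
  assumes U: "openin (zariski R) U" and \<sigma>: "\<sigma> \<in> carrier (spec_sec R U)" and P: "P \<in> U"
    and as: "a \<in> carrier R" "s \<in> carrier R" "s \<notin> P" "\<sigma> P = fraction_at R P a s"
  shows "inv_at (spec R) P U \<sigma> \<longleftrightarrow> a \<notin> P"
proof
  have prime: "primeideal P R" using zariski_prime[OF U P] .
  assume "inv_at (spec R) P U \<sigma>"
  then obtain W where W: "openin (zariski R) W" "P \<in> W" "W \<subseteq> U" "restrict \<sigma> W \<in> Units (spec_sec R W)"
    by (auto simp: inv_at_def)
  then obtain \<tau> where \<tau>: "\<tau> \<in> carrier (spec_sec R W)" "\<tau> \<otimes>\<^bsub>spec_sec R W\<^esub> restrict \<sigma> W = \<one>\<^bsub>spec_sec R W\<^esub>"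
    "restrict \<sigma> W \<otimes>\<^bsub>spec_sec R W\<^esub> \<tau> = \<one>\<^bsub>spec_sec R W\<^esub>"
    by (auto simp: Units_def)
  have "\<tau> P \<otimes>\<^bsub>localize_at R P\<^esub> \<sigma> P = \<one>\<^bsub>localize_at R P\<^esub>" "\<sigma> P \<otimes>\<^bsub>localize_at R P\<^esub> \<tau> P = \<one>\<^bsub>localize_at R P\<^esub>"
    using fun_cong[OF \<tau>(2), of P] fun_cong[OF \<tau>(3), of P] W(2) by (simp_all add: spec_sec_ops_at)
  then have "\<sigma> P \<in> Units (localize_at R P)"
    using spec_sec_at[OF \<tau>(1) W(2)] spec_sec_at[OF \<sigma> P] unfolding Units_def by blast
  then show "a \<notin> P" using primeideal.Units_localize_iff[OF prime] as by auto
next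
  assume a: "a \<notin> P"
  have prime: "primeideal P R" using zariski_prime[OF U P] .
  show "inv_at (spec R) P U \<sigma>"
  proof (rule spec_sec_local[OF \<sigma> P])
    fix V b t
    assume V: "openin (zariski R) V" "P \<in> V" "V \<subseteq> U" "b \<in> carrier R" "t \<in> carrier R"
      "\<forall>Q\<in>V. t \<notin> Q \<and> \<sigma> Q = fraction_at R Q b t"
    have "fraction_at R P b t \<in> Units (localize_at R P)"
      using V(2,6) as a primeideal.Units_localize_iff[OF prime, of a s] by auto
    then have b: "b \<notin> P" using V primeideal.Units_localize_iff[OF prime, of b t] by auto
    let ?W = "V \<inter> basic_open R b"
    have W: "openin (zariski R) ?W" using V(1) openin_basic_open[OF V(4)] by (rule openin_Int)
    have PW: "P \<in> ?W" using V(2) b prime by (simp add: basic_open_def)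
    let ?\<tau> = "\<lambda>Q\<in>?W. fraction_at R Q t b"
    have \<tau>: "?\<tau> \<in> carrier (spec_sec R ?W)"
      using W V by (intro fraction_section_closed) (auto simp: basic_open_def)
    interpret S: cring "spec_sec R ?W" by (rule cring_spec_sec[OF W])
    have \<sigma>W: "restrict \<sigma> ?W \<in> carrier (spec_sec R ?W)"
      using restrict_spec_sec[OF U W _ \<sigma>] V(3) by blast
    have "restrict \<sigma> ?W \<otimes>\<^bsub>spec_sec R ?W\<^esub> ?\<tau> = \<one>\<^bsub>spec_sec R ?W\<^esub>"
    proof (rule spec_sec_eqI[of _ ?W])
      fix Q assume Q: "Q \<in> ?W"
      then have q: "primeideal Q R" "t \<notin> Q" "b \<notin> Q" "\<sigma> Q = fraction_at R Q b t"
        using V by (auto simp: basic_open_def)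
      have "fraction_at R Q (b \<otimes> t) (t \<otimes> b) = fraction_at R Q \<one> \<one>"
        using q V(4,5) mult_notin_prime[OF q(1), of t b] one_notin_prime[OF q(1)]
        by (intro fraction_eqI_at[OF q(1)]) (simp_all add: m_comm)
      then show "(restrict \<sigma> ?W \<otimes>\<^bsub>spec_sec R ?W\<^esub> ?\<tau>) Q = \<one>\<^bsub>spec_sec R ?W\<^esub> Q"
        unfolding spec_sec_ops_at[OF Q] using Q q V(4,5)
        by (simp add: fraction_mult_at[OF q(1)] mult_set.localize_one[OF mult_set_prime[OF q(1)]])
    qed (use \<sigma>W \<tau> in \<open>simp_all del: Int_iff\<close>)
    then have "restrict \<sigma> ?W \<in> Units (spec_sec R ?W)" using \<sigma>W \<tau> by (intro S.UnitsI)
    then show ?thesis unfolding inv_at_def spec_simps using W PW V(3) by blast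
  qed
qed

lemma stalk_spec_Units_iff:
  assumes U: "openin (zariski R) U" and \<sigma>: "\<sigma> \<in> carrier (spec_sec R U)" and P: "P \<in> U"
    and as: "a \<in> carrier R" "s \<in> carrier R" "s \<notin> P" "\<sigma> P = fraction_at R P a s"
  shows "germ (spec R) P U \<sigma> \<in> Units (stalk (spec R) P) \<longleftrightarrow> a \<notin> P"
  using inv_at_spec_iff[OF assms] presheaf.germ_Units_iff[OF presheaf_locale_spec, of U P \<sigma>] U \<sigma> P
  by simp

lemma stalk_spec_nontrivial:
  assumes "P \<in> pts (spec R)"
  shows "\<zero>\<^bsub>stalk (spec R) P\<^esub> \<notin> Units (stalk (spec R) P)"
proof -
  let ?U = "topspace (zariski R)"
  have U: "openin (zariski R) ?U" "P \<in> ?U" using assms by auto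
  have prime: "primeideal P R" using zariski_prime[OF U] .
  interpret P: primeideal P R by (rule prime)
  have "germ (spec R) P ?U (spec_const R ?U \<zero>) \<in> Units (stalk (spec R) P) \<longleftrightarrow> \<zero> \<notin> P"
    using U one_notin_prime[OF prime] spec_const_closed[OF U(1)]
    by (intro stalk_spec_Units_iff[where s=\<one>]) (simp_all add: spec_const_def)
  then show ?thesis
    using presheaf.germ_zero[OF presheaf_locale_spec, of ?U P] U P.zero_closed
    by (simp add: spec_const_zero)
qed

text \<open>The non-units are the germs whose value at \<open>P\<close> has its numerator in
  \<open>P\<close>, and \<open>t \<otimes> a \<oplus> s \<otimes> b\<close> lies in \<open>P\<close>
  along with \<open>a\<close> and \<open>b\<close>.\<close>

lemma stalk_spec_local:
  assumes P: "P \<in> pts (spec R)"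
    and xy: "x \<in> carrier (stalk (spec R) P)" "y \<in> carrier (stalk (spec R) P)"
    and nu: "x \<notin> Units (stalk (spec R) P)" "y \<notin> Units (stalk (spec R) P)"
  shows "x \<oplus>\<^bsub>stalk (spec R) P\<^esub> y \<notin> Units (stalk (spec R) P)"
proof (rule presheaf.stalk_cases2[OF presheaf_locale_spec xy])
  fix U \<sigma> \<tau>
  assume "opn (spec R) U" "P \<in> U" "\<sigma> \<in> carrier (sec (spec R) U)" "\<tau> \<in> carrier (sec (spec R) U)"
    and e: "x = germ (spec R) P U \<sigma>" "y = germ (spec R) P U \<tau>"
  then have U: "openin (zariski R) U" and PU: "P \<in> U" and \<sigma>: "\<sigma> \<in> carrier (spec_sec R U)"
    and \<tau>: "\<tau> \<in> carrier (spec_sec R U)" by simp_all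
  have prime: "primeideal P R" using zariski_prime[OF U PU] .
  interpret P: primeideal P R by (rule prime)
  obtain a s where a: "a \<in> carrier R" "s \<in> carrier R" "s \<notin> P" "\<sigma> P = fraction_at R P a s"
    by (rule spec_sec_fraction_at[OF U \<sigma> PU])
  obtain b t where b: "b \<in> carrier R" "t \<in> carrier R" "t \<notin> P" "\<tau> P = fraction_at R P b t"
    by (rule spec_sec_fraction_at[OF U \<tau> PU])
  have "a \<in> P" "b \<in> P"
    using nu e stalk_spec_Units_iff[OF U \<sigma> PU a] stalk_spec_Units_iff[OF U \<tau> PU b] by simp_all
  then have in_P: "t \<otimes> a \<oplus> s \<otimes> b \<in> P" using a b by (intro P.a_closed P.I_l_closed)
  have "(\<sigma> \<oplus>\<^bsub>spec_sec R U\<^esub> \<tau>) P = fraction_at R P (t \<otimes> a \<oplus> s \<otimes> b) (s \<otimes> t)"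
    using a b by (simp add: spec_sec_ops_at[OF PU] fraction_add_at[OF prime])
  then have "germ (spec R) P U (\<sigma> \<oplus>\<^bsub>spec_sec R U\<^esub> \<tau>) \<notin> Units (stalk (spec R) P)"
    using stalk_spec_Units_iff[OF U spec_sec_add_closed[OF U \<sigma> \<tau>] PU, of "t \<otimes> a \<oplus> s \<otimes> b" "s \<otimes> t"]
      in_P a b mult_notin_prime[OF prime, of s t] by simp
  then show ?thesis
    using presheaf.germ_add[OF presheaf_locale_spec, of U P \<sigma> \<tau>] U PU \<sigma> \<tau> e by simp
qed

text \<open>The two requirements on stalks, nontriviality and closure of non-units under addition,
  concern the source, where they are known; the target may thus be any presheaf of rings.\<close>

lemma lrs_from_spec_iff:
  assumes Y: "presheaf Y"
  shows "lrs_morphism (spec R) Y f \<longleftrightarrow> premorphism (spec R) Y f \<and> reflects (spec R) Y f"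
  using lrs_imp_premorphism[of "spec R" Y f]
    lrs_imp_reflects[OF presheaf_locale_spec Y _ stalk_spec_nontrivial]
    reflects_imp_lrs[OF presheaf_locale_spec Y _ _ stalk_spec_local] by blast

end

section \<open>Morphisms of spectra\<close>

locale spec_hom = A: cring A + B: cring B
  for A :: "('s, 'm) ring_scheme" and B :: "('r, 'n) ring_scheme" and \<phi> :: "'s \<Rightarrow> 'r" +
  assumes hom: "\<phi> \<in> ring_hom A B"
begin

abbreviation contract :: "'r set \<Rightarrow> 's set" where
  "contract P \<equiv> {a \<in> carrier A. \<phi> a \<in> P}"

lemma phi_closed: "a \<in> carrier A \<Longrightarrow> \<phi> a \<in> carrier B"
  using hom by (rule ring_hom_closed)

lemma contract_prime: "primeideal P B \<Longrightarrow> primeideal (contract P) A"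
  using ring_hom_ring.primeideal_vimage[OF ring_hom_ringI2[OF A.ring_axioms B.ring_axioms hom] A.cring_axioms]
  by blast

lemma pt_spec_map: "pt (spec_map A B \<phi>) P = contract P"
  by (simp add: spec_map_def)

text \<open>The preimage of the basic open set of \<open>a\<close> is the basic open set of
  \<open>\<phi> a\<close>, and generators suffice.\<close>

lemma continuous_spec_map: "continuous_map (zariski B) (zariski A) (pt (spec_map A B \<phi>))"
  unfolding zariski_def[of A]
proof (rule continuous_on_generated_topo)
  fix U assume "U \<in> {{P. primeideal P A \<and> a \<notin> P} |a. a \<in> carrier A}"
  then obtain a where a: "a \<in> carrier A" "U = {P. primeideal P A \<and> a \<notin> P}" by blast
  have "pt (spec_map A B \<phi>) -` U \<inter> topspace (zariski B) = basic_open B (\<phi> a)"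
    using a contract_prime by (auto simp: B.topspace_zariski basic_open_def pt_spec_map)
  then show "openin (zariski B) (pt (spec_map A B \<phi>) -` U \<inter> topspace (zariski B))"
    using B.openin_basic_open phi_closed a(1) by simp
next
  have "pt (spec_map A B \<phi>) ` topspace (zariski B) \<subseteq> topspace (zariski A)"
    using contract_prime by (auto simp: A.topspace_zariski B.topspace_zariski pt_spec_map)
  then show "pt (spec_map A B \<phi>) ` topspace (zariski B) \<subseteq> \<Union>{{P. primeideal P A \<and> a \<notin> P} |a. a \<in> carrier A}"
    unfolding zariski_def[of A] topology_generated_by_topspace .
qed

lemma preim_spec_map_open:
  "openin (zariski A) V \<Longrightarrow> openin (zariski B) (preim (spec B) (spec_map A B \<phi>) V)"
  using continuous_spec_map by (simp add: continuous_map_def preim_def)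

text \<open>The union in \<open>spec_map\<close> runs over all fractions equal to
  \<open>a/s\<close>; a relation with multiplier \<open>u\<close> maps to one with multiplier
  \<open>\<phi> u\<close>, so all terms coincide. Later facts on \<open>spec_map\<close> are
  computed from one representative in this way.\<close>

lemma co_spec_map_at:
  assumes V: "openin (zariski A) V" and P: "P \<in> preim (spec B) (spec_map A B \<phi>) V"
    and as: "a \<in> carrier A" "s \<in> carrier A" "\<phi> s \<notin> P"
    and \<sigma>: "\<sigma> (contract P) = fraction_at A (contract P) a s"
  shows "co (spec_map A B \<phi>) V \<sigma> P = fraction_at B P (\<phi> a) (\<phi> s)"
proof -
  have prime: "primeideal P B" and cV: "contract P \<in> V" and Pp: "P \<in> topspace (zariski B)"
    using P by (auto simp: mem_preim B.topspace_zariski pt_spec_map)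
  interpret MA: mult_set A "carrier A - contract P"
    by (rule mult_set_prime[OF contract_prime[OF prime]])
  interpret MB: mult_set B "carrier B - P" by (rule mult_set_prime[OF prime])
  have sA: "s \<in> carrier A - contract P" using as by auto
  have "fraction_at B P (\<phi> b) (\<phi> t) = fraction_at B P (\<phi> a) (\<phi> s)"
    if h: "(b, t) \<in> fraction_at A (contract P) a s" for b t
  proof -
    obtain u where u: "b \<in> carrier A" "t \<in> carrier A - contract P" "u \<in> carrier A - contract P"
      "u \<otimes>\<^bsub>A\<^esub> (t \<otimes>\<^bsub>A\<^esub> a) = u \<otimes>\<^bsub>A\<^esub> (s \<otimes>\<^bsub>A\<^esub> b)"
      using h unfolding MA.mem_fraction_iff[OF as(1) sA] by blast
    then have "\<phi> (u \<otimes>\<^bsub>A\<^esub> (t \<otimes>\<^bsub>A\<^esub> a)) = \<phi> (u \<otimes>\<^bsub>A\<^esub> (s \<otimes>\<^bsub>A\<^esub> b))" by simp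
    then have "\<phi> u \<otimes>\<^bsub>B\<^esub> (\<phi> t \<otimes>\<^bsub>B\<^esub> \<phi> a) = \<phi> u \<otimes>\<^bsub>B\<^esub> (\<phi> s \<otimes>\<^bsub>B\<^esub> \<phi> b)"
      using u(1-3) as by (simp add: ring_hom_mult[OF hom])
    then show ?thesis
      using u(1-3) as by (intro MB.fraction_eqI[of _ _ _ _ "\<phi> u", symmetric]) (auto simp: phi_closed)
  qed
  then have "(\<Union>(b, t)\<in>fraction_at A (contract P) a s. fraction_at B P (\<phi> b) (\<phi> t))
    = fraction_at B P (\<phi> a) (\<phi> s)"
    by (rule MA.UN_fraction[OF as(1) sA])
  then show ?thesis using cV Pp \<sigma> by (simp add: spec_map_def)
qed

lemma co_spec_map_closed:
  assumes V: "openin (zariski A) V" and \<sigma>: "\<sigma> \<in> carrier (spec_sec A V)"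
  shows "co (spec_map A B \<phi>) V \<sigma> \<in> carrier (spec_sec B (preim (spec B) (spec_map A B \<phi>) V))"
proof (rule B.spec_secI)
  let ?f = "spec_map A B \<phi>"
  show "openin (zariski B) (preim (spec B) ?f V)" using V by (rule preim_spec_map_open)
  show "co ?f V \<sigma> \<in> extensional (preim (spec B) ?f V)" by (simp add: spec_map_def preim_def)
  fix P assume P: "P \<in> preim (spec B) ?f V"
  then have "contract P \<in> V" by (simp add: mem_preim pt_spec_map)
  with \<sigma> show "\<exists>W a s. openin (zariski B) W \<and> P \<in> W \<and> W \<subseteq> preim (spec B) ?f V \<and> a \<in> carrier B \<and>
      s \<in> carrier B \<and> (\<forall>Q\<in>W. s \<notin> Q \<and> co ?f V \<sigma> Q = fraction_at B Q a s)"
  proof (rule A.spec_sec_local)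
    fix W a s
    assume W: "openin (zariski A) W" "contract P \<in> W" "W \<subseteq> V" "a \<in> carrier A" "s \<in> carrier A"
      "\<forall>Q\<in>W. s \<notin> Q \<and> \<sigma> Q = fraction_at A Q a s"
    have "\<phi> s \<notin> Q \<and> co ?f V \<sigma> Q = fraction_at B Q (\<phi> a) (\<phi> s)" if Q: "Q \<in> preim (spec B) ?f W" for Q
    proof -
      have cQ: "contract Q \<in> W" using Q by (simp add: mem_preim pt_spec_map)
      have "\<phi> s \<notin> Q" using bspec[OF W(6) cQ] W(5) by simp
      moreover have "Q \<in> preim (spec B) ?f V" using Q preim_mono[OF W(3), of "spec B" ?f] by blast
      ultimately show ?thesis using co_spec_map_at[where \<sigma>=\<sigma>, OF V _ W(4,5)] bspec[OF W(6) cQ] by blast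
    qed
    moreover have "P \<in> preim (spec B) ?f W" using P W(2) by (simp add: mem_preim pt_spec_map)
    ultimately show ?thesis
      using preim_spec_map_open[OF W(1)] preim_mono[OF W(3), of "spec B" ?f] phi_closed W(4,5)
      by (intro exI[of _ "preim (spec B) ?f W"] exI[of _ "\<phi> a"] exI[of _ "\<phi> s"]) simp
  qed
qed

lemma spec_map_fraction_rep:
  assumes V: "openin (zariski A) V" and \<sigma>: "\<sigma> \<in> carrier (spec_sec A V)"
    and P: "P \<in> preim (spec B) (spec_map A B \<phi>) V"
  obtains a s where "a \<in> carrier A" "s \<in> carrier A" "\<phi> s \<notin> P" "s \<notin> contract P"
    "\<sigma> (contract P) = fraction_at A (contract P) a s"
    "co (spec_map A B \<phi>) V \<sigma> P = fraction_at B P (\<phi> a) (\<phi> s)"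
proof -
  have cV: "contract P \<in> V" using P by (simp add: mem_preim pt_spec_map)
  obtain a s where as: "a \<in> carrier A" "s \<in> carrier A" "s \<notin> contract P"
    "\<sigma> (contract P) = fraction_at A (contract P) a s"
    by (rule A.spec_sec_fraction_at[OF V \<sigma> cV])
  then have s: "\<phi> s \<notin> P" by simp
  show thesis using that[OF as(1,2) s as(3,4) co_spec_map_at[where \<sigma>=\<sigma>, OF V P as(1,2) s as(4)]] .
qed

lemma co_spec_const:
  assumes V: "openin (zariski A) V" and a: "a \<in> carrier A"
  shows "co (spec_map A B \<phi>) V (spec_const A V a) = spec_const B (preim (spec B) (spec_map A B \<phi>) V) (\<phi> a)"
proof (rule B.spec_sec_eqI)
  let ?f = "spec_map A B \<phi>"
  show "co ?f V (spec_const A V a) \<in> carrier (spec_sec B (preim (spec B) ?f V))"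
    using co_spec_map_closed[OF V A.spec_const_closed[OF V a]] .
  show "spec_const B (preim (spec B) ?f V) (\<phi> a) \<in> carrier (spec_sec B (preim (spec B) ?f V))"
    using preim_spec_map_open[OF V] phi_closed[OF a] by (rule B.spec_const_closed)
  fix P assume P: "P \<in> preim (spec B) ?f V"
  have "primeideal P B" "contract P \<in> V" using P by (auto simp: mem_preim B.topspace_zariski pt_spec_map)
  then show "co ?f V (spec_const A V a) P = spec_const B (preim (spec B) ?f V) (\<phi> a) P"
    using co_spec_map_at[where \<sigma>="spec_const A V a", OF V P a A.one_closed] P B.one_notin_prime
    by (simp add: spec_const_def ring_hom_one[OF hom])
qed

lemma premorphism_spec_map: "premorphism (spec B) (spec A) (spec_map A B \<phi>)"
  unfolding premorphism_def spec_simps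
proof (intro conjI allI impI ballI)
  let ?f = "spec_map A B \<phi>"
  show "continuous_map (zariski B) (zariski A) (pt ?f)" by (rule continuous_spec_map)
  fix V assume V: "openin (zariski A) V"
  let ?W = "preim (spec B) ?f V"
  show "co ?f V \<in> ring_hom (spec_sec A V) (spec_sec B ?W)"
  proof (rule ring_hom_memI)
    fix \<sigma> \<tau> assume \<sigma>: "\<sigma> \<in> carrier (spec_sec A V)" and \<tau>: "\<tau> \<in> carrier (spec_sec A V)"
    have W: "openin (zariski B) ?W" using V by (rule preim_spec_map_open)
    note c = co_spec_map_closed[OF V]
    show "co ?f V (\<sigma> \<otimes>\<^bsub>spec_sec A V\<^esub> \<tau>) = co ?f V \<sigma> \<otimes>\<^bsub>spec_sec B ?W\<^esub> co ?f V \<tau>"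
    proof (rule B.spec_sec_eqI[OF c[OF A.spec_sec_mult_closed[OF V \<sigma> \<tau>]] B.spec_sec_mult_closed[OF W c[OF \<sigma>] c[OF \<tau>]]])
      fix P assume P: "P \<in> ?W"
      have prime: "primeideal P B" and cV: "contract P \<in> V"
        using P by (auto simp: mem_preim B.topspace_zariski pt_spec_map)
      obtain a s where a: "a \<in> carrier A" "s \<in> carrier A" "\<phi> s \<notin> P" "s \<notin> contract P"
        "\<sigma> (contract P) = fraction_at A (contract P) a s" "co ?f V \<sigma> P = fraction_at B P (\<phi> a) (\<phi> s)"
        by (rule spec_map_fraction_rep[OF V \<sigma> P])
      obtain b t where b: "b \<in> carrier A" "t \<in> carrier A" "\<phi> t \<notin> P" "t \<notin> contract P"
        "\<tau> (contract P) = fraction_at A (contract P) b t" "co ?f V \<tau> P = fraction_at B P (\<phi> b) (\<phi> t)"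
        by (rule spec_map_fraction_rep[OF V \<tau> P])
      have st: "\<phi> (s \<otimes>\<^bsub>A\<^esub> t) \<notin> P"
        using B.mult_notin_prime[OF prime] a b phi_closed by (simp add: ring_hom_mult[OF hom])
      have "(\<sigma> \<otimes>\<^bsub>spec_sec A V\<^esub> \<tau>) (contract P)
        = fraction_at A (contract P) (a \<otimes>\<^bsub>A\<^esub> b) (s \<otimes>\<^bsub>A\<^esub> t)"
        unfolding spec_sec_ops_at[OF cV] a(5) b(5)
        by (rule A.fraction_mult_at[OF contract_prime[OF prime] a(1,2,4) b(1,2,4)])
      then have "co ?f V (\<sigma> \<otimes>\<^bsub>spec_sec A V\<^esub> \<tau>) P
        = fraction_at B P (\<phi> (a \<otimes>\<^bsub>A\<^esub> b)) (\<phi> (s \<otimes>\<^bsub>A\<^esub> t))"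
        using a b st by (intro co_spec_map_at[OF V P]) simp_all
      also have "\<dots> = fraction_at B P (\<phi> a) (\<phi> s) \<otimes>\<^bsub>localize_at B P\<^esub> fraction_at B P (\<phi> b) (\<phi> t)"
        using a b phi_closed by (simp add: B.fraction_mult_at[OF prime] ring_hom_mult[OF hom])
      finally show "co ?f V (\<sigma> \<otimes>\<^bsub>spec_sec A V\<^esub> \<tau>) P = (co ?f V \<sigma> \<otimes>\<^bsub>spec_sec B ?W\<^esub> co ?f V \<tau>) P"
        unfolding spec_sec_ops_at[OF P] a(6) b(6) .
    qed
    show "co ?f V (\<sigma> \<oplus>\<^bsub>spec_sec A V\<^esub> \<tau>) = co ?f V \<sigma> \<oplus>\<^bsub>spec_sec B ?W\<^esub> co ?f V \<tau>"
    proof (rule B.spec_sec_eqI[OF c[OF A.spec_sec_add_closed[OF V \<sigma> \<tau>]] B.spec_sec_add_closed[OF W c[OF \<sigma>] c[OF \<tau>]]])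
      fix P assume P: "P \<in> ?W"
      have prime: "primeideal P B" and cV: "contract P \<in> V"
        using P by (auto simp: mem_preim B.topspace_zariski pt_spec_map)
      obtain a s where a: "a \<in> carrier A" "s \<in> carrier A" "\<phi> s \<notin> P" "s \<notin> contract P"
        "\<sigma> (contract P) = fraction_at A (contract P) a s" "co ?f V \<sigma> P = fraction_at B P (\<phi> a) (\<phi> s)"
        by (rule spec_map_fraction_rep[OF V \<sigma> P])
      obtain b t where b: "b \<in> carrier A" "t \<in> carrier A" "\<phi> t \<notin> P" "t \<notin> contract P"
        "\<tau> (contract P) = fraction_at A (contract P) b t" "co ?f V \<tau> P = fraction_at B P (\<phi> b) (\<phi> t)"
        by (rule spec_map_fraction_rep[OF V \<tau> P])
      have st: "\<phi> (s \<otimes>\<^bsub>A\<^esub> t) \<notin> P"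
        using B.mult_notin_prime[OF prime] a b phi_closed by (simp add: ring_hom_mult[OF hom])
      have "(\<sigma> \<oplus>\<^bsub>spec_sec A V\<^esub> \<tau>) (contract P)
        = fraction_at A (contract P) (t \<otimes>\<^bsub>A\<^esub> a \<oplus>\<^bsub>A\<^esub> s \<otimes>\<^bsub>A\<^esub> b) (s \<otimes>\<^bsub>A\<^esub> t)"
        unfolding spec_sec_ops_at[OF cV] a(5) b(5)
        by (rule A.fraction_add_at[OF contract_prime[OF prime] a(1,2,4) b(1,2,4)])
      then have "co ?f V (\<sigma> \<oplus>\<^bsub>spec_sec A V\<^esub> \<tau>) P
        = fraction_at B P (\<phi> (t \<otimes>\<^bsub>A\<^esub> a \<oplus>\<^bsub>A\<^esub> s \<otimes>\<^bsub>A\<^esub> b)) (\<phi> (s \<otimes>\<^bsub>A\<^esub> t))"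
        using a b st by (intro co_spec_map_at[OF V P]) simp_all
      also have "\<dots> = fraction_at B P (\<phi> a) (\<phi> s) \<oplus>\<^bsub>localize_at B P\<^esub> fraction_at B P (\<phi> b) (\<phi> t)"
        using a b phi_closed
        by (simp add: B.fraction_add_at[OF prime] ring_hom_mult[OF hom] ring_hom_add[OF hom])
      finally show "co ?f V (\<sigma> \<oplus>\<^bsub>spec_sec A V\<^esub> \<tau>) P = (co ?f V \<sigma> \<oplus>\<^bsub>spec_sec B ?W\<^esub> co ?f V \<tau>) P"
        unfolding spec_sec_ops_at[OF P] a(6) b(6) .
    qed
  next
    show "co ?f V \<one>\<^bsub>spec_sec A V\<^esub> = \<one>\<^bsub>spec_sec B ?W\<^esub>"
      by (simp add: A.spec_const_one B.spec_const_one co_spec_const[OF V] ring_hom_one[OF hom])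
  qed (rule co_spec_map_closed[OF V])
next
  fix V W \<sigma>
  assume "openin (zariski A) V \<and> openin (zariski A) W \<and> W \<subseteq> V"
  then show "co (spec_map A B \<phi>) W (restrict \<sigma> W)
    = restrict (co (spec_map A B \<phi>) V \<sigma>) (preim (spec B) (spec_map A B \<phi>) W)"
    by (auto simp: spec_map_def preim_def fun_eq_iff)
qed

text \<open>A numerator \<open>a\<close> with \<open>\<phi> a \<notin> P\<close> is outside the
  contracted prime by the very definition of the latter, and on spectra invertibility is decided by
  numerators.\<close>

lemma reflects_spec_map: "reflects (spec B) (spec A) (spec_map A B \<phi>)"
  unfolding reflects_def spec_simps
proof (intro allI impI, elim conjE)
  fix V \<sigma> P
  let ?f = "spec_map A B \<phi>"
  assume V: "openin (zariski A) V" and \<sigma>: "\<sigma> \<in> carrier (spec_sec A V)" and P: "P \<in> preim (spec B) ?f V"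
    and inv: "inv_at (spec B) P (preim (spec B) ?f V) (co ?f V \<sigma>)"
  obtain a s where a: "a \<in> carrier A" "s \<in> carrier A" "\<phi> s \<notin> P" "s \<notin> contract P"
    "\<sigma> (contract P) = fraction_at A (contract P) a s" "co ?f V \<sigma> P = fraction_at B P (\<phi> a) (\<phi> s)"
    by (rule spec_map_fraction_rep[OF V \<sigma> P])
  have "\<phi> a \<notin> P"
    using inv B.inv_at_spec_iff[OF preim_spec_map_open[OF V] co_spec_map_closed[OF V \<sigma>] P _ _ a(3) a(6)]
      phi_closed a by blast
  then have "a \<notin> contract P" by simp
  moreover have cV: "contract P \<in> V" using P by (simp add: mem_preim pt_spec_map)
  ultimately have "inv_at (spec A) (contract P) V \<sigma>"
    using A.inv_at_spec_iff[OF V \<sigma> cV a(1,2,4,5)] by blast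
  then show "inv_at (spec A) (pt ?f P) V \<sigma>" by (simp add: pt_spec_map)
qed

end

section \<open>Open subspaces and sections that are locally fractions\<close>

lemma open_sub_simps [simp]:
  "space_of (open_sub X U) = subtopology (space_of X) U" "sec (open_sub X U) = sec X"
  "res (open_sub X U) = res X"
  by (simp_all add: open_sub_def)

text \<open>The affine property behind uniqueness: near every point each section is
  \<open>a/s\<close> with \<open>a\<close> and \<open>s\<close> from \<open>C\<close>. It is written
  as an equation in which the unit \<open>s\<close> multiplies the section, so that it transports
  along isomorphisms and \<open>s\<close> can be cancelled after any pullback.\<close>

definition locally_fractions :: "('a, 'b, 'm) ringed_space_scheme \<Rightarrow> 'a set \<Rightarrow> 'b set \<Rightarrow> bool" where
  "locally_fractions X U C \<longleftrightarrow> opn X U \<and> C \<subseteq> carrier (sec X U) \<and>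
     (\<forall>V \<tau> p. opn X V \<and> V \<subseteq> U \<and> \<tau> \<in> carrier (sec X V) \<and> p \<in> V \<longrightarrow>
        (\<exists>s\<in>C. \<exists>a\<in>C. \<exists>W. opn X W \<and> p \<in> W \<and> W \<subseteq> V \<and> res X U W s \<in> Units (sec X W) \<and>
           res X U W s \<otimes>\<^bsub>sec X W\<^esub> res X V W \<tau> = res X U W a))"

lemma locally_fractionsE:
  assumes "locally_fractions X U C" "opn X V" "V \<subseteq> U" "\<tau> \<in> carrier (sec X V)" "p \<in> V"
  obtains s a W where "s \<in> C" "a \<in> C" "s \<in> carrier (sec X U)" "a \<in> carrier (sec X U)"
    "opn X W" "p \<in> W" "W \<subseteq> V" "res X U W s \<in> Units (sec X W)"
    "res X U W s \<otimes>\<^bsub>sec X W\<^esub> res X V W \<tau> = res X U W a"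
proof -
  have *: "\<forall>V \<tau> p. opn X V \<and> V \<subseteq> U \<and> \<tau> \<in> carrier (sec X V) \<and> p \<in> V \<longrightarrow>
      (\<exists>s\<in>C. \<exists>a\<in>C. \<exists>W. opn X W \<and> p \<in> W \<and> W \<subseteq> V \<and> res X U W s \<in> Units (sec X W) \<and>
         res X U W s \<otimes>\<^bsub>sec X W\<^esub> res X V W \<tau> = res X U W a)"
    and C: "C \<subseteq> carrier (sec X U)"
    using assms(1) by (simp_all add: locally_fractions_def)
  obtain s a W where "s \<in> C" "a \<in> C" "opn X W" "p \<in> W" "W \<subseteq> V" "res X U W s \<in> Units (sec X W)"
    "res X U W s \<otimes>\<^bsub>sec X W\<^esub> res X V W \<tau> = res X U W a"
    using *[rule_format, of V \<tau> p] assms(2-5) by metis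
  then show thesis using that subsetD[OF C] by simp
qed

text \<open>Where a section is given by \<open>a/s\<close>, the constant \<open>s\<close> is
  inverted by the section \<open>1/s\<close>; so locally all sections are fractions of
  constants.\<close>

lemma (in cring) locally_fractions_spec:
  "locally_fractions (spec R) (pts (spec R)) {spec_const R (pts (spec R)) a |a. a \<in> carrier R}"
  unfolding locally_fractions_def spec_simps
proof (intro conjI allI impI)
  let ?T = "topspace (zariski R)"
  show "openin (zariski R) ?T" by simp
  then show "{spec_const R ?T a |a. a \<in> carrier R} \<subseteq> carrier (spec_sec R ?T)"
    using spec_const_closed by blast
  fix V \<sigma> P
  assume "openin (zariski R) V \<and> V \<subseteq> ?T \<and> \<sigma> \<in> carrier (spec_sec R V) \<and> P \<in> V"
  then have V: "openin (zariski R) V" and \<sigma>: "\<sigma> \<in> carrier (spec_sec R V)" and P: "P \<in> V" by auto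
  have "\<exists>s\<in>carrier R. \<exists>a\<in>carrier R. \<exists>W. openin (zariski R) W \<and> P \<in> W \<and> W \<subseteq> V \<and>
      spec_const R W s \<in> Units (spec_sec R W) \<and>
      spec_const R W s \<otimes>\<^bsub>spec_sec R W\<^esub> restrict \<sigma> W = spec_const R W a"
  proof (rule spec_sec_local[OF \<sigma> P])
    fix W a s
    assume W: "openin (zariski R) W" "P \<in> W" "W \<subseteq> V" "a \<in> carrier R" "s \<in> carrier R"
      "\<forall>Q\<in>W. s \<notin> Q \<and> \<sigma> Q = fraction_at R Q a s"
    interpret S: cring "spec_sec R W" by (rule cring_spec_sec[OF W(1)])
    let ?i = "\<lambda>Q\<in>W. fraction_at R Q \<one> s"
    have i: "?i \<in> carrier (spec_sec R W)"
      using W by (intro fraction_section_closed) auto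
    have c: "spec_const R W s \<in> carrier (spec_sec R W)" "spec_const R W a \<in> carrier (spec_sec R W)"
      using spec_const_closed[OF W(1)] W(4,5) by auto
    have r: "restrict \<sigma> W \<in> carrier (spec_sec R W)" by (rule restrict_spec_sec[OF V W(1,3) \<sigma>])
    have "spec_const R W s \<otimes>\<^bsub>spec_sec R W\<^esub> ?i = \<one>\<^bsub>spec_sec R W\<^esub>"
    proof (rule spec_sec_eqI[OF S.m_closed[OF c(1) i] S.one_closed])
      fix Q assume Q: "Q \<in> W"
      have q: "primeideal Q R" by (rule zariski_prime[OF W(1) Q])
      have sQ: "s \<notin> Q" using W(6) Q by blast
      have "fraction_at R Q (s \<otimes> \<one>) (\<one> \<otimes> s) = fraction_at R Q \<one> \<one>"
        using W(5) sQ one_notin_prime[OF q] by (intro fraction_eqI_at[OF q]) simp_all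
      then show "(spec_const R W s \<otimes>\<^bsub>spec_sec R W\<^esub> ?i) Q = \<one>\<^bsub>spec_sec R W\<^esub> Q"
        unfolding spec_const_one spec_sec_ops_at[OF Q] using Q W(5) sQ one_notin_prime[OF q]
        by (simp add: spec_const_def fraction_mult_at[OF q])
    qed
    then have u: "spec_const R W s \<in> Units (spec_sec R W)" using c(1) i by (intro S.UnitsI)
    have "spec_const R W s \<otimes>\<^bsub>spec_sec R W\<^esub> restrict \<sigma> W = spec_const R W a"
    proof (rule spec_sec_eqI[OF S.m_closed[OF c(1) r] c(2)])
      fix Q assume Q: "Q \<in> W"
      have q: "primeideal Q R" by (rule zariski_prime[OF W(1) Q])
      have sQ: "s \<notin> Q" "\<sigma> Q = fraction_at R Q a s" using W(6) Q by blast+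
      have "fraction_at R Q (s \<otimes> a) (\<one> \<otimes> s) = fraction_at R Q a \<one>"
        using W(4,5) sQ one_notin_prime[OF q] by (intro fraction_eqI_at[OF q]) simp_all
      then show "(spec_const R W s \<otimes>\<^bsub>spec_sec R W\<^esub> restrict \<sigma> W) Q = spec_const R W a Q"
        unfolding spec_sec_ops_at[OF Q] using Q W(4,5) sQ one_notin_prime[OF q]
        by (simp add: spec_const_def fraction_mult_at[OF q])
    qed
    then show ?thesis using W(1-5) u by blast
  qed
  then obtain s a W where h: "s \<in> carrier R" "a \<in> carrier R" "openin (zariski R) W" "P \<in> W" "W \<subseteq> V"
    "spec_const R W s \<in> Units (spec_sec R W)"
    "spec_const R W s \<otimes>\<^bsub>spec_sec R W\<^esub> restrict \<sigma> W = spec_const R W a"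
    by (elim bexE exE conjE)
  have r: "restrict (spec_const R ?T a) W = spec_const R W a" if "openin (zariski R) W" for W a
    using openin_subset[OF that] by (auto simp: spec_const_def fun_eq_iff)
  show "\<exists>s\<in>{spec_const R ?T a |a. a \<in> carrier R}. \<exists>a\<in>{spec_const R ?T a |a. a \<in> carrier R}.
      \<exists>W. openin (zariski R) W \<and> P \<in> W \<and> W \<subseteq> V \<and> restrict s W \<in> Units (spec_sec R W) \<and>
        restrict s W \<otimes>\<^bsub>spec_sec R W\<^esub> restrict \<sigma> W = restrict a W"
    using h r[OF h(3)]
    by (intro bexI[of _ "spec_const R ?T s"] bexI[of _ "spec_const R ?T a"] exI[of _ W]) auto
qed

text \<open>Sections over a spectrum are compared at each prime. Near the image of \<open>P\<close>
  a section \<open>\<tau>\<close> satisfies \<open>s \<tau> = a\<close> with \<open>s\<close> and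
  \<open>a\<close> from \<open>C\<close>; both pullbacks agree on \<open>s\<close> and
  \<open>a\<close>, and the pullback of \<open>s\<close> is a unit, so it cancels.\<close>

lemma premorphisms_from_spec_eqI:
  assumes R: "cring R" and X: "presheaf X" and fr: "locally_fractions X U C"
    and f: "premorphism (spec R) X f" and g: "premorphism (spec R) X g"
    and pt: "\<And>P. P \<in> pts (spec R) \<Longrightarrow> pt f P = pt g P \<and> pt f P \<in> U"
    and co: "\<And>c. c \<in> C \<Longrightarrow> co f U c = co g U c"
  shows "eq_map (spec R) X f g"
proof -
  interpret R: cring R by (rule R)
  interpret X: presheaf X by (rule X)
  have U: "opn X U" using fr by (simp add: locally_fractions_def)
  have pre: "preim (spec R) g V = preim (spec R) f V" for V using pt by (auto simp: preim_def)
  have "co f V \<tau> = co g V \<tau>" if V: "opn X V" and \<tau>: "\<tau> \<in> carrier (sec X V)" for V \<tau>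
  proof (rule R.spec_sec_eqI)
    show "co f V \<tau> \<in> carrier (spec_sec R (preim (spec R) f V))" using co_closed[OF f V \<tau>] by simp
    show "co g V \<tau> \<in> carrier (spec_sec R (preim (spec R) f V))"
      using co_closed[OF g V \<tau>] by (simp add: pre)
    fix P assume P: "P \<in> preim (spec R) f V"
    have o: "opn X (V \<inter> U)" using V U by blast
    have "pt f P \<in> V \<inter> U" using P pt[of P] by (auto simp: mem_preim)
    then obtain s a W where h: "s \<in> C" "a \<in> C" "s \<in> carrier (sec X U)" "a \<in> carrier (sec X U)"
      "opn X W" "pt f P \<in> W" "W \<subseteq> V \<inter> U" "res X U W s \<in> Units (sec X W)"
      "res X U W s \<otimes>\<^bsub>sec X W\<^esub> res X (V \<inter> U) W (res X V (V \<inter> U) \<tau>) = res X U W a"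
      by (rule locally_fractionsE[OF fr o Int_lower2 X.res_closed[OF V o Int_lower1 \<tau>]])
    let ?W = "preim (spec R) f W"
    have W: "W \<subseteq> V" "W \<subseteq> U" using h(7) by auto
    have \<tau>W: "res X V W \<tau> \<in> carrier (sec X W)" "res X U W s \<in> carrier (sec X W)"
      using X.res_closed V U h W \<tau> by auto
    have eq: "res X U W s \<otimes>\<^bsub>sec X W\<^esub> res X V W \<tau> = res X U W a"
      using h(9) X.res_res[OF V o h(5) h(7) Int_lower1 \<tau>] by simp
    have opW: "opn (spec R) ?W" by (rule preim_open[OF f h(5)])
    interpret S: cring "spec_sec R ?W" using opW by (intro R.cring_spec_sec) simp
    have Cc: "co f W (res X U W c) = co g W (res X U W c)" if "c \<in> C" "c \<in> carrier (sec X U)" for c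
      unfolding co_res[OF f U h(5) W(2) that(2)] co_res[OF g U h(5) W(2) that(2)] co[OF that(1)] pre ..
    have u: "co f W (res X U W s) \<in> Units (spec_sec R ?W)"
      using ring_hom_Units[OF co_hom[OF f h(5)] h(8)] by simp
    have fc: "co f W (res X V W \<tau>) \<in> carrier (spec_sec R ?W)" using co_closed[OF f h(5) \<tau>W(1)] by simp
    have gc: "co g W (res X V W \<tau>) \<in> carrier (spec_sec R ?W)"
      using co_closed[OF g h(5) \<tau>W(1)] by (simp add: pre)
    have "co f W (res X U W s) \<otimes>\<^bsub>spec_sec R ?W\<^esub> co f W (res X V W \<tau>) = co f W (res X U W a)"
      using ring_hom_mult[OF co_hom[OF f h(5)] \<tau>W(2,1)] eq by simp
    also have "\<dots> = co g W (res X U W a)" using Cc h by blast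
    also have "\<dots> = co g W (res X U W s) \<otimes>\<^bsub>spec_sec R ?W\<^esub> co g W (res X V W \<tau>)"
      using ring_hom_mult[OF co_hom[OF g h(5)] \<tau>W(2,1)] eq by (simp add: pre)
    also have "co g W (res X U W s) = co f W (res X U W s)" using Cc h by simp
    finally have "co f W (res X V W \<tau>) = co g W (res X V W \<tau>)"
      using S.Units_l_cancel[OF u fc gc] by simp
    then have "restrict (co f V \<tau>) ?W = restrict (co g V \<tau>) ?W"
      unfolding co_res[OF f V h(5) W(1) \<tau>] co_res[OF g V h(5) W(1) \<tau>] by (simp add: pre)
    moreover have "P \<in> ?W" using P h(6) by (simp add: mem_preim)
    ultimately show "co f V \<tau> P = co g V \<tau> P" by (metis restrict_apply')
  qed
  then show ?thesis using pt by (simp add: eq_map_def)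
qed

section \<open>Inclusion of an open subspace\<close>

lemma inv_at_open_sub:
  assumes "opn X U" "V \<subseteq> U"
  shows "inv_at (open_sub X U) p V s \<longleftrightarrow> inv_at X p V s"
  using assms unfolding inv_at_def by (auto simp: openin_open_subtopology)

lemma preim_incl_map: "opn X V \<Longrightarrow> preim (open_sub X U) (incl_map X U) V = U \<inter> V"
  using openin_subset[of "space_of X" V] by (auto simp: preim_def incl_map_def)

lemma premorphism_incl_map:
  assumes X: "presheaf X" and U: "opn X U"
  shows "premorphism (open_sub X U) X (incl_map X U)"
  unfolding premorphism_def
proof (intro conjI allI impI ballI)
  interpret presheaf X by (rule X)
  have "pt (incl_map X U) = id" by (auto simp: incl_map_def)
  then show "continuous_map (space_of (open_sub X U)) (space_of X) (pt (incl_map X U))"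
    by (simp add: continuous_map_from_subtopology)
  fix V assume V: "opn X V"
  have o: "opn X (U \<inter> V)" using U V by blast
  then show "co (incl_map X U) V \<in> ring_hom (sec X V) (sec (open_sub X U) (preim (open_sub X U) (incl_map X U) V))"
    using res_hom[OF V o Int_lower2] by (simp add: preim_incl_map[OF V]) (simp add: incl_map_def)
next
  interpret presheaf X by (rule X)
  fix V W s assume h: "opn X V \<and> opn X W \<and> W \<subseteq> V" "s \<in> carrier (sec X V)"
  then have o: "opn X (U \<inter> V)" "opn X (U \<inter> W)" using U by blast+
  have "res X W (U \<inter> W) (res X V W s) = res X (U \<inter> V) (U \<inter> W) (res X V (U \<inter> V) s)"
    using res_res[of V W "U \<inter> W" s] res_res[of V "U \<inter> V" "U \<inter> W" s] h o
    by (simp add: le_infI2 Int_mono)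
  then show "co (incl_map X U) W (res X V W s) = res (open_sub X U) (preim (open_sub X U) (incl_map X U) V)
      (preim (open_sub X U) (incl_map X U) W) (co (incl_map X U) V s)"
    using h by (simp add: preim_incl_map) (simp add: incl_map_def)
qed

lemma reflects_incl_map:
  assumes X: "presheaf X" and U: "opn X U"
  shows "reflects (open_sub X U) X (incl_map X U)"
  unfolding reflects_def
proof (intro allI impI, elim conjE)
  interpret presheaf X by (rule X)
  fix V t p
  assume V: "opn X V" and t: "t \<in> carrier (sec X V)"
    and p: "p \<in> preim (open_sub X U) (incl_map X U) V"
    and inv: "inv_at (open_sub X U) p (preim (open_sub X U) (incl_map X U) V) (co (incl_map X U) V t)"
  have o: "opn X (U \<inter> V)" using U V by blast
  have "inv_at X p (U \<inter> V) (res X V (U \<inter> V) t)"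
    using inv unfolding preim_incl_map[OF V] inv_at_open_sub[OF U Int_lower1] by (simp add: incl_map_def)
  moreover have "p \<in> U \<inter> V" using p by (simp add: preim_incl_map[OF V])
  ultimately show "inv_at X (pt (incl_map X U) p) V t"
    using inv_at_res_iff[OF V o _ Int_lower2 t] by (simp add: incl_map_def)
qed

section \<open>The dual of the polynomial ring\<close>

locale dual_poly = field K for K :: "'k ring" (structure)

sublocale dual_poly \<subseteq> UP: UP_cring K "UP K"
  by unfold_locales auto

context dual_poly
begin

abbreviation B where "B \<equiv> poly_dual K"

abbreviation \<delta> where "\<delta> \<equiv> dual_der K"

text \<open>
  The multiplication of \<open>K[x]\<^sup>*\<close> on the sequences of values at the monomials: the product of
  exponential generating functions.
\<close>

definition conv :: "(nat \<Rightarrow> 'k) \<Rightarrow> (nat \<Rightarrow> 'k) \<Rightarrow> nat \<Rightarrow> 'k" where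
  "conv u v n = (\<Oplus>i\<in>{..n}. add_pow K (n choose i) (u i \<otimes> v (n - i)))"

lemma conv_0: "\<lbrakk>u 0 \<in> carrier K; v 0 \<in> carrier K\<rbrakk> \<Longrightarrow> conv u v 0 = u 0 \<otimes> v 0"
  by (simp add: conv_def)

lemma conv_Suc_split:
  assumes u: "\<And>n. u n \<in> carrier K" and v: "\<And>n. v n \<in> carrier K"
  shows "conv u v (Suc n) =
    (\<Oplus>j\<in>{..n}. add_pow K (Suc n choose Suc j) (u (Suc j) \<otimes> v (n - j))) \<oplus> u 0 \<otimes> v (Suc n)"
  unfolding conv_def using u v by (subst finsum_Suc2) (auto simp: Pi_def)

text \<open>Pascal's rule. On exponential generating functions the shift of a sequence is
  differentiation, so this is the Leibniz rule. It drives the inductions below and later the product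
  rules for \<open>\<delta>\<close> and for the iterates of \<open>D\<close>.\<close>

lemma conv_Suc:
  assumes u: "\<And>n. u n \<in> carrier K" and v: "\<And>n. v n \<in> carrier K"
  shows "conv u v (Suc n) = conv (\<lambda>i. u (Suc i)) v n \<oplus> conv u (\<lambda>i. v (Suc i)) n"
proof -
  have c: "add_pow K k (u i \<otimes> v j) \<in> carrier K" for k :: nat and i j
    using u v by (simp add: add.nat_pow_closed)
  have "conv u v (Suc n) =
    (\<Oplus>j\<in>{..n}. add_pow K (n choose j) (u (Suc j) \<otimes> v (n - j))
      \<oplus> add_pow K (n choose Suc j) (u (Suc j) \<otimes> v (n - j))) \<oplus> u 0 \<otimes> v (Suc n)"
    using u v by (simp add: conv_Suc_split add.nat_pow_mult)
  also have "\<dots> = conv (\<lambda>i. u (Suc i)) v n \<oplus>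
    ((\<Oplus>j\<in>{..n}. add_pow K (n choose Suc j) (u (Suc j) \<otimes> v (n - j))) \<oplus> u 0 \<otimes> v (Suc n))"
    using c u v by (simp add: finsum_addf conv_def Pi_def a_assoc)
  \<comment> \<open>The lone term is the one at index \<open>0\<close> of a sum up to
    \<open>Suc n\<close>, since \<open>n choose 0\<close> is one.\<close>
  also have "(\<Oplus>j\<in>{..n}. add_pow K (n choose Suc j) (u (Suc j) \<otimes> v (n - j))) \<oplus> u 0 \<otimes> v (Suc n)
    = (\<Oplus>i\<in>{..Suc n}. add_pow K (n choose i) (u i \<otimes> v (Suc n - i)))"
    using c u v by (subst finsum_Suc2) (auto simp: Pi_def)
  \<comment> \<open>The term at \<open>Suc n\<close> vanishes because \<open>n choose Suc n\<close>
    is zero.\<close>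
  also have "\<dots> = (\<Oplus>i\<in>{..n}. add_pow K (n choose i) (u i \<otimes> v (Suc n - i)))"
    using c u v by (simp add: Pi_def binomial_eq_0)
  also have "\<dots> = conv u (\<lambda>i. v (Suc i)) n"
    unfolding conv_def using c by (intro finsum_cong') (auto simp: Suc_diff_le)
  finally show ?thesis .
qed

lemma conv_closed:
  assumes "\<And>n. u n \<in> carrier K" and "\<And>n. v n \<in> carrier K"
  shows "conv u v n \<in> carrier K"
  unfolding conv_def using assms by (intro finsum_closed) (auto simp: Pi_def add.nat_pow_closed)

lemma conv_comm:
  assumes "\<And>n. u n \<in> carrier K" and "\<And>n. v n \<in> carrier K"
  shows "conv u v n = conv v u n"
  using assms
proof (induction n arbitrary: u v)
  case 0 then show ?case by (simp add: conv_0 m_comm)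
next
  case (Suc n)
  show ?case
    using Suc.prems Suc.IH[of "\<lambda>i. u (Suc i)" v] Suc.IH[of u "\<lambda>i. v (Suc i)"]
      conv_closed[of v "\<lambda>i. u (Suc i)"] conv_closed[of "\<lambda>i. v (Suc i)" u]
    by (simp add: conv_Suc a_comm)
qed

lemma conv_add:
  assumes "\<And>n. u n \<in> carrier K" "\<And>n. v n \<in> carrier K" "\<And>n. w n \<in> carrier K"
  shows "conv (\<lambda>n. u n \<oplus> v n) w n = conv u w n \<oplus> conv v w n"
  using assms
proof (induction n arbitrary: u v w)
  case 0 then show ?case by (simp add: conv_0 l_distr)
next
  case (Suc n)
  have c: "conv (\<lambda>i. u (Suc i)) w n \<in> carrier K" "conv (\<lambda>i. v (Suc i)) w n \<in> carrier K"
    "conv u (\<lambda>i. w (Suc i)) n \<in> carrier K" "conv v (\<lambda>i. w (Suc i)) n \<in> carrier K"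
    using Suc.prems by (auto intro!: conv_closed)
  show ?case
    using Suc.prems Suc.IH[of "\<lambda>i. u (Suc i)" "\<lambda>i. v (Suc i)" w] Suc.IH[of u v "\<lambda>i. w (Suc i)"] c
    by (simp add: conv_Suc a_ac)
qed

lemma conv_smult:
  assumes "c \<in> carrier K" "\<And>n. u n \<in> carrier K" "\<And>n. v n \<in> carrier K"
  shows "conv (\<lambda>n. c \<otimes> u n) v n = c \<otimes> conv u v n"
  using assms(2,3)
proof (induction n arbitrary: u v)
  case 0 then show ?case using assms(1) by (simp add: conv_0 m_assoc)
next
  case (Suc n)
  have "conv (\<lambda>i. u (Suc i)) v n \<in> carrier K" "conv u (\<lambda>i. v (Suc i)) n \<in> carrier K"
    using Suc.prems by (auto intro!: conv_closed)
  then show ?case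
    using Suc.prems assms(1) Suc.IH[of "\<lambda>i. u (Suc i)" v] Suc.IH[of u "\<lambda>i. v (Suc i)"]
    by (simp add: conv_Suc r_distr)
qed

text \<open>By \<open>conv_Suc\<close> each side at \<open>Suc n\<close> is a sum of three terms at
  \<open>n\<close>, one for each factor shifted, and the induction hypothesis matches them.\<close>

lemma conv_assoc:
  assumes "\<And>n. u n \<in> carrier K" "\<And>n. v n \<in> carrier K" "\<And>n. w n \<in> carrier K"
  shows "conv (conv u v) w n = conv u (conv v w) n"
  using assms
proof (induction n arbitrary: u v w)
  case 0 then show ?case by (simp add: conv_0 conv_closed m_assoc)
next
  case (Suc n)
  let ?u = "\<lambda>i. u (Suc i)" and ?v = "\<lambda>i. v (Suc i)" and ?w = "\<lambda>i. w (Suc i)"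
  note c = conv_closed Suc.prems
  have "conv (conv u v) w (Suc n) = conv (\<lambda>i. conv ?u v i \<oplus> conv u ?v i) w n \<oplus> conv (conv u v) ?w n"
    using Suc.prems by (simp add: conv_Suc[of "conv u v"] c conv_Suc[of u v])
  also have "\<dots> = conv ?u (conv v w) n \<oplus> (conv u (conv ?v w) n \<oplus> conv u (conv v ?w) n)"
    using Suc.prems Suc.IH[of ?u v w] Suc.IH[of u ?v w] Suc.IH[of u v ?w]
    by (simp add: conv_add c a_assoc)
  \<comment> \<open>Additivity was established in the first argument, hence the detour through
    commutativity.\<close>
  also have "conv u (conv ?v w) n \<oplus> conv u (conv v ?w) n = conv u (\<lambda>i. conv v w (Suc i)) n"
    using Suc.prems
    by (simp add: conv_comm[of u] c conv_add[symmetric] conv_Suc[of v w])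
  also have "conv ?u (conv v w) n \<oplus> conv u (\<lambda>i. conv v w (Suc i)) n = conv u (conv v w) (Suc n)"
    using Suc.prems by (simp add: conv_Suc[of u "conv v w"] c)
  finally show ?case .
qed

lemma conv_zero: "(\<And>n. v n \<in> carrier K) \<Longrightarrow> conv (\<lambda>_. \<zero>) v n = \<zero>"
  by (simp add: conv_def)

lemma conv_one:
  assumes "\<And>n. v n \<in> carrier K"
  shows "conv (\<lambda>n. if n = 0 then \<one> else \<zero>) v n = v n"
  using assms
proof (induction n arbitrary: v)
  case 0 then show ?case by (simp add: conv_0)
next
  case (Suc n)
  then show ?case using Suc.IH[of "\<lambda>i. v (Suc i)"] by (simp add: conv_Suc conv_zero)
qed

text \<open>The inverse for \<open>conv\<close>: the recursion solves the vanishing of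
  \<open>conv u v (Suc n)\<close> for \<open>v (Suc n)\<close>. Only \<open>u 0\<close> is inverted,
  so it works in every characteristic.\<close>

fun hinv :: "(nat \<Rightarrow> 'k) \<Rightarrow> nat \<Rightarrow> 'k" where
  "hinv u 0 = inv (u 0)"
| "hinv u (Suc n) = \<ominus> (inv (u 0) \<otimes>
     (\<Oplus>j\<in>{..n}. add_pow K (Suc n choose Suc j) (u (Suc j) \<otimes> hinv u (n - j))))"

lemma hinv_closed:
  assumes u: "\<And>n. u n \<in> carrier K" and u0: "u 0 \<noteq> \<zero>"
  shows "hinv u n \<in> carrier K"
proof (induction n rule: less_induct)
  case (less n)
  have i: "inv (u 0) \<in> carrier K" using u u0 by (simp add: field_Units)
  show ?case
  proof (cases n)
    case (Suc m)
    have "add_pow K (Suc m choose Suc j) (u (Suc j) \<otimes> hinv u (m - j)) \<in> carrier K" for j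
      using less[of "m - j"] Suc u by (simp add: add.nat_pow_closed del: binomial_Suc_Suc)
    then show ?thesis using i Suc by (simp add: Pi_def del: binomial_Suc_Suc)
  qed (simp add: i)
qed

lemma conv_hinv:
  assumes u: "\<And>n. u n \<in> carrier K" and u0: "u 0 \<noteq> \<zero>"
  shows "conv u (hinv u) n = (if n = 0 then \<one> else \<zero>)"
proof (cases n)
  have U: "u 0 \<in> Units K" using u u0 by (simp add: field_Units)
  {
    case 0
    then show ?thesis using U u by (simp add: conv_0 Units_r_inv)
  next
    case (Suc m)
    let ?S = "\<Oplus>j\<in>{..m}. add_pow K (Suc m choose Suc j) (u (Suc j) \<otimes> hinv u (m - j))"
    have S: "?S \<in> carrier K"
      using u hinv_closed[of u, OF u u0] by (intro finsum_closed) (auto simp: Pi_def add.nat_pow_closed)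
    have "conv u (hinv u) (Suc m) = ?S \<oplus> u 0 \<otimes> (\<ominus> (inv (u 0) \<otimes> ?S))"
      using conv_Suc_split[of u "hinv u" m] u hinv_closed[of u, OF u u0] by simp
    also have "\<dots> = \<zero>"
      using U S u by (simp add: r_minus m_assoc[symmetric] Units_r_inv r_neg del: binomial_Suc_Suc)
    finally show ?thesis using Suc by simp
  }
qed

section \<open>Linear forms on polynomials as sequences of values at the monomials\<close>

lemma xpow_closed [simp]: "xpow K n \<in> carrier (UP K)"
  by (simp add: xpow_def)

lemma coeff_xpow: "coeff (UP K) (xpow K n) m = (if n = m then \<one> else \<zero>)"
  by (simp add: xpow_def)

lemma deg_xpow: "deg K (xpow K n) = n"
  by (simp add: xpow_def)

lemma xpow_0: "xpow K 0 = \<one>\<^bsub>UP K\<^esub>"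
  by (simp add: xpow_def)

lemma xpow_mult: "xpow K 1 \<otimes>\<^bsub>UP K\<^esub> xpow K n = xpow K (Suc n)"
  using UP.monom_mult[of \<one> \<one> 1 n] by (simp add: xpow_def)

text \<open>The linear form with prescribed values at the monomials, inverse to reading off those
  values; together with \<open>dual_eq_lin\<close> it identifies \<open>B\<close> with the sequences
  in \<open>K\<close>.\<close>

definition lin :: "(nat \<Rightarrow> 'k) \<Rightarrow> (nat \<Rightarrow> 'k) \<Rightarrow> 'k" where
  "lin u = (\<lambda>q\<in>carrier (UP K). \<Oplus>n\<in>{..deg K q}. coeff (UP K) q n \<otimes> u n)"

lemma finsum_extend:
  assumes "\<And>n. f n \<in> carrier K" "\<And>n. d < n \<Longrightarrow> f n = \<zero>" "d \<le> N"
  shows "(\<Oplus>n\<in>{..N}. f n) = (\<Oplus>n\<in>{..d::nat}. f n)"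
  using assms(3)
proof (induction N rule: dec_induct)
  case (step N)
  then show ?case using assms(1,2) by (simp add: Pi_def)
qed simp

text \<open>Coefficients above the degree vanish, so values at polynomials of different degrees can
  be summed over one common range. This is how additivity of \<open>lin u\<close> is seen.\<close>

lemma lin_bound:
  assumes u: "\<And>n. u n \<in> carrier K" and q: "q \<in> carrier (UP K)" and "deg K q \<le> N"
  shows "lin u q = (\<Oplus>n\<in>{..N}. coeff (UP K) q n \<otimes> u n)"
  unfolding lin_def using q u assms(3) UP.coeff_closed[OF q]
  by (simp add: finsum_extend[of "\<lambda>n. coeff (UP K) q n \<otimes> u n" "deg K q" N] UP.deg_aboveD)

lemma lin_closed:
  assumes u: "\<And>n. u n \<in> carrier K"
  shows "lin u \<in> carrier B"
proof -
  have add: "lin u (p \<oplus>\<^bsub>UP K\<^esub> q) = lin u p \<oplus> lin u q" if pq: "p \<in> carrier (UP K)" "q \<in> carrier (UP K)" for p q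
  proof -
    let ?N = "max (deg K p) (deg K q)"
    have "lin u (p \<oplus>\<^bsub>UP K\<^esub> q) = (\<Oplus>n\<in>{..?N}. coeff (UP K) (p \<oplus>\<^bsub>UP K\<^esub> q) n \<otimes> u n)"
      using pq UP.deg_add by (intro lin_bound[of u, OF u]) auto
    also have "\<dots> = (\<Oplus>n\<in>{..?N}. coeff (UP K) p n \<otimes> u n) \<oplus> (\<Oplus>n\<in>{..?N}. coeff (UP K) q n \<otimes> u n)"
      using u pq by (simp add: l_distr finsum_addf Pi_def)
    finally show ?thesis using lin_bound[of u, OF u, of p ?N] lin_bound[of u, OF u, of q ?N] pq by simp
  qed
  have smult: "lin u (c \<odot>\<^bsub>UP K\<^esub> q) = c \<otimes> lin u q" if cq: "c \<in> carrier K" "q \<in> carrier (UP K)" for c q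
  proof -
    have "deg K (c \<odot>\<^bsub>UP K\<^esub> q) \<le> deg K q" using cq by (intro UP.deg_smult_decr)
    then have "lin u (c \<odot>\<^bsub>UP K\<^esub> q) = (\<Oplus>n\<in>{..deg K q}. c \<otimes> (coeff (UP K) q n \<otimes> u n))"
      using lin_bound[of u, OF u, of "c \<odot>\<^bsub>UP K\<^esub> q" "deg K q"] cq u by (simp add: m_assoc)
    also have "\<dots> = c \<otimes> lin u q"
      using cq u by (simp add: lin_def finsum_rdistr Pi_def)
    finally show ?thesis .
  qed
  have "lin u q \<in> carrier K" if "q \<in> carrier (UP K)" for q
    using that u by (simp add: lin_def Pi_def)
  then have "lin u \<in> carrier (UP K) \<rightarrow>\<^sub>E carrier K" by (auto simp: lin_def)
  then show ?thesis using add smult by (simp add: poly_dual_def)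
qed

lemma lin_xpow:
  assumes u: "\<And>n. u n \<in> carrier K"
  shows "lin u (xpow K n) = u n"
proof -
  have "lin u (xpow K n) = (\<Oplus>m\<in>{..n}. (if n = m then u m else \<zero>))"
    using u by (simp add: lin_def deg_xpow coeff_xpow if_distrib[of "\<lambda>c. c \<otimes> _"] cong: if_cong)
  also have "\<dots> = u n" using u finsum_singleton[of n "{..n}" u] by (simp add: Pi_def)
  finally show ?thesis .
qed

lemma dual_closed: "\<lbrakk>w \<in> carrier B; q \<in> carrier (UP K)\<rbrakk> \<Longrightarrow> w q \<in> carrier K"
  by (auto simp: poly_dual_def)

lemma dual_extensional: "w \<in> carrier B \<Longrightarrow> w \<in> extensional (carrier (UP K))"
  by (auto simp: poly_dual_def PiE_def)

lemma dual_add: "\<lbrakk>w \<in> carrier B; p \<in> carrier (UP K); q \<in> carrier (UP K)\<rbrakk>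
    \<Longrightarrow> w (p \<oplus>\<^bsub>UP K\<^esub> q) = w p \<oplus> w q"
  by (auto simp: poly_dual_def)

lemma dual_smult: "\<lbrakk>w \<in> carrier B; c \<in> carrier K; q \<in> carrier (UP K)\<rbrakk> \<Longrightarrow> w (c \<odot>\<^bsub>UP K\<^esub> q) = c \<otimes> w q"
  by (auto simp: poly_dual_def)

lemma dual_finsum:
  assumes w: "w \<in> carrier B" and f: "\<And>i. f i \<in> carrier (UP K)"
  shows "w (\<Oplus>\<^bsub>UP K\<^esub>i\<in>{..n::nat}. f i) = (\<Oplus>i\<in>{..n}. w (f i))"
proof (induction n)
  case 0 then show ?case using f dual_closed[OF w] by simp
next
  case (Suc n)
  then show ?case using f dual_closed[OF w] dual_add[OF w] by (simp add: Pi_def UP.P.finsum_closed)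
qed

text \<open>A polynomial is a finite combination of monomials, on which a linear form is
  determined.\<close>

lemma dual_eq_lin:
  assumes w: "w \<in> carrier B"
  shows "w = lin (\<lambda>n. w (xpow K n))"
proof (rule extensionalityI[OF dual_extensional[OF w] dual_extensional[OF lin_closed]])
  show "w (xpow K n) \<in> carrier K" for n using dual_closed[OF w] by simp
  fix q assume q: "q \<in> carrier (UP K)"
  have "monom (UP K) (coeff (UP K) q i) i = coeff (UP K) q i \<odot>\<^bsub>UP K\<^esub> xpow K i" for i
    using q UP.monom_mult_smult[of "coeff (UP K) q i" \<one> i] by (simp add: xpow_def)
  then have "q = (\<Oplus>\<^bsub>UP K\<^esub>i\<in>{..deg K q}. coeff (UP K) q i \<odot>\<^bsub>UP K\<^esub> xpow K i)"
    using UP.up_repr[OF q] by simp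
  then have "w q = w (\<Oplus>\<^bsub>UP K\<^esub>i\<in>{..deg K q}. coeff (UP K) q i \<odot>\<^bsub>UP K\<^esub> xpow K i)" by simp
  also have "\<dots> = (\<Oplus>i\<in>{..deg K q}. coeff (UP K) q i \<otimes> w (xpow K i))"
    using q by (subst dual_finsum[OF w]) (simp_all add: dual_smult[OF w])
  finally show "w q = lin (\<lambda>n. w (xpow K n)) q" using q by (simp add: lin_def)
qed

text \<open>Reduces an identity in \<open>B\<close> to one between sequences, where the operations
  are pointwise except for the product, which is \<open>conv\<close>.\<close>

lemma dual_eqI:
  assumes "w \<in> carrier B" "w' \<in> carrier B" "\<And>n. w (xpow K n) = w' (xpow K n)"
  shows "w = w'"
  using dual_eq_lin[OF assms(1)] dual_eq_lin[OF assms(2)] assms(3) by simp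

lemma dual_mult_lin: "w \<otimes>\<^bsub>B\<^esub> w' = lin (conv (\<lambda>n. w (xpow K n)) (\<lambda>n. w' (xpow K n)))"
  by (simp add: poly_dual_def lin_def conv_def)

lemma dual_mult_closed: "\<lbrakk>w \<in> carrier B; w' \<in> carrier B\<rbrakk> \<Longrightarrow> w \<otimes>\<^bsub>B\<^esub> w' \<in> carrier B"
  unfolding dual_mult_lin by (intro lin_closed conv_closed) (simp_all add: dual_closed)

lemma dual_mult_xpow:
  "\<lbrakk>w \<in> carrier B; w' \<in> carrier B\<rbrakk>
    \<Longrightarrow> (w \<otimes>\<^bsub>B\<^esub> w') (xpow K n) = conv (\<lambda>n. w (xpow K n)) (\<lambda>n. w' (xpow K n)) n"
  unfolding dual_mult_lin by (intro lin_xpow conv_closed) (simp_all add: dual_closed)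

lemma dual_one_xpow: "\<one>\<^bsub>B\<^esub> (xpow K n) = (if n = 0 then \<one> else \<zero>)"
  by (simp add: poly_dual_def coeff_xpow)

lemma dual_zero_xpow: "\<zero>\<^bsub>B\<^esub> (xpow K n) = \<zero>"
  by (simp add: poly_dual_def)

lemma dual_add_apply: "q \<in> carrier (UP K) \<Longrightarrow> (w \<oplus>\<^bsub>B\<^esub> w') q = w q \<oplus> w' q"
  by (simp add: poly_dual_def)

lemma dual_smult_apply: "q \<in> carrier (UP K) \<Longrightarrow> (c \<odot>\<^bsub>B\<^esub> w) q = c \<otimes> w q"
  by (simp add: poly_dual_def)

lemma dual_one_closed: "\<one>\<^bsub>B\<^esub> \<in> carrier B"
  by (auto simp: poly_dual_def)

lemma dual_zero_closed: "\<zero>\<^bsub>B\<^esub> \<in> carrier B"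
  by (auto simp: poly_dual_def)

lemma dual_add_closed: "\<lbrakk>w \<in> carrier B; w' \<in> carrier B\<rbrakk> \<Longrightarrow> w \<oplus>\<^bsub>B\<^esub> w' \<in> carrier B"
proof -
  assume w: "w \<in> carrier B" "w' \<in> carrier B"
  have "w \<oplus>\<^bsub>B\<^esub> w' = (\<lambda>q\<in>carrier (UP K). w q \<oplus> w' q)" by (simp add: poly_dual_def)
  moreover have "\<dots> \<in> carrier B"
    using dual_closed[OF w(1)] dual_closed[OF w(2)] dual_add[OF w(1)] dual_add[OF w(2)]
      dual_smult[OF w(1)] dual_smult[OF w(2)]
    by (simp add: poly_dual_def[of K] a_ac r_distr)
  ultimately show ?thesis by simp
qed

lemma dual_smult_closed: "\<lbrakk>c \<in> carrier K; w \<in> carrier B\<rbrakk> \<Longrightarrow> c \<odot>\<^bsub>B\<^esub> w \<in> carrier B"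
proof -
  assume c: "c \<in> carrier K" and w: "w \<in> carrier B"
  have "c \<odot>\<^bsub>B\<^esub> w = (\<lambda>q\<in>carrier (UP K). c \<otimes> w q)" by (simp add: poly_dual_def)
  moreover have "\<dots> \<in> carrier B"
    using dual_closed[OF w] dual_add[OF w] dual_smult[OF w] c
    by (simp add: poly_dual_def[of K] m_lcomm r_distr)
  ultimately show ?thesis by simp
qed

lemma algebra_dual: "algebra K B"
proof (rule algebraI)
  note x = dual_mult_xpow dual_one_xpow dual_zero_xpow dual_add_apply dual_smult_apply dual_closed
  note c = dual_mult_closed dual_one_closed dual_zero_closed dual_add_closed dual_smult_closed
  show "cring K" by (rule cring_axioms)
  show "cring B"
  proof (rule cringI)
    show "abelian_group B"
    proof (rule abelian_groupI)
      fix u v w assume h: "u \<in> carrier B" "v \<in> carrier B" "w \<in> carrier B"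
      then show "u \<oplus>\<^bsub>B\<^esub> v \<oplus>\<^bsub>B\<^esub> w = u \<oplus>\<^bsub>B\<^esub> (v \<oplus>\<^bsub>B\<^esub> w)"
        by (intro dual_eqI c) (simp_all add: x a_assoc)
      from h show "u \<oplus>\<^bsub>B\<^esub> v = v \<oplus>\<^bsub>B\<^esub> u"
        by (intro dual_eqI c) (simp_all add: x a_comm)
    next
      fix u assume u: "u \<in> carrier B"
      then show "\<zero>\<^bsub>B\<^esub> \<oplus>\<^bsub>B\<^esub> u = u" by (intro dual_eqI c) (simp_all add: x)
      have "(\<ominus> \<one>) \<odot>\<^bsub>B\<^esub> u \<oplus>\<^bsub>B\<^esub> u = \<zero>\<^bsub>B\<^esub>"
        using u by (intro dual_eqI c) (simp_all add: x l_minus l_neg)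
      then show "\<exists>v\<in>carrier B. v \<oplus>\<^bsub>B\<^esub> u = \<zero>\<^bsub>B\<^esub>"
        using c(5)[of "\<ominus> \<one>" u] u by auto
    qed (rule c; assumption)+
    show "comm_monoid B"
    proof (rule comm_monoidI)
      fix u v w assume h: "u \<in> carrier B" "v \<in> carrier B" "w \<in> carrier B"
      then show "u \<otimes>\<^bsub>B\<^esub> v \<otimes>\<^bsub>B\<^esub> w = u \<otimes>\<^bsub>B\<^esub> (v \<otimes>\<^bsub>B\<^esub> w)"
        using conv_assoc[of "\<lambda>n. u (xpow K n)" "\<lambda>n. v (xpow K n)" "\<lambda>n. w (xpow K n)"]
        by (intro dual_eqI c) (simp_all add: x c)
      from h show "u \<otimes>\<^bsub>B\<^esub> v = v \<otimes>\<^bsub>B\<^esub> u"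
        using conv_comm[of "\<lambda>n. u (xpow K n)" "\<lambda>n. v (xpow K n)"]
        by (intro dual_eqI c) (simp_all add: x c)
    next
      fix u assume u: "u \<in> carrier B"
      then show "\<one>\<^bsub>B\<^esub> \<otimes>\<^bsub>B\<^esub> u = u"
        using conv_one[of "\<lambda>n. u (xpow K n)"] by (intro dual_eqI c) (simp_all add: x c)
    qed (rule c; assumption)+
    fix u v w assume h: "u \<in> carrier B" "v \<in> carrier B" "w \<in> carrier B"
    then show "(u \<oplus>\<^bsub>B\<^esub> v) \<otimes>\<^bsub>B\<^esub> w = u \<otimes>\<^bsub>B\<^esub> w \<oplus>\<^bsub>B\<^esub> v \<otimes>\<^bsub>B\<^esub> w"
      using conv_add[of "\<lambda>n. u (xpow K n)" "\<lambda>n. v (xpow K n)" "\<lambda>n. w (xpow K n)"]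
      by (intro dual_eqI c) (simp_all add: x c)
  qed
  show "a \<odot>\<^bsub>B\<^esub> w \<in> carrier B" if "a \<in> carrier K" "w \<in> carrier B" for a w
    using that c by blast
  show "(a \<oplus> b) \<odot>\<^bsub>B\<^esub> w = a \<odot>\<^bsub>B\<^esub> w \<oplus>\<^bsub>B\<^esub> b \<odot>\<^bsub>B\<^esub> w"
    if "a \<in> carrier K" "b \<in> carrier K" "w \<in> carrier B" for a b w
    using that by (intro dual_eqI c) (simp_all add: x l_distr)
  show "a \<odot>\<^bsub>B\<^esub> (w \<oplus>\<^bsub>B\<^esub> w') = a \<odot>\<^bsub>B\<^esub> w \<oplus>\<^bsub>B\<^esub> a \<odot>\<^bsub>B\<^esub> w'"
    if "a \<in> carrier K" "w \<in> carrier B" "w' \<in> carrier B" for a w w'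
    using that by (intro dual_eqI c) (simp_all add: x r_distr)
  show "(a \<otimes> b) \<odot>\<^bsub>B\<^esub> w = a \<odot>\<^bsub>B\<^esub> (b \<odot>\<^bsub>B\<^esub> w)"
    if "a \<in> carrier K" "b \<in> carrier K" "w \<in> carrier B" for a b w
    using that by (intro dual_eqI c) (simp_all add: x m_assoc)
  show "\<one> \<odot>\<^bsub>B\<^esub> w = w" if "w \<in> carrier B" for w
    using that by (intro dual_eqI c) (simp_all add: x)
  show "(a \<odot>\<^bsub>B\<^esub> w) \<otimes>\<^bsub>B\<^esub> w' = a \<odot>\<^bsub>B\<^esub> (w \<otimes>\<^bsub>B\<^esub> w')"
    if "a \<in> carrier K" "w \<in> carrier B" "w' \<in> carrier B" for a w w'
    using that conv_smult[of a "\<lambda>n. w (xpow K n)" "\<lambda>n. w' (xpow K n)"]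
    by (intro dual_eqI c) (simp_all add: x c)
qed

end

sublocale dual_poly \<subseteq> D: algebra K "poly_dual K"
  by (rule algebra_dual)

section \<open>The invariant derivation and the units of the dual ring\<close>

context dual_poly
begin

text \<open>In the coordinates \<open>w(x\<^sup>n)\<close> the derivation is the shift, whence its
  product rule is \<open>conv_Suc\<close>.\<close>

lemma der_xpow: "w \<in> carrier B \<Longrightarrow> \<delta> w (xpow K n) = w (xpow K (Suc n))"
  by (simp add: dual_der_def xpow_mult del: One_nat_def)

lemma der_closed:
  assumes w: "w \<in> carrier B"
  shows "\<delta> w \<in> carrier B"
proof -
  have "xpow K 1 \<otimes>\<^bsub>UP K\<^esub> (c \<odot>\<^bsub>UP K\<^esub> q) = c \<odot>\<^bsub>UP K\<^esub> (xpow K 1 \<otimes>\<^bsub>UP K\<^esub> q)"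
    if "c \<in> carrier K" "q \<in> carrier (UP K)" for c q
    using that UP.smult_assoc2[of c q "xpow K 1"] UP.P.m_comm by simp
  then show ?thesis
    using dual_closed[OF w] dual_add[OF w] dual_smult[OF w]
    by (simp add: poly_dual_def[of K] dual_der_def UP.P.r_distr)
qed

lemma der_mult:
  assumes w: "w \<in> carrier B" "w' \<in> carrier B"
  shows "\<delta> (w \<otimes>\<^bsub>B\<^esub> w') = \<delta> w \<otimes>\<^bsub>B\<^esub> w' \<oplus>\<^bsub>B\<^esub> w \<otimes>\<^bsub>B\<^esub> \<delta> w'"
  using w conv_Suc[of "\<lambda>n. w (xpow K n)" "\<lambda>n. w' (xpow K n)"]
  by (intro dual_eqI dual_add_closed dual_mult_closed der_closed)
    (simp_all add: der_xpow dual_mult_closed der_closed dual_add_apply dual_mult_xpow dual_closed)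

text \<open>The value at \<open>x\<^sup>0\<close> is multiplicative, so it is nonzero on units;
  conversely \<open>hinv\<close> inverts a sequence with nonzero start. Thus the non-units are the
  kernel of evaluation at \<open>1\<close>, and \<open>B\<close> is local.\<close>

lemma dual_Units_iff:
  assumes w: "w \<in> carrier B"
  shows "w \<in> Units B \<longleftrightarrow> w (xpow K 0) \<noteq> \<zero>"
proof
  assume "w \<in> Units B"
  then obtain v where v: "v \<in> carrier B" "v \<otimes>\<^bsub>B\<^esub> w = \<one>\<^bsub>B\<^esub>" by (auto simp: Units_def)
  then have "v (xpow K 0) \<otimes> w (xpow K 0) = \<one>"
    using dual_mult_xpow[OF v(1) w, of 0] dual_one_xpow[of 0] w by (simp add: conv_0 dual_closed)
  then show "w (xpow K 0) \<noteq> \<zero>" using v(1) dual_closed by auto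
next
  assume n: "w (xpow K 0) \<noteq> \<zero>"
  let ?u = "\<lambda>n. w (xpow K n)"
  have u: "?u n \<in> carrier K" for n using dual_closed[OF w] by simp
  have h: "hinv ?u n \<in> carrier K" for n using hinv_closed[of ?u] u n by simp
  have "w \<otimes>\<^bsub>B\<^esub> lin (hinv ?u) = \<one>\<^bsub>B\<^esub>"
    using w conv_hinv[of ?u] u n
    by (intro dual_eqI dual_mult_closed dual_one_closed lin_closed h)
      (simp_all add: dual_mult_xpow lin_closed h lin_xpow dual_one_xpow)
  then show "w \<in> Units B" using w lin_closed[of "hinv ?u", OF h] by (intro D.UnitsI)
qed

definition m0 :: "((nat \<Rightarrow> 'k) \<Rightarrow> 'k) set" where
  "m0 = {w \<in> carrier B. w (xpow K 0) = \<zero>}"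

lemma ev_hom: "(\<lambda>w. w \<one>\<^bsub>UP K\<^esub>) \<in> ring_hom B K"
  by (rule ring_hom_memI)
    (simp_all add: xpow_0[symmetric] dual_closed dual_mult_xpow conv_0 dual_add_apply dual_one_xpow)

end

section \<open>Spectra of local rings and derivations\<close>

text \<open>Locality is put as a prime \<open>m\<close> outside of which every element is a unit.
  The locale serves twice, for \<open>B\<close> with \<open>m0\<close> and for \<open>K\<close> with
  the zero ideal.\<close>

locale local_spec = cring R for R (structure) +
  fixes m
  assumes m_prime: "primeideal m R"
    and m_units: "a \<in> carrier R \<Longrightarrow> a \<notin> m \<Longrightarrow> a \<in> Units R"
begin

lemma prime_subset_m:
  assumes "primeideal Q R"
  shows "Q \<subseteq> m"
proof
  interpret Q: primeideal Q R by fact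
  fix a assume a: "a \<in> Q"
  then have ac: "a \<in> carrier R" using Q.a_subset by blast
  show "a \<in> m"
  proof (rule ccontr)
    assume "a \<notin> m"
    then have "a \<in> Units R" using m_units ac by blast
    then have "inv a \<otimes> a = \<one>" "inv a \<in> carrier R" by simp_all
    then have "\<one> \<in> Q" using Q.I_l_closed[OF a] by metis
    then show False using one_notin_prime[OF assms] by blast
  qed
qed

lemma m_in_pts: "m \<in> topspace (zariski R)"
  using m_prime by (simp add: topspace_zariski)

lemma open_m:
  assumes "openin (zariski R) V" "m \<in> V"
  shows "V = topspace (zariski R)"
proof
  show "V \<subseteq> topspace (zariski R)" using assms(1) by (rule openin_subset)
  show "topspace (zariski R) \<subseteq> V"
    using zariski_generization[OF assms] prime_subset_m by (auto simp: topspace_zariski)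
qed

text \<open>Equality in the local ring at \<open>m\<close> is equality up to a factor outside
  \<open>m\<close>, which is a unit and cancels. So the value at the closed point already separates
  constants.\<close>

lemma spec_const_inj:
  assumes "a \<in> carrier R" "b \<in> carrier R" "m \<in> V" "spec_const R V a m = spec_const R V b m"
  shows "a = b"
proof -
  interpret M: mult_set R "carrier R - m" by (rule mult_set_prime[OF m_prime])
  have "fraction_at R m a \<one> = fraction_at R m b \<one>" using assms by (simp add: spec_const_def)
  then obtain u where u: "u \<in> carrier R - m" "u \<otimes> (\<one> \<otimes> a) = u \<otimes> (\<one> \<otimes> b)"
    using M.fraction_eqD[OF assms(1,2) M.M_one M.M_one] by blast
  then have "u \<in> Units R" using m_units by blast
  then show ?thesis using Units_l_cancel[of u a b] u assms(1,2) by simp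
qed

text \<open>A representation \<open>b/s\<close> around \<open>m\<close> is valid at all primes by
  \<open>open_m\<close>, and \<open>s\<close>, being outside \<open>m\<close>, is a unit. Hence
  global sections are elements of the ring.\<close>

lemma spec_const_surj:
  assumes \<sigma>: "\<sigma> \<in> carrier (spec_sec R (topspace (zariski R)))"
  obtains a where "a \<in> carrier R" "\<sigma> = spec_const R (topspace (zariski R)) a"
proof (rule spec_sec_local[OF \<sigma> m_in_pts])
  let ?T = "topspace (zariski R)"
  fix V b s
  assume V: "openin (zariski R) V" "m \<in> V" "V \<subseteq> ?T" "b \<in> carrier R" "s \<in> carrier R"
    "\<forall>Q\<in>V. s \<notin> Q \<and> \<sigma> Q = fraction_at R Q b s"
  have VT: "V = ?T" using open_m V(1,2) by blast
  have s: "s \<in> Units R" using m_units V by blast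
  have c: "inv s \<otimes> b \<in> carrier R" using s V by simp
  have "\<sigma> = spec_const R ?T (inv s \<otimes> b)"
  proof (rule spec_sec_eqI[OF \<sigma> spec_const_closed[OF _ c]])
    fix Q assume Q: "Q \<in> ?T"
    have q: "primeideal Q R" using Q by (simp add: topspace_zariski)
    have sQ: "s \<notin> Q" "\<sigma> Q = fraction_at R Q b s" using V(6) Q VT by blast+
    have "s \<otimes> (inv s \<otimes> b) = b" using s V by (simp add: m_assoc[symmetric])
    then have "fraction_at R Q b s = fraction_at R Q (inv s \<otimes> b) \<one>"
      using V sQ c one_notin_prime[OF q] by (intro fraction_eqI_at[OF q]) simp_all
    then show "\<sigma> Q = spec_const R ?T (inv s \<otimes> b) Q" using sQ Q by (simp add: spec_const_def)
  qed simp
  then show thesis using that c by blast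
qed

end

lemma (in field) local_spec_field: "local_spec R {\<zero>}"
  by (intro local_spec.intro local_spec_axioms.intro cring_axioms zeroprimeideal)
    (simp add: field_Units)

section \<open>Derivations and the quotient rule\<close>

locale derivation = cring R for R (structure) +
  fixes d
  assumes d_closed: "a \<in> carrier R \<Longrightarrow> d a \<in> carrier R"
    and d_mult: "\<lbrakk>a \<in> carrier R; b \<in> carrier R\<rbrakk> \<Longrightarrow> d (a \<otimes> b) = d a \<otimes> b \<oplus> a \<otimes> d b"
begin

lemma d_one: "d \<one> = \<zero>"
proof -
  have "d \<one> \<oplus> \<zero> = d \<one> \<oplus> d \<one>" using d_mult[of \<one> \<one>] d_closed[of \<one>] by simp
  then show ?thesis using d_closed[of \<one>] add.l_cancel by (metis one_closed zero_closed)
qed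

text \<open>This makes the quotient rule independent of the fraction: \<open>u\<close> witnesses
  that \<open>a/s\<close> and \<open>b/t\<close> are equal, and \<open>u \<otimes> u\<close>
  witnesses the same for their derivatives. Differentiate the relation and multiply by
  \<open>u\<close> once more; the terms with \<open>d u\<close> cancel by the relation
  itself.\<close>

lemma quotient_rule:
  assumes c: "a \<in> carrier R" "b \<in> carrier R" "s \<in> carrier R" "t \<in> carrier R" "u \<in> carrier R"
    and eq: "u \<otimes> (t \<otimes> a) = u \<otimes> (s \<otimes> b)"
  shows "(u \<otimes> u) \<otimes> ((s \<otimes> s) \<otimes> (t \<otimes> d b \<ominus> b \<otimes> d t)) = (u \<otimes> u) \<otimes> ((t \<otimes> t) \<otimes> (s \<otimes> d a \<ominus> a \<otimes> d s))"
proof -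
  note dc = d_closed[OF c(1)] d_closed[OF c(2)] d_closed[OF c(3)] d_closed[OF c(4)] d_closed[OF c(5)]
  \<comment> \<open>The four terms of \<open>u\<^sup>2 d(ta)\<close> and
    \<open>u\<^sup>2 d(sb)\<close>, named so that the differentiated relation reads
    \<open>p \<oplus> q = r \<oplus> v\<close>.\<close>
  define p q r v where "p = u \<otimes> u \<otimes> (d t \<otimes> a)" and "q = u \<otimes> u \<otimes> (t \<otimes> d a)"
    and "r = u \<otimes> u \<otimes> (d s \<otimes> b)" and "v = u \<otimes> u \<otimes> (s \<otimes> d b)"
  note defs = this
  have pc: "p \<in> carrier R" "q \<in> carrier R" "r \<in> carrier R" "v \<in> carrier R"
    using c dc by (simp_all add: defs)
  have eq': "x \<otimes> (u \<otimes> (t \<otimes> a)) = x \<otimes> (u \<otimes> (s \<otimes> b))" for x by (simp add: eq)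
  have "d (u \<otimes> (t \<otimes> a)) = d (u \<otimes> (s \<otimes> b))" by (simp add: eq)
  then have "d u \<otimes> (t \<otimes> a) \<oplus> u \<otimes> (d t \<otimes> a \<oplus> t \<otimes> d a) = d u \<otimes> (s \<otimes> b) \<oplus> u \<otimes> (d s \<otimes> b \<oplus> s \<otimes> d b)"
    using c by (simp add: d_mult)
  then have "u \<otimes> (d u \<otimes> (t \<otimes> a) \<oplus> u \<otimes> (d t \<otimes> a \<oplus> t \<otimes> d a))
    = u \<otimes> (d u \<otimes> (s \<otimes> b) \<oplus> u \<otimes> (d s \<otimes> b \<oplus> s \<otimes> d b))" by simp
  moreover have "u \<otimes> (d u \<otimes> (t \<otimes> a) \<oplus> u \<otimes> (d t \<otimes> a \<oplus> t \<otimes> d a)) = d u \<otimes> (u \<otimes> (t \<otimes> a)) \<oplus> (p \<oplus> q)"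
    using c dc by (simp add: defs r_distr m_ac)
  moreover have "u \<otimes> (d u \<otimes> (s \<otimes> b) \<oplus> u \<otimes> (d s \<otimes> b \<oplus> s \<otimes> d b)) = d u \<otimes> (u \<otimes> (s \<otimes> b)) \<oplus> (r \<oplus> v)"
    using c dc by (simp add: defs r_distr m_ac)
  ultimately have "d u \<otimes> (u \<otimes> (s \<otimes> b)) \<oplus> (p \<oplus> q) = d u \<otimes> (u \<otimes> (s \<otimes> b)) \<oplus> (r \<oplus> v)"
    by (simp add: eq)
  then have pq: "p \<oplus> q = r \<oplus> v" using c dc pc by simp
  \<comment> \<open>After multiplication by \<open>s \<otimes> t\<close> the left side becomes the
    term for \<open>b/t\<close> and the right side the term for \<open>a/s\<close>.\<close>
  have "v \<ominus> p = \<ominus> p \<oplus> (\<ominus> r \<oplus> (r \<oplus> v))" using pc by algebra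
  also have "\<dots> = \<ominus> p \<oplus> (\<ominus> r \<oplus> (p \<oplus> q))" by (simp add: pq)
  also have "\<dots> = q \<ominus> r" using pc by algebra
  finally have vp: "v \<ominus> p = q \<ominus> r" .
  have 1: "(u \<otimes> u) \<otimes> ((s \<otimes> s) \<otimes> (b \<otimes> d t)) = (s \<otimes> t) \<otimes> p"
  proof -
    have "(u \<otimes> u) \<otimes> ((s \<otimes> s) \<otimes> (b \<otimes> d t)) = (u \<otimes> (s \<otimes> d t)) \<otimes> (u \<otimes> (s \<otimes> b))"
      using c dc by (simp add: m_ac)
    also have "\<dots> = (s \<otimes> t) \<otimes> p"
      unfolding eq'[symmetric] using c dc by (simp add: defs m_ac)
    finally show ?thesis .
  qed
  have 2: "(u \<otimes> u) \<otimes> ((t \<otimes> t) \<otimes> (a \<otimes> d s)) = (s \<otimes> t) \<otimes> r"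
  proof -
    have "(u \<otimes> u) \<otimes> ((t \<otimes> t) \<otimes> (a \<otimes> d s)) = (u \<otimes> (t \<otimes> d s)) \<otimes> (u \<otimes> (t \<otimes> a))"
      using c dc by (simp add: m_ac)
    also have "\<dots> = (s \<otimes> t) \<otimes> r"
      unfolding eq' using c dc by (simp add: defs m_ac)
    finally show ?thesis .
  qed
  have "(u \<otimes> u) \<otimes> ((s \<otimes> s) \<otimes> (t \<otimes> d b \<ominus> b \<otimes> d t))
    = (u \<otimes> u) \<otimes> ((s \<otimes> s) \<otimes> (t \<otimes> d b)) \<ominus> (u \<otimes> u) \<otimes> ((s \<otimes> s) \<otimes> (b \<otimes> d t))"
    using c dc by (simp add: minus_eq r_distr r_minus)
  also have "\<dots> = (s \<otimes> t) \<otimes> v \<ominus> (s \<otimes> t) \<otimes> p"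
    unfolding 1 using c dc by (simp add: defs m_ac)
  also have "\<dots> = (s \<otimes> t) \<otimes> (v \<ominus> p)" using c pc by (simp add: minus_eq r_distr r_minus)
  also have "\<dots> = (s \<otimes> t) \<otimes> q \<ominus> (s \<otimes> t) \<otimes> r" unfolding vp using c pc by (simp add: minus_eq r_distr r_minus)
  also have "\<dots> = (u \<otimes> u) \<otimes> ((t \<otimes> t) \<otimes> (s \<otimes> d a)) \<ominus> (u \<otimes> u) \<otimes> ((t \<otimes> t) \<otimes> (a \<otimes> d s))"
    unfolding 2 using c dc by (simp add: defs m_ac)
  also have "\<dots> = (u \<otimes> u) \<otimes> ((t \<otimes> t) \<otimes> (s \<otimes> d a \<ominus> a \<otimes> d s))"
    using c dc by (simp add: minus_eq r_distr r_minus)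
  finally show ?thesis .
qed

text \<open>By \<open>quotient_rule\<close> all terms of the union in
  \<open>spec_vector_field\<close> coincide, so one representative may be used.\<close>

lemma spec_vector_field_at:
  assumes P: "P \<in> U" "primeideal P R" and as: "a \<in> carrier R" "s \<in> carrier R" "s \<notin> P"
    and \<sigma>: "\<sigma> P = fraction_at R P a s"
  shows "spec_vector_field R d U \<sigma> P = fraction_at R P (s \<otimes> d a \<ominus> a \<otimes> d s) (s \<otimes> s)"
proof -
  interpret M: mult_set R "carrier R - P" by (rule mult_set_prime[OF P(2)])
  have s: "s \<in> carrier R - P" using as by blast
  have "fraction_at R P (t \<otimes> d b \<ominus> b \<otimes> d t) (t \<otimes> t) = fraction_at R P (s \<otimes> d a \<ominus> a \<otimes> d s) (s \<otimes> s)"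
    if h: "(b, t) \<in> fraction_at R P a s" for b t
  proof -
    obtain u where u: "b \<in> carrier R" "t \<in> carrier R - P" "u \<in> carrier R - P"
      "u \<otimes> (t \<otimes> a) = u \<otimes> (s \<otimes> b)"
      using h unfolding M.mem_fraction_iff[OF as(1) s] by blast
    have "t \<in> carrier R" "u \<in> carrier R" using u by blast+
    note q = quotient_rule[OF as(1) u(1) as(2) this u(4)]
    show ?thesis
      using q u(1-3) s as(1) M.M_mult d_closed
      by (intro M.fraction_eqI[of _ _ _ _ "u \<otimes> u"]) simp_all
  qed
  then have "(\<Union>(b, t)\<in>fraction_at R P a s. fraction_at R P (t \<otimes> d b \<ominus> b \<otimes> d t) (t \<otimes> t))
    = fraction_at R P (s \<otimes> d a \<ominus> a \<otimes> d s) (s \<otimes> s)"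
    by (rule M.UN_fraction[OF as(1) s])
  then show ?thesis using P(1) \<sigma> by (simp add: spec_vector_field_def)
qed

lemma spec_vector_field_const:
  assumes U: "openin (zariski R) U" and a: "a \<in> carrier R"
  shows "spec_vector_field R d U (spec_const R U a) = spec_const R U (d a)"
proof (rule extensionalityI[of _ U])
  fix P assume P: "P \<in> U"
  have p: "primeideal P R" by (rule zariski_prime[OF U P])
  have "spec_vector_field R d U (spec_const R U a) P
      = fraction_at R P (\<one> \<otimes> d a \<ominus> a \<otimes> d \<one>) (\<one> \<otimes> \<one>)"
    using P a one_notin_prime[OF p] by (intro spec_vector_field_at[OF P p]) (simp_all add: spec_const_def)
  then show "spec_vector_field R d U (spec_const R U a) P = spec_const R U (d a) P"
    using P a d_closed[OF a] by (simp add: spec_const_def d_one minus_eq)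
qed (simp_all add: spec_vector_field_def spec_const_def)

end

section \<open>Affine charts\<close>

locale chart = presheaf X for X :: "('a, 'b, 'm) ringed_space_scheme" +
  fixes U :: "'a set" and A :: "'r ring"
    and \<theta> :: "('a, 'b, 'r set, 'r set \<Rightarrow> ('r \<times> 'r) set) lrs_map"
    and \<theta>' :: "('r set, 'r set \<Rightarrow> ('r \<times> 'r) set, 'a, 'b) lrs_map"
  assumes chart: "affine_chart X U A \<theta> \<theta>'"

sublocale chart \<subseteq> A: cring A
  using chart by (simp add: affine_chart_def)

context chart
begin

abbreviation X0 where "X0 \<equiv> open_sub X U"

abbreviation TA where "TA \<equiv> topspace (zariski A)"

text \<open>The identification of \<open>A\<close> with the sections over \<open>U\<close>;
  \<open>co_theta'_G\<close> leads back to constants.\<close>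

definition G :: "'r \<Rightarrow> 'b" where
  "G a = co \<theta> TA (spec_const A TA a)"

lemma U_open: "opn X U"
  using chart by (simp add: affine_chart_def)

lemma pts_X0: "pts X0 = U"
  using openin_subset[OF U_open] by auto

lemma opn_X0: "opn X0 V \<longleftrightarrow> opn X V \<and> V \<subseteq> U"
  using openin_open_subtopology[OF U_open] by simp

lemma theta: "premorphism X0 (spec A) \<theta>" and theta': "premorphism (spec A) X0 \<theta>'"
  using chart lrs_imp_premorphism unfolding affine_chart_def by blast+

lemma theta_pt: "p \<in> U \<Longrightarrow> pt \<theta> p \<in> TA"
  using premorphism_pt[OF theta, of p] unfolding pts_X0 by simp

lemma theta'_theta: "p \<in> U \<Longrightarrow> pt \<theta>' (pt \<theta> p) = p"
  using chart pts_X0 unfolding affine_chart_def eq_map_def comp_map_def id_map_def by auto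

lemma theta_theta': "Q \<in> TA \<Longrightarrow> pt \<theta> (pt \<theta>' Q) = Q"
  using chart unfolding affine_chart_def eq_map_def comp_map_def id_map_def by auto

lemma co_theta_theta': "\<lbrakk>opn X V; V \<subseteq> U; s \<in> carrier (sec X V)\<rbrakk>
    \<Longrightarrow> co \<theta> (preim (spec A) \<theta>' V) (co \<theta>' V s) = s"
  using chart opn_X0[of V] unfolding affine_chart_def eq_map_def comp_map_def id_map_def by simp

lemma co_theta'_theta: "\<lbrakk>openin (zariski A) V; s \<in> carrier (spec_sec A V)\<rbrakk>
    \<Longrightarrow> co \<theta>' (preim X0 \<theta> V) (co \<theta> V s) = s"
  using chart unfolding affine_chart_def eq_map_def comp_map_def id_map_def by simp

lemma preim_theta_theta': "V \<subseteq> U \<Longrightarrow> preim X0 \<theta> (preim (spec A) \<theta>' V) = V"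
  using theta'_theta pts_X0 premorphism_pt[OF theta] by (auto simp: mem_preim)

lemma preim_theta_TA: "preim X0 \<theta> TA = U"
  using preim_pts[OF theta] pts_X0 by simp

lemma preim_theta'_U: "preim (spec A) \<theta>' U = TA"
  using preim_pts[OF theta'] pts_X0 by simp

lemma G_closed: "a \<in> carrier A \<Longrightarrow> G a \<in> carrier (sec X U)"
  using co_closed[OF theta, of TA "spec_const A TA a"] A.spec_const_closed[of TA a]
  by (simp add: G_def preim_theta_TA)

lemma G_hom: "G \<in> ring_hom A (sec X U)"
proof -
  have "co \<theta> TA \<in> ring_hom (spec_sec A TA) (sec X U)"
    using co_hom[OF theta, of TA] by (simp add: preim_theta_TA)
  from ring_hom_mult[OF this] ring_hom_add[OF this] ring_hom_one[OF this] show ?thesis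
    by (intro ring_hom_memI)
      (simp_all add: G_closed, simp_all add: G_def A.spec_const_closed
        A.spec_const_mult[symmetric] A.spec_const_add[symmetric] A.spec_const_one)
qed

lemma co_theta'_G: "a \<in> carrier A \<Longrightarrow> co \<theta>' U (G a) = spec_const A TA a"
  using co_theta'_theta[of TA "spec_const A TA a"] A.spec_const_closed[of TA a]
  by (simp add: G_def preim_theta_TA)

text \<open>An isomorphism reflects units because its inverse carries them back: the pullback by
  \<open>\<theta>\<close> of the pullback by \<open>\<theta>'\<close> is the section itself.\<close>

lemma reflects_theta': "reflects (spec A) X0 \<theta>'"
  unfolding reflects_def
proof (intro allI impI, elim conjE)
  fix V t Q
  assume V0: "opn X0 V" and t: "t \<in> carrier (sec X0 V)" and Q: "Q \<in> preim (spec A) \<theta>' V"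
    and inv: "inv_at (spec A) Q (preim (spec A) \<theta>' V) (co \<theta>' V t)"
  have V: "opn X V" "V \<subseteq> U" "t \<in> carrier (sec X V)" using V0 t opn_X0 by auto
  have p: "pt \<theta>' Q \<in> U" using Q V(2) by (auto simp: mem_preim)
  have QT: "pt \<theta> (pt \<theta>' Q) = Q" using Q by (intro theta_theta') (simp add: mem_preim)
  have "inv_at X0 (pt \<theta>' Q) (preim X0 \<theta> (preim (spec A) \<theta>' V)) (co \<theta> (preim (spec A) \<theta>' V) (co \<theta>' V t))"
    using inv QT Q p pts_X0
    by (intro inv_at_co[OF theta preim_open[OF theta' V0] co_closed[OF theta' V0 t]])
      (simp_all add: mem_preim)
  then show "inv_at X0 (pt \<theta>' Q) V t"
    by (simp add: preim_theta_theta'[OF V(2)] co_theta_theta'[OF V])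
qed

text \<open>On the spectrum a constant is invertible at a prime exactly when it lies outside it, and
  units pass both ways along \<open>\<theta>\<close> and \<open>\<theta>'\<close>. This recovers the
  prime of a point from the invertibility of functions there.\<close>

lemma inv_at_G_iff:
  assumes p: "p \<in> U" and a: "a \<in> carrier A"
  shows "inv_at X p U (G a) \<longleftrightarrow> a \<notin> pt \<theta> p"
proof -
  have T: "openin (zariski A) TA" by simp
  have c: "spec_const A TA a \<in> carrier (spec_sec A TA)" using A.spec_const_closed[OF T a] .
  have Q: "pt \<theta> p \<in> TA" using p by (rule theta_pt)
  then have prime: "primeideal (pt \<theta> p) A" by (simp add: A.topspace_zariski)
  have iff: "inv_at (spec A) (pt \<theta> p) TA (spec_const A TA a) \<longleftrightarrow> a \<notin> pt \<theta> p"
    using Q A.one_notin_prime[OF prime]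
    by (intro A.inv_at_spec_iff[OF T c Q a A.one_closed]) (simp_all add: spec_const_def)
  have "inv_at X0 p U (G a) \<longleftrightarrow> inv_at (spec A) (pt \<theta> p) TA (spec_const A TA a)"
  proof
    assume "inv_at X0 p U (G a)"
    then have "inv_at (spec A) (pt \<theta> p) (preim (spec A) \<theta>' U) (co \<theta>' U (G a))"
      using U_open G_closed[OF a] p Q theta'_theta[OF p] opn_X0
      by (intro inv_at_co[OF theta']) (simp_all add: mem_preim)
    then show "inv_at (spec A) (pt \<theta> p) TA (spec_const A TA a)"
      by (simp add: preim_theta'_U co_theta'_G[OF a])
  next
    assume "inv_at (spec A) (pt \<theta> p) TA (spec_const A TA a)"
    then have "inv_at X0 p (preim X0 \<theta> TA) (co \<theta> TA (spec_const A TA a))"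
      using c p preim_theta_TA by (intro inv_at_co[OF theta]) simp_all
    then show "inv_at X0 p U (G a)" by (simp add: preim_theta_TA G_def)
  qed
  then show ?thesis using iff inv_at_open_sub[OF U_open order_refl] by blast
qed

text \<open>Transport of \<open>locally_fractions_spec\<close>: a section is moved to
  \<open>spec A\<close> by \<open>\<theta>'\<close>, written there as a fraction of constants, and
  moved back by \<open>\<theta>\<close>.\<close>

lemma locally_fractions_G: "locally_fractions X U {G a |a. a \<in> carrier A}"
  unfolding locally_fractions_def
proof (intro conjI allI impI)
  show "opn X U" by (rule U_open)
  show "{G a |a. a \<in> carrier A} \<subseteq> carrier (sec X U)" using G_closed by blast
  fix V \<tau> p
  assume "opn X V \<and> V \<subseteq> U \<and> \<tau> \<in> carrier (sec X V) \<and> p \<in> V"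
  then have V: "opn X V" "V \<subseteq> U" "\<tau> \<in> carrier (sec X V)" and p: "p \<in> V" by auto
  have V0: "opn X0 V" "\<tau> \<in> carrier (sec X0 V)" using V opn_X0 by auto
  let ?V = "preim (spec A) \<theta>' V" and ?\<sigma> = "co \<theta>' V \<tau>"
  have V': "opn (spec A) ?V" by (rule preim_open[OF theta' V0(1)])
  have \<sigma>: "?\<sigma> \<in> carrier (sec (spec A) ?V)" by (rule co_closed[OF theta' V0])
  have Q: "pt \<theta> p \<in> ?V"
    using p V(2) premorphism_pt[OF theta, of p] pts_X0 theta'_theta[of p] by (auto simp: mem_preim)
  obtain s a W where h0:
    "s \<in> {spec_const A (pts (spec A)) a |a. a \<in> carrier A}"
    "a \<in> {spec_const A (pts (spec A)) a |a. a \<in> carrier A}"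
    "s \<in> carrier (sec (spec A) (pts (spec A)))" "a \<in> carrier (sec (spec A) (pts (spec A)))"
    "opn (spec A) W" "pt \<theta> p \<in> W" "W \<subseteq> ?V" "res (spec A) (pts (spec A)) W s \<in> Units (sec (spec A) W)"
    "res (spec A) (pts (spec A)) W s \<otimes>\<^bsub>sec (spec A) W\<^esub> res (spec A) ?V W ?\<sigma> = res (spec A) (pts (spec A)) W a"
    by (rule locally_fractionsE[OF A.locally_fractions_spec V' openin_subset[OF V'] \<sigma> Q])
  note h = h0[unfolded spec_simps]
  let ?W = "preim X0 \<theta> W"
  have W0: "opn X0 ?W" using preim_open[OF theta, of W] h(5) by simp
  then have W: "opn X ?W" "?W \<subseteq> U" using opn_X0 by auto
  have WV: "?W \<subseteq> V" using preim_mono[OF h(7), of X0 \<theta>] preim_theta_theta'[OF V(2)] by simp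
  have pW: "p \<in> ?W" using p V(2) pts_X0 h(6) by (auto simp: mem_preim)
  have WT: "W \<subseteq> TA" using h(5) by (rule openin_subset)
  have resG: "res X U ?W (co \<theta> TA c) = co \<theta> W (restrict c W)" if "c \<in> carrier (spec_sec A TA)" for c
    using co_res[OF theta, of TA W c] h(5) WT that by (simp add: preim_theta_TA)
  have res\<tau>: "res X V ?W \<tau> = co \<theta> W (restrict ?\<sigma> W)"
    using co_res[OF theta V' _ h(7) \<sigma>] h(5) co_theta_theta'[OF V] preim_theta_theta'[OF V(2)] by simp
  have hom: "co \<theta> W \<in> ring_hom (spec_sec A W) (sec X ?W)" using co_hom[OF theta, of W] h(5) by simp
  have \<sigma>W: "restrict ?\<sigma> W \<in> carrier (spec_sec A W)"
    using A.restrict_spec_sec[of ?V W ?\<sigma>] V' h(5,7) \<sigma> by simp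
  have sW: "restrict s W \<in> carrier (spec_sec A W)"
    using A.restrict_spec_sec[of TA W s] WT h(5,3) by simp
  have 1: "res X U ?W (co \<theta> TA s) \<in> Units (sec X ?W)"
    using ring_hom_Units[OF hom h(8)] resG[OF h(3)] by simp
  have 2: "res X U ?W (co \<theta> TA s) \<otimes>\<^bsub>sec X ?W\<^esub> res X V ?W \<tau> = res X U ?W (co \<theta> TA a)"
    unfolding resG[OF h(3)] resG[OF h(4)] res\<tau> h(9)[symmetric]
    using ring_hom_mult[OF hom sW \<sigma>W] by simp
  have "co \<theta> TA s \<in> {G a |a. a \<in> carrier A}" "co \<theta> TA a \<in> {G a |a. a \<in> carrier A}"
    using h(1,2) unfolding G_def by auto
  then show "\<exists>s\<in>{G a |a. a \<in> carrier A}. \<exists>a\<in>{G a |a. a \<in> carrier A}. \<exists>W. opn X W \<and> p \<in> W \<and> W \<subseteq> V \<and>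
      res X U W s \<in> Units (sec X W) \<and> res X U W s \<otimes>\<^bsub>sec X W\<^esub> res X V W \<tau> = res X U W a"
    using 1 2 W WV pW by (intro bexI[of _ "co \<theta> TA s"] bexI[of _ "co \<theta> TA a"] exI[of _ ?W]) auto
qed

text \<open>The uniqueness half of the correspondence between maps from a spectrum to an affine
  scheme and ring homomorphisms. Points agree because the prime of \<open>pt f P\<close> is the set
  of those \<open>a\<close> for which \<open>G a\<close> is not invertible there, and this is
  decided by \<open>co f U (G a)\<close> at \<open>P\<close>; sections then agree by
  \<open>premorphisms_from_spec_eqI\<close>.\<close>

lemma eq_map_from_spec:
  assumes R: "cring R"
    and f: "premorphism (spec R) X f" "reflects (spec R) X f"
    and g: "premorphism (spec R) X g" "reflects (spec R) X g"
    and fU: "\<And>P. P \<in> pts (spec R) \<Longrightarrow> pt f P \<in> U" and gU: "\<And>P. P \<in> pts (spec R) \<Longrightarrow> pt g P \<in> U"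
    and co: "\<And>a. a \<in> carrier A \<Longrightarrow> co f U (G a) = co g U (G a)"
  shows "eq_map (spec R) X f g"
proof (rule premorphisms_from_spec_eqI[OF R presheaf_axioms locally_fractions_G f(1) g(1)])
  \<comment> \<open>One implication is the pullback of units, the other is
    \<open>reflects\<close>.\<close>
  have *: "inv_at X (pt h P) U (G a) \<longleftrightarrow> inv_at (spec R) P (pts (spec R)) (co h U (G a))"
    if h: "premorphism (spec R) X h" "reflects (spec R) X h" "\<And>P. P \<in> pts (spec R) \<Longrightarrow> pt h P \<in> U"
      and a: "a \<in> carrier A" and P: "P \<in> pts (spec R)" for h a P
  proof -
    have pre: "preim (spec R) h U = pts (spec R)" using h(3) by (auto simp: mem_preim)
    have PU: "P \<in> preim (spec R) h U" using P unfolding pre .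
    show ?thesis
    proof
      assume "inv_at X (pt h P) U (G a)"
      from inv_at_co[OF h(1) U_open G_closed[OF a] PU this]
      show "inv_at (spec R) P (pts (spec R)) (co h U (G a))" unfolding pre .
    next
      assume "inv_at (spec R) P (pts (spec R)) (co h U (G a))"
      then have "inv_at (spec R) P (preim (spec R) h U) (co h U (G a))" unfolding pre .
      then show "inv_at X (pt h P) U (G a)"
        using h(2)[unfolded reflects_def, rule_format, of U "G a" P] U_open G_closed[OF a] PU by simp
    qed
  qed
  fix P assume P: "P \<in> pts (spec R)"
  have eq: "a \<in> pt \<theta> (pt f P) \<longleftrightarrow> a \<in> pt \<theta> (pt g P)" if a: "a \<in> carrier A" for a
  proof -
    have "a \<notin> pt \<theta> (pt f P) \<longleftrightarrow> inv_at X (pt f P) U (G a)"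
      by (rule inv_at_G_iff[OF fU[OF P] a, symmetric])
    also have "\<dots> \<longleftrightarrow> inv_at (spec R) P (pts (spec R)) (co f U (G a))" by (rule *[OF f fU a P])
    also have "\<dots> \<longleftrightarrow> inv_at X (pt g P) U (G a)" unfolding co[OF a] by (rule *[OF g gU a P, symmetric])
    also have "\<dots> \<longleftrightarrow> a \<notin> pt \<theta> (pt g P)" by (rule inv_at_G_iff[OF gU[OF P] a])
    finally show ?thesis by blast
  qed
  have sub: "pt \<theta> p \<subseteq> carrier A" if "p \<in> U" for p
  proof -
    have "pt \<theta> p \<in> TA" using that by (rule theta_pt)
    then have "primeideal (pt \<theta> p) A" by (simp add: A.topspace_zariski)
    then interpret primeideal "pt \<theta> p" A .
    show ?thesis by (rule a_subset)
  qed
  have "pt \<theta> (pt f P) = pt \<theta> (pt g P)"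
  proof (rule Set.set_eqI)
    fix a show "a \<in> pt \<theta> (pt f P) \<longleftrightarrow> a \<in> pt \<theta> (pt g P)"
    proof (cases "a \<in> carrier A")
      case True
      then show ?thesis by (rule eq)
    next
      case False
      have "a \<notin> pt \<theta> (pt f P)" using sub[OF fU[OF P]] False by (rule contra_subsetD)
      moreover have "a \<notin> pt \<theta> (pt g P)" using sub[OF gU[OF P]] False by (rule contra_subsetD)
      ultimately show ?thesis by simp
    qed
  qed
  then have "pt \<theta>' (pt \<theta> (pt f P)) = pt \<theta>' (pt \<theta> (pt g P))" by (rule arg_cong)
  then have "pt f P = pt g P" unfolding theta'_theta[OF fU[OF P]] theta'_theta[OF gU[OF P]] .
  then show "pt f P = pt g P \<and> pt f P \<in> U" using fU[OF P] by simp
next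
  fix c assume "c \<in> {G a |a. a \<in> carrier A}"
  then show "co f U c = co g U c" using co by blast
qed

end

section \<open>Evaluation at the rational point\<close>

context dual_poly
begin

lemma m0_eq: "m0 = {w \<in> carrier B. w \<one>\<^bsub>UP K\<^esub> \<in> {\<zero>}}"
  by (simp add: m0_def xpow_0)

lemma local_spec_dual: "local_spec B m0"
proof (intro local_spec.intro local_spec_axioms.intro D.cring_axioms)
  show "primeideal m0 B"
    unfolding m0_eq
    by (rule ring_hom_ring.primeideal_vimage[OF ring_hom_ringI2[OF D.ring_axioms ring_axioms ev_hom]
        D.cring_axioms zeroprimeideal])
  show "a \<in> Units B" if "a \<in> carrier B" "a \<notin> m0" for a
    using that dual_Units_iff by (simp add: m0_def)
qed

lemma derivation_dual: "derivation B \<delta>"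
  by (intro derivation.intro derivation_axioms.intro D.cring_axioms der_closed der_mult)

lemma spec_hom_ev: "spec_hom B K (\<lambda>w. w \<one>\<^bsub>UP K\<^esub>)"
  by (intro spec_hom.intro spec_hom_axioms.intro D.cring_axioms cring_axioms ev_hom)

lemma spec_hom_scalar: "spec_hom K B (\<lambda>c. c \<odot>\<^bsub>B\<^esub> \<one>\<^bsub>B\<^esub>)"
proof (intro spec_hom.intro spec_hom_axioms.intro D.cring_axioms cring_axioms)
  show "(\<lambda>c. c \<odot>\<^bsub>B\<^esub> \<one>\<^bsub>B\<^esub>) \<in> ring_hom K B"
  proof (rule ring_hom_memI)
    fix c d assume cd: "c \<in> carrier K" "d \<in> carrier K"
    show "c \<odot>\<^bsub>B\<^esub> \<one>\<^bsub>B\<^esub> \<in> carrier B" using cd dual_smult_closed dual_one_closed by blast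
    show "(c \<otimes> d) \<odot>\<^bsub>B\<^esub> \<one>\<^bsub>B\<^esub> = (c \<odot>\<^bsub>B\<^esub> \<one>\<^bsub>B\<^esub>) \<otimes>\<^bsub>B\<^esub> (d \<odot>\<^bsub>B\<^esub> \<one>\<^bsub>B\<^esub>)"
      using cd by (simp add: D.smult_assoc1 D.smult_assoc2)
    show "(c \<oplus> d) \<odot>\<^bsub>B\<^esub> \<one>\<^bsub>B\<^esub> = c \<odot>\<^bsub>B\<^esub> \<one>\<^bsub>B\<^esub> \<oplus>\<^bsub>B\<^esub> d \<odot>\<^bsub>B\<^esub> \<one>\<^bsub>B\<^esub>"
      using cd by (simp add: D.smult_l_distr)
  qed (simp add: D.smult_one)
qed

end

sublocale dual_poly \<subseteq> LB: local_spec "poly_dual K" m0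
  by (rule local_spec_dual)

sublocale dual_poly \<subseteq> LK: local_spec K "{\<zero>\<^bsub>K\<^esub>}"
  by (rule local_spec_field)

sublocale dual_poly \<subseteq> DB: derivation "poly_dual K" "dual_der K"
  by (rule derivation_dual)

lemma with_str_simps [simp]:
  "space_of (with_str Z \<pi>) = space_of Z" "sec (with_str Z \<pi>) = sec Z"
  "res (with_str Z \<pi>) = res Z" "str (with_str Z \<pi>) = \<pi>"
  by (simp_all add: with_str_def)

lemma preim_with_str [simp]: "preim (with_str Z \<pi>) f V = preim Z f V"
  by (simp add: preim_def)

lemma germ_with_str [simp]: "germ (with_str Z \<pi>) p U s = germ Z p U s"
  by (simp add: germ_def)

lemma stalk_with_str [simp]: "stalk (with_str Z \<pi>) p = stalk Z p"
  by (simp add: stalk_def)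

lemma stalk_map_with_str [simp]: "stalk_map (with_str Z \<pi>) f p = stalk_map Z f p"
  by (simp add: stalk_map_def fun_eq_iff)

lemma lrs_morphism_with_str [simp]:
  "lrs_morphism (with_str Z \<pi>) Y f = lrs_morphism Z Y f"
  "lrs_morphism Y (with_str Z \<pi>) g = lrs_morphism Y Z g"
  by (simp_all add: lrs_morphism_def)

lemma eq_map_with_str [simp]:
  "eq_map (with_str Z \<pi>) Y f g = eq_map Z Y f g"
  by (simp add: eq_map_def)

lemma comp_map_with_str [simp]: "comp_map (with_str Z \<pi>) g f = comp_map Z g f"
  by (simp add: comp_map_def)

locale flow = dual_poly K for K :: "'k ring" (structure) +
  fixes X :: "('a, 'b, 'k) space_over"
    and y :: "('k set, 'k set \<Rightarrow> ('k \<times> 'k) set, 'a, 'b) lrs_map"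
    and D :: "'a set \<Rightarrow> 'b \<Rightarrow> 'b"
  assumes X_over: "scheme_over K X"
    and y_rational: "rational_point K X y"
    and D_field: "vector_field K X D"

sublocale flow \<subseteq> X: presheaf X
  using X_over
  by (intro presheaf.intro sheaf_imp_presheaf)
    (simp add: scheme_over_def scheme_def locally_ringed_space_def)

context flow
begin

abbreviation TK where "TK \<equiv> topspace (zariski K)"

abbreviation TB where "TB \<equiv> topspace (zariski B)"

text \<open>\<open>{\<zero>}\<close> is the only point of \<open>spec K\<close>, so this is the
  topological point underlying \<open>y\<close>.\<close>

definition y0 :: 'a where "y0 = pt y {\<zero>}"

definition near :: "'a set \<Rightarrow> bool" where "near V \<longleftrightarrow> opn X V \<and> y0 \<in> V"

lemma near_open: "near V \<Longrightarrow> opn X V"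
  by (simp add: near_def)

lemma near_Int: "\<lbrakk>near V; near W\<rbrakk> \<Longrightarrow> near (V \<inter> W)"
  by (auto simp: near_def)

lemma TK_eq: "TK = {{\<zero>}}"
proof
  show "{{\<zero>}} \<subseteq> TK" using LK.m_in_pts by simp
  show "TK \<subseteq> {{\<zero>}}"
  proof
    fix Q assume "Q \<in> TK"
    then have Q: "primeideal Q K" by (simp add: topspace_zariski)
    interpret Q: primeideal Q K by (rule Q)
    have "Q \<subseteq> {\<zero>}" using LK.prime_subset_m[OF Q] .
    then show "Q \<in> {{\<zero>}}" using Q.zero_closed by blast
  qed
qed

lemma y_premorphism: "premorphism (spec K) X y" and y_reflects: "reflects (spec K) X y"
  using y_rational lrs_from_spec_iff[OF X.presheaf_axioms, of y]
  by (simp_all add: morphism_over_def base_scheme_def)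

lemma str_premorphism: "premorphism X (spec K) (str X)"
  using X_over by (intro lrs_imp_premorphism) (simp add: scheme_over_def)

lemma near_pts: "near (pts X)"
  using premorphism_pt[OF y_premorphism, of "{\<zero>}"] LK.m_in_pts by (simp add: near_def y0_def)

lemma preim_y: "near V \<Longrightarrow> preim (spec K) y V = TK"
  by (auto simp: near_def y0_def preim_def TK_eq)

abbreviation val :: "'a set \<Rightarrow> 'b \<Rightarrow> 'k" where "val \<equiv> value_at K y"

text \<open>A global section of \<open>spec K\<close> is the constant of exactly one scalar, so the
  description in \<open>value_at\<close> denotes that scalar.\<close>

lemma val_props:
  assumes V: "near V" and a: "a \<in> carrier (sec X V)"
  shows val_closed: "val V a \<in> carrier K" and co_y: "co y V a = spec_const K TK (val V a)"
proof -
  have "co y V a \<in> carrier (spec_sec K TK)"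
    using co_closed[OF y_premorphism near_open[OF V] a] by (simp add: preim_y[OF V])
  then obtain c where c: "c \<in> carrier K" "co y V a = spec_const K TK c"
    by (rule LK.spec_const_surj)
  have "val V a = c"
    unfolding value_at_def preim_y[OF V]
  proof (rule the_equality)
    fix c' assume c': "c' \<in> carrier K \<and> co y V a = spec_const K TK c'"
    then have "spec_const K TK c' = spec_const K TK c" using c(2) by (elim conjE) (rule trans[OF sym])
    then have "spec_const K TK c' {\<zero>} = spec_const K TK c {\<zero>}" by (rule fun_cong)
    then show "c' = c" by (rule LK.spec_const_inj[OF conjunct1[OF c'] c(1) LK.m_in_pts])
  qed (use c in simp)
  then show "val V a \<in> carrier K" "co y V a = spec_const K TK (val V a)" using c by simp_all
qed

lemma val_eqI:
  assumes "near V" "a \<in> carrier (sec X V)" "c \<in> carrier K" "co y V a = spec_const K TK c"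
  shows "val V a = c"
  using LK.spec_const_inj[of "val V a" c TK] val_props[OF assms(1,2)] assms(3,4) LK.m_in_pts by simp

lemma val_hom:
  assumes V: "near V"
  shows "val V \<in> ring_hom (sec X V) K"
proof -
  interpret S: cring "sec X V" by (rule X.cring_sec[OF near_open[OF V]])
  have h: "co y V \<in> ring_hom (sec X V) (spec_sec K TK)"
    using co_hom[OF y_premorphism near_open[OF V]] by (simp add: preim_y[OF V])
  have T: "openin (zariski K) TK" by simp
  show ?thesis
  proof (rule ring_hom_memI)
    fix a b assume ab: "a \<in> carrier (sec X V)" "b \<in> carrier (sec X V)"
    note p = val_props[OF V ab(1)] val_props[OF V ab(2)]
    show "val V a \<in> carrier K" by (rule p)
    show "val V (a \<otimes>\<^bsub>sec X V\<^esub> b) = val V a \<otimes> val V b"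
      using ring_hom_mult[OF h ab] spec_const_mult[OF T p(1,3)] p ab by (intro val_eqI[OF V]) simp_all
    show "val V (a \<oplus>\<^bsub>sec X V\<^esub> b) = val V a \<oplus> val V b"
      using ring_hom_add[OF h ab] spec_const_add[OF T p(1,3)] p ab by (intro val_eqI[OF V]) simp_all
  next
    show "val V \<one>\<^bsub>sec X V\<^esub> = \<one>"
      using ring_hom_one[OF h] spec_const_one[of TK] by (intro val_eqI[OF V]) simp_all
  qed
qed

lemma val_res:
  assumes V: "near V" and W: "near W" "W \<subseteq> V" and a: "a \<in> carrier (sec X V)"
  shows "val W (res X V W a) = val V a"
proof (rule val_eqI[OF W(1) X.res_closed[OF near_open[OF V] near_open[OF W(1)] W(2) a] val_closed[OF V a]])
  show "co y W (res X V W a) = spec_const K TK (val V a)"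
    using co_res[OF y_premorphism near_open[OF V] near_open[OF W(1)] W(2) a] co_y[OF V a]
    by (simp add: preim_y V W spec_const_def)
qed

lemma co_str_closed: "c \<in> carrier K \<Longrightarrow> co (str X) TK (spec_const K TK c) \<in> carrier (sec X (pts X))"
  using co_closed[OF str_premorphism, of TK "spec_const K TK c"] spec_const_closed[of TK c]
    preim_pts[OF str_premorphism] by simp

lemma scalar_closed: "\<lbrakk>opn X V; c \<in> carrier K\<rbrakk> \<Longrightarrow> scalar K X V c \<in> carrier (sec X V)"
  using X.res_closed[OF openin_topspace _ openin_subset co_str_closed] by (simp add: scalar_def)

lemma scalar_pts: "c \<in> carrier K \<Longrightarrow> scalar K X (pts X) c = co (str X) TK (spec_const K TK c)"
  using X.res_id[OF openin_topspace co_str_closed] by (simp add: scalar_def)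

lemma val_scalar:
  assumes V: "near V" and c: "c \<in> carrier K"
  shows "val V (scalar K X V c) = c"
proof -
  have VX: "V \<subseteq> pts X" using openin_subset near_open[OF V] by blast
  have sc: "scalar K X V c = res X (pts X) V (scalar K X (pts X) c)"
    by (simp add: scalar_pts[OF c]) (simp add: scalar_def)
  \<comment> \<open>That \<open>y\<close> is a morphism over \<open>K\<close> says that the
    structure morphism after \<open>y\<close> is the identity of \<open>spec K\<close>.\<close>
  have "\<forall>V. openin (zariski K) V \<longrightarrow>
      (\<forall>s\<in>carrier (spec_sec K V). co y (preim X (str X) V) (co (str X) V s) = s)"
    using y_rational
    by (simp add: morphism_over_def base_scheme_def eq_map_def comp_map_def id_map_def)
  then have "co y (preim X (str X) TK) (co (str X) TK (spec_const K TK c)) = spec_const K TK c"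
    using spec_const_closed[of TK c] c by simp
  then have "co y (pts X) (co (str X) TK (spec_const K TK c)) = spec_const K TK c"
    using preim_pts[OF str_premorphism] by simp
  then have "val (pts X) (scalar K X (pts X) c) = c"
    using scalar_closed[OF openin_topspace c] c by (intro val_eqI[OF near_pts]) (simp_all add: scalar_pts)
  then show ?thesis
    using val_res[OF near_pts V VX scalar_closed[OF openin_topspace c]] sc by simp
qed

section \<open>The field \<open>D\<close>, its iterates and the homomorphism
  \<open>phi\<close>\<close>

lemma D_closed: "\<lbrakk>opn X V; a \<in> carrier (sec X V)\<rbrakk> \<Longrightarrow> D V a \<in> carrier (sec X V)"
  using D_field unfolding vector_field_def by blast

lemma D_add: "\<lbrakk>opn X V; a \<in> carrier (sec X V); b \<in> carrier (sec X V)\<rbrakk>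
    \<Longrightarrow> D V (a \<oplus>\<^bsub>sec X V\<^esub> b) = D V a \<oplus>\<^bsub>sec X V\<^esub> D V b"
  using D_field unfolding vector_field_def by (elim conjE) simp

lemma D_mult: "\<lbrakk>opn X V; a \<in> carrier (sec X V); b \<in> carrier (sec X V)\<rbrakk>
    \<Longrightarrow> D V (a \<otimes>\<^bsub>sec X V\<^esub> b) = a \<otimes>\<^bsub>sec X V\<^esub> D V b \<oplus>\<^bsub>sec X V\<^esub> D V a \<otimes>\<^bsub>sec X V\<^esub> b"
  using D_field unfolding vector_field_def by (elim conjE) simp

lemma D_scalar_mult: "\<lbrakk>opn X V; c \<in> carrier K; a \<in> carrier (sec X V)\<rbrakk>
    \<Longrightarrow> D V (scalar K X V c \<otimes>\<^bsub>sec X V\<^esub> a) = scalar K X V c \<otimes>\<^bsub>sec X V\<^esub> D V a"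
  using D_field unfolding vector_field_def by (elim conjE) simp

lemma D_res: "\<lbrakk>opn X V; opn X W; W \<subseteq> V; a \<in> carrier (sec X V)\<rbrakk>
    \<Longrightarrow> D W (res X V W a) = res X V W (D V a)"
  using D_field unfolding vector_field_def by (elim conjE) simp

lemma derivation_D: "opn X V \<Longrightarrow> derivation (sec X V) (D V)"
proof (intro derivation.intro derivation_axioms.intro)
  assume V: "opn X V"
  show "cring (sec X V)" using V by (rule X.cring_sec)
  then interpret S: cring "sec X V" .
  show "D V a \<in> carrier (sec X V)" if "a \<in> carrier (sec X V)" for a using V that by (rule D_closed)
  show "D V (a \<otimes>\<^bsub>sec X V\<^esub> b) = D V a \<otimes>\<^bsub>sec X V\<^esub> b \<oplus>\<^bsub>sec X V\<^esub> a \<otimes>\<^bsub>sec X V\<^esub> D V b"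
    if "a \<in> carrier (sec X V)" "b \<in> carrier (sec X V)" for a b
    using that by (simp add: D_mult[OF V] D_closed[OF V] S.a_comm)
qed

lemma Dn_closed: "\<lbrakk>opn X V; a \<in> carrier (sec X V)\<rbrakk> \<Longrightarrow> (D V ^^ n) a \<in> carrier (sec X V)"
  by (induction n) (simp_all add: D_closed)

lemma Dn_res: "\<lbrakk>opn X V; opn X W; W \<subseteq> V; a \<in> carrier (sec X V)\<rbrakk>
    \<Longrightarrow> (D W ^^ n) (res X V W a) = res X V W ((D V ^^ n) a)"
  by (induction n) (simp_all add: D_res Dn_closed)

lemma Dn_Suc: "(D V ^^ Suc n) a = (D V ^^ n) (D V a)"
  by (simp add: funpow_swap1)

text \<open>The homomorphism \<open>a \<mapsto> (q \<mapsto> (q(D) a)(y))\<close>.\<close>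

definition phi :: "'a set \<Rightarrow> 'b \<Rightarrow> (nat \<Rightarrow> 'k) \<Rightarrow> 'k" where
  "phi V a = lin (\<lambda>n. val V ((D V ^^ n) a))"

lemma val_Dn_closed: "\<lbrakk>near V; a \<in> carrier (sec X V)\<rbrakk> \<Longrightarrow> val V ((D V ^^ n) a) \<in> carrier K"
  by (intro val_closed Dn_closed near_open)

lemma phi_closed: "\<lbrakk>near V; a \<in> carrier (sec X V)\<rbrakk> \<Longrightarrow> phi V a \<in> carrier B"
  unfolding phi_def by (intro lin_closed val_Dn_closed)

lemma phi_xpow: "\<lbrakk>near V; a \<in> carrier (sec X V)\<rbrakk> \<Longrightarrow> phi V a (xpow K n) = val V ((D V ^^ n) a)"
  unfolding phi_def by (intro lin_xpow val_Dn_closed)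

lemma phi_one_poly: "\<lbrakk>near V; a \<in> carrier (sec X V)\<rbrakk> \<Longrightarrow> phi V a \<one>\<^bsub>UP K\<^esub> = val V a"
  using phi_xpow[of V a 0] by (simp add: xpow_0)

lemma phi_D:
  assumes V: "near V" and a: "a \<in> carrier (sec X V)"
  shows "phi V (D V a) = \<delta> (phi V a)"
  using phi_closed[OF V] D_closed[OF near_open[OF V]] a
  by (intro dual_eqI der_closed) (simp_all add: der_xpow phi_xpow[OF V] Dn_Suc del: funpow.simps)

text \<open>Iterates of \<open>D\<close> and values at \<open>y\<close> commute with restriction, so
  \<open>phi\<close> depends on the germ at \<open>y0\<close> only.\<close>

lemma phi_res:
  assumes "near V" "near W" "W \<subseteq> V" "a \<in> carrier (sec X V)"
  shows "phi W (res X V W a) = phi V a"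
  unfolding phi_def using assms by (simp add: Dn_res near_open val_res Dn_closed)

text \<open>\<open>val V\<close> is a ring homomorphism that returns scalars unchanged, so it passes
  through the sum defining \<open>q(D) a\<close>. This ties \<open>phi\<close> to the formula in
  \<open>exp_on\<close>.\<close>

lemma phi_poly_of_field:
  assumes V: "near V" and a: "a \<in> carrier (sec X V)"
  shows "phi V a = (\<lambda>q\<in>carrier (UP K). val V (poly_of_field K X D V q a))"
proof -
  interpret S: cring "sec X V" by (rule X.cring_sec[OF near_open[OF V]])
  interpret h: ring_hom_ring "sec X V" K "val V"
    by (rule ring_hom_ringI2[OF S.ring_axioms ring_axioms val_hom[OF V]])
  have "val V (poly_of_field K X D V q a) = (\<Oplus>n\<in>{..deg K q}. coeff (UP K) q n \<otimes> val V ((D V ^^ n) a))"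
    if q: "q \<in> carrier (UP K)" for q
  proof -
    have c: "scalar K X V (coeff (UP K) q n) \<in> carrier (sec X V)" "(D V ^^ n) a \<in> carrier (sec X V)" for n
      using scalar_closed[OF near_open[OF V]] Dn_closed[OF near_open[OF V] a] q by simp_all
    have "val V (poly_of_field K X D V q a)
      = (\<Oplus>n\<in>{..deg K q}. val V (scalar K X V (coeff (UP K) q n) \<otimes>\<^bsub>sec X V\<^esub> (D V ^^ n) a))"
      unfolding poly_of_field_def using c by (subst h.hom_finsum) (auto simp: o_def Pi_def)
    also have "\<dots> = (\<Oplus>n\<in>{..deg K q}. coeff (UP K) q n \<otimes> val V ((D V ^^ n) a))"
      using c q val_scalar[OF V] by (intro finsum_cong') (auto simp: Pi_def)
    finally show ?thesis .
  qed
  then show ?thesis by (auto simp: phi_def lin_def fun_eq_iff)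
qed

text \<open>The higher Leibniz rule evaluated at \<open>y\<close>. Applying \<open>D\<close> once to
  a product differentiates either factor, which shifts one of the two sequences; this is the
  recursion \<open>conv_Suc\<close>.\<close>

lemma val_Dn_mult:
  assumes V: "near V"
  shows "\<lbrakk>a \<in> carrier (sec X V); b \<in> carrier (sec X V)\<rbrakk> \<Longrightarrow> val V ((D V ^^ n) (a \<otimes>\<^bsub>sec X V\<^esub> b))
    = conv (\<lambda>n. val V ((D V ^^ n) a)) (\<lambda>n. val V ((D V ^^ n) b)) n"
proof (induction n arbitrary: a b)
  case 0
  then show ?case
    using ring_hom_mult[OF val_hom[OF V]] val_closed[OF V] by (simp add: conv_0)
next
  case (Suc n)
  interpret S: cring "sec X V" by (rule X.cring_sec[OF near_open[OF V]])
  note c = Suc.prems D_closed[OF near_open[OF V] Suc.prems(1)] D_closed[OF near_open[OF V] Suc.prems(2)]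
  have Dn_add: "(D V ^^ n) (u \<oplus>\<^bsub>sec X V\<^esub> v) = (D V ^^ n) u \<oplus>\<^bsub>sec X V\<^esub> (D V ^^ n) v"
    if "u \<in> carrier (sec X V)" "v \<in> carrier (sec X V)" for u v
    using that by (induction n) (simp_all add: D_add Dn_closed near_open[OF V])
  have "val V ((D V ^^ Suc n) (a \<otimes>\<^bsub>sec X V\<^esub> b))
    = val V ((D V ^^ n) (a \<otimes>\<^bsub>sec X V\<^esub> D V b)) \<oplus> val V ((D V ^^ n) (D V a \<otimes>\<^bsub>sec X V\<^esub> b))"
    unfolding Dn_Suc D_mult[OF near_open[OF V] Suc.prems]
    using c Dn_closed[OF near_open[OF V]] ring_hom_add[OF val_hom[OF V]] by (simp add: Dn_add)
  also have "\<dots> = val V ((D V ^^ n) (D V a \<otimes>\<^bsub>sec X V\<^esub> b)) \<oplus> val V ((D V ^^ n) (a \<otimes>\<^bsub>sec X V\<^esub> D V b))"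
    using c by (intro a_comm val_Dn_closed[OF V]) simp_all
  also have "\<dots> = conv (\<lambda>n. val V ((D V ^^ Suc n) a)) (\<lambda>n. val V ((D V ^^ n) b)) n
     \<oplus> conv (\<lambda>n. val V ((D V ^^ n) a)) (\<lambda>n. val V ((D V ^^ Suc n) b)) n"
    unfolding Dn_Suc using Suc.IH c by simp
  also have "\<dots> = conv (\<lambda>n. val V ((D V ^^ n) a)) (\<lambda>n. val V ((D V ^^ n) b)) (Suc n)"
    using c by (intro conv_Suc[symmetric] val_Dn_closed[OF V])
  finally show ?case .
qed

lemma phi_hom:
  assumes V: "near V"
  shows "phi V \<in> ring_hom (sec X V) B"
proof (rule ring_hom_memI)
  interpret S: cring "sec X V" by (rule X.cring_sec[OF near_open[OF V]])
  note o = near_open[OF V]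
  fix a b assume ab: "a \<in> carrier (sec X V)" "b \<in> carrier (sec X V)"
  show "phi V a \<in> carrier B" by (rule phi_closed[OF V ab(1)])
  show "phi V (a \<otimes>\<^bsub>sec X V\<^esub> b) = phi V a \<otimes>\<^bsub>B\<^esub> phi V b"
    using ab phi_closed[OF V] val_Dn_mult[OF V ab]
    by (intro dual_eqI dual_mult_closed) (simp_all add: dual_mult_xpow phi_xpow[OF V])
  have Dn_add: "(D V ^^ n) (a \<oplus>\<^bsub>sec X V\<^esub> b) = (D V ^^ n) a \<oplus>\<^bsub>sec X V\<^esub> (D V ^^ n) b" for n
    using ab by (induction n) (simp_all add: D_add Dn_closed o)
  show "phi V (a \<oplus>\<^bsub>sec X V\<^esub> b) = phi V a \<oplus>\<^bsub>B\<^esub> phi V b"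
    using ab phi_closed[OF V] Dn_closed[OF o]
    by (intro dual_eqI dual_add_closed)
      (simp_all add: dual_add_apply phi_xpow[OF V] Dn_add ring_hom_add[OF val_hom[OF V]])
next
  interpret S: cring "sec X V" by (rule X.cring_sec[OF near_open[OF V]])
  interpret DV: derivation "sec X V" "D V" by (rule derivation_D[OF near_open[OF V]])
  interpret h: ring_hom_cring "sec X V" K "val V"
    by (intro ring_hom_cring.intro ring_hom_cring_axioms.intro S.cring_axioms cring_axioms val_hom[OF V])
  have D0: "D V \<zero>\<^bsub>sec X V\<^esub> = \<zero>\<^bsub>sec X V\<^esub>"
    using DV.d_mult[of "\<zero>\<^bsub>sec X V\<^esub>" "\<zero>\<^bsub>sec X V\<^esub>"] DV.d_closed[of "\<zero>\<^bsub>sec X V\<^esub>"] by simp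
  have Dn: "(D V ^^ n) \<one>\<^bsub>sec X V\<^esub> = (if n = 0 then \<one>\<^bsub>sec X V\<^esub> else \<zero>\<^bsub>sec X V\<^esub>)" for n
    by (induction n) (simp_all add: DV.d_one D0)
  show "phi V \<one>\<^bsub>sec X V\<^esub> = \<one>\<^bsub>B\<^esub>"
    using phi_closed[OF V S.one_closed]
    by (intro dual_eqI dual_one_closed) (simp_all add: phi_xpow[OF V] dual_one_xpow Dn)
qed

text \<open>\<open>D\<close> kills scalars, as \<open>D(c 1) = c D(1)\<close> and
  \<open>D(1)\<close> vanishes; so only the value at \<open>x\<^sup>0\<close> survives. This yields
  compatibility of the curve with the structure morphisms.\<close>

lemma phi_scalar:
  assumes V: "near V" and c: "c \<in> carrier K"
  shows "phi V (scalar K X V c) = c \<odot>\<^bsub>B\<^esub> \<one>\<^bsub>B\<^esub>"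
proof -
  interpret S: cring "sec X V" by (rule X.cring_sec[OF near_open[OF V]])
  interpret DV: derivation "sec X V" "D V" by (rule derivation_D[OF near_open[OF V]])
  interpret h: ring_hom_cring "sec X V" K "val V"
    by (intro ring_hom_cring.intro ring_hom_cring_axioms.intro S.cring_axioms cring_axioms val_hom[OF V])
  have sc: "scalar K X V c \<in> carrier (sec X V)" by (rule scalar_closed[OF near_open[OF V] c])
  have D1: "D V (scalar K X V c) = \<zero>\<^bsub>sec X V\<^esub>"
    using D_scalar_mult[OF near_open[OF V] c S.one_closed] sc by (simp add: DV.d_one)
  have D0: "D V \<zero>\<^bsub>sec X V\<^esub> = \<zero>\<^bsub>sec X V\<^esub>"
    using DV.d_mult[of "\<zero>\<^bsub>sec X V\<^esub>" "\<zero>\<^bsub>sec X V\<^esub>"] DV.d_closed[of "\<zero>\<^bsub>sec X V\<^esub>"] by simp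
  have Dn: "(D V ^^ n) (scalar K X V c) = (if n = 0 then scalar K X V c else \<zero>\<^bsub>sec X V\<^esub>)" for n
    by (induction n) (simp_all add: D1 D0)
  show ?thesis
    using phi_closed[OF V sc] val_scalar[OF V c] c
    by (intro dual_eqI dual_smult_closed dual_one_closed)
      (simp_all add: phi_xpow[OF V sc] dual_smult_apply dual_one_xpow Dn)
qed

end

section \<open>The analytic integral curve\<close>

lemma eq_map_sym: "eq_map X Y f g \<Longrightarrow> eq_map X Y g f"
  by (simp add: eq_map_def)

lemma eq_map_trans: "\<lbrakk>eq_map X Y f g; eq_map X Y g h\<rbrakk> \<Longrightarrow> eq_map X Y f h"
  by (simp add: eq_map_def)

lemma preim_eq_map: "eq_map X Y f g \<Longrightarrow> preim X f V = preim X g V"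
  by (auto simp: eq_map_def preim_def)

lemma co_eq_map: "\<lbrakk>eq_map X Y f g; opn Y V; s \<in> carrier (sec Y V)\<rbrakk> \<Longrightarrow> co f V s = co g V s"
  by (simp add: eq_map_def)

text \<open>\<open>eq_map\<close> compares values at points, open sets and sections only, so
  properties have to be carried over explicitly. This matters because \<open>exp_curve\<close> is
  determined only up to \<open>eq_map\<close>.\<close>

lemma premorphism_eq_map:
  assumes Y: "presheaf Y" and f: "premorphism X Y f" and fg: "eq_map X Y f g"
  shows "premorphism X Y g"
  unfolding premorphism_def
proof (intro conjI allI impI ballI)
  interpret Y: presheaf Y by (rule Y)
  note pre = preim_eq_map[OF fg, symmetric]
  show "continuous_map (space_of X) (space_of Y) (pt g)"
    by (rule continuous_map_eq[of _ _ "pt f"]) (use f fg in \<open>auto simp: premorphism_def eq_map_def\<close>)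
  fix V assume V: "opn Y V"
  interpret S: cring "sec Y V" by (rule Y.cring_sec[OF V])
  show "co g V \<in> ring_hom (sec Y V) (sec X (preim X g V))"
    using ring_hom_closed[OF co_hom[OF f V]] ring_hom_mult[OF co_hom[OF f V]]
      ring_hom_add[OF co_hom[OF f V]] ring_hom_one[OF co_hom[OF f V]]
    by (intro ring_hom_memI) (simp_all add: pre co_eq_map[OF fg V, symmetric])
next
  interpret Y: presheaf Y by (rule Y)
  fix V W s assume h: "opn Y V \<and> opn Y W \<and> W \<subseteq> V" "s \<in> carrier (sec Y V)"
  then show "co g W (res Y V W s) = res X (preim X g V) (preim X g W) (co g V s)"
    using co_res[OF f, of V W s] Y.res_closed[of V W s]
    by (simp add: co_eq_map[OF fg, symmetric] preim_eq_map[OF fg, symmetric])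
qed

lemma reflects_eq_map:
  assumes f: "reflects X Y f" and fg: "eq_map X Y f g"
  shows "reflects X Y g"
  unfolding reflects_def
proof (intro allI impI, elim conjE)
  fix V t p
  assume h: "opn Y V" "t \<in> carrier (sec Y V)" "p \<in> preim X g V" "inv_at X p (preim X g V) (co g V t)"
  then have "inv_at Y (pt f p) V t"
    using f unfolding reflects_def preim_eq_map[OF fg, symmetric] co_eq_map[OF fg h(1,2), symmetric]
    by blast
  moreover have "pt f p = pt g p" using fg h(3) by (simp add: eq_map_def mem_preim)
  ultimately show "inv_at Y (pt g p) V t" by simp
qed

context flow
begin

text \<open>
  The property on functions that \<open>integral_curve\<close> expresses by tangent vectors:
  \<open>f\<^sup>*\<close> intertwines \<open>D\<close> and \<open>\<delta>\<close>.
\<close>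

definition der_curve where
  "der_curve f \<longleftrightarrow> premorphism (spec B) X f \<and> reflects (spec B) X f \<and>
     eq_map (spec B) (spec K) (comp_map X (str X) f) (spec_map K B (\<lambda>c. c \<odot>\<^bsub>B\<^esub> \<one>\<^bsub>B\<^esub>)) \<and>
     eq_map (spec K) X (comp_map (spec B) f (origin K)) y \<and>
     (\<forall>V \<tau>. opn X V \<and> \<tau> \<in> carrier (sec X V) \<longrightarrow>
        invariant_field K (preim (spec B) f V) (co f V \<tau>) = co f V (D V \<tau>))"

lemma origin_spec: "premorphism (spec K) (spec B) (origin K)" "reflects (spec K) (spec B) (origin K)"
  using spec_hom.premorphism_spec_map[OF spec_hom_ev] spec_hom.reflects_spec_map[OF spec_hom_ev]
  by (simp_all add: origin_def)

lemma pt_origin: "pt (origin K) {\<zero>} = m0"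
  by (simp add: origin_def spec_map_def m0_eq)

text \<open>Consequently \<open>f\<close> pulls sections over \<open>V\<close> back to global
  sections of \<open>spec B\<close>, that is to elements of \<open>B\<close>.\<close>

lemma preim_near:
  assumes f: "premorphism (spec B) X f" and f0: "pt f m0 = y0" and V: "near V"
  shows "preim (spec B) f V = TB"
proof (rule LB.open_m)
  show "openin (zariski B) (preim (spec B) f V)" using preim_open[OF f near_open[OF V]] by simp
  show "m0 \<in> preim (spec B) f V" using V f0 LB.m_in_pts by (simp add: mem_preim near_def)
qed

lemma pt_m0: "eq_map (spec K) X (comp_map (spec B) f (origin K)) y \<Longrightarrow> pt f m0 = y0"
  using LK.m_in_pts by (simp add: eq_map_def comp_map_def pt_origin[symmetric] y0_def)

lemma der_curveD:
  assumes "der_curve f"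
  shows "premorphism (spec B) X f" "reflects (spec B) X f"
    "eq_map (spec B) (spec K) (comp_map X (str X) f) (spec_map K B (\<lambda>c. c \<odot>\<^bsub>B\<^esub> \<one>\<^bsub>B\<^esub>))"
    "eq_map (spec K) X (comp_map (spec B) f (origin K)) y"
    "\<And>V \<tau>. \<lbrakk>opn X V; \<tau> \<in> carrier (sec X V)\<rbrakk> \<Longrightarrow>
      invariant_field K (preim (spec B) f V) (co f V \<tau>) = co f V (D V \<tau>)"
  using assms unfolding der_curve_def by blast+

lemma der_curve_eq_map:
  assumes f: "der_curve f" and fg: "eq_map (spec B) X f g"
  shows "der_curve g"
proof -
  note pf = der_curveD(1)[OF f] and rf = der_curveD(2)[OF f] and strf = der_curveD(3)[OF f]
    and orf = der_curveD(4)[OF f] and df = der_curveD(5)[OF f]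
  have "eq_map (spec B) (spec K) (comp_map X (str X) g) (comp_map X (str X) f)"
    using fg co_closed[OF str_premorphism] preim_open[OF str_premorphism]
    by (simp add: eq_map_def comp_map_def)
  then have 1: "eq_map (spec B) (spec K) (comp_map X (str X) g) (spec_map K B (\<lambda>c. c \<odot>\<^bsub>B\<^esub> \<one>\<^bsub>B\<^esub>))"
    using strf by (rule eq_map_trans)
  have "eq_map (spec K) X (comp_map (spec B) g (origin K)) (comp_map (spec B) f (origin K))"
    using fg premorphism_pt[OF origin_spec(1)] preim_eq_map[OF fg]
    by (simp add: eq_map_def comp_map_def)
  then have 2: "eq_map (spec K) X (comp_map (spec B) g (origin K)) y"
    using orf by (rule eq_map_trans)
  have 3: "invariant_field K (preim (spec B) g V) (co g V \<tau>) = co g V (D V \<tau>)"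
    if "opn X V" "\<tau> \<in> carrier (sec X V)" for V \<tau>
    using df[OF that] co_eq_map[OF fg that] co_eq_map[OF fg that(1) D_closed[OF that]]
      preim_eq_map[OF fg, of V] by simp
  show ?thesis
    unfolding der_curve_def
    using premorphism_eq_map[OF X.presheaf_axioms pf fg] reflects_eq_map[OF rf fg] 1 2 3 by blast
qed

lemma dual_space_eq: "dual_space K = with_str (spec B) (spec_map K B (\<lambda>c. c \<odot>\<^bsub>B\<^esub> \<one>\<^bsub>B\<^esub>))"
  by (simp add: spec_over_def)

text \<open>A tangent vector acts by \<open>a \<mapsto> \<mu>(a) + \<epsilon> \<mu>(D a)\<close>;
  once \<open>f\<close> intertwines the two fields, composing with \<open>f\<close> before or after
  gives the same pullback by \<open>\<mu>\<close>. The argument is uniform in \<open>S\<close>, so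
  it holds at every element type.\<close>

lemma der_curve_imp_integral_curve:
  assumes f: "der_curve f"
  shows "integral_curve TYPE('s) K X D y f"
  unfolding integral_curve_def
proof (intro conjI allI impI)
  note pf = der_curveD(1)[OF f] and rf = der_curveD(2)[OF f] and strf = der_curveD(3)[OF f]
    and orf = der_curveD(4)[OF f] and df = der_curveD(5)[OF f]
  show "morphism_over K (dual_space K) X f"
    using D.lrs_from_spec_iff[OF X.presheaf_axioms] pf rf strf
    by (simp add: morphism_over_def dual_space_eq)
  show "eq_map (base_scheme K) X (comp_map (dual_space K) f (origin K)) y"
    using orf by (simp add: base_scheme_def dual_space_eq)
  fix S :: "('k, 's) module" and \<mu>
  assume "algebra K S \<and> morphism_over K (spec_over K S) (dual_space K) \<mu>"
  then have "lrs_morphism (spec S) (spec B) \<mu>"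
    by (simp add: morphism_over_def spec_over_def)
  then have \<mu>: "premorphism (spec S) (spec B) \<mu>" by (rule lrs_imp_premorphism)
  show "eq_map (spec_over K (dual_numbers S)) X
      (comp_map (dual_space K) f (tangent_at S (invariant_field K) \<mu>))
      (tangent_at S D (comp_map (dual_space K) f \<mu>))"
    using df preim_comp_map[OF \<mu>, of f]
    by (simp add: eq_map_def dual_space_eq spec_over_def comp_map_def tangent_at_def Let_def)
qed

text \<open>\<open>der\<close> is assumed on the single \<open>V\<close>, which is the form in which
  the tangent condition delivers it for an arbitrary curve. The induction runs over all sections at
  once: the value for \<open>t\<close> at the monomial of degree \<open>Suc n\<close> is that for
  \<open>D V t\<close> in degree \<open>n\<close>.\<close>

lemma der_on_near:
  assumes f: "premorphism (spec B) X f" and f0: "eq_map (spec K) X (comp_map (spec B) f (origin K)) y"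
    and V: "near V"
    and der: "\<And>\<tau>. \<tau> \<in> carrier (sec X V) \<Longrightarrow> invariant_field K TB (co f V \<tau>) = co f V (D V \<tau>)"
    and \<tau>: "\<tau> \<in> carrier (sec X V)"
  shows "co f V \<tau> = spec_const B TB (phi V \<tau>)"
proof -
  have pre: "preim (spec B) f V = TB" by (rule preim_near[OF f pt_m0[OF f0] V])
  have T: "openin (zariski B) TB" by simp
  have ex: "\<exists>b. b \<in> carrier B \<and> co f V t = spec_const B TB b" if "t \<in> carrier (sec X V)" for t
  proof -
    have "co f V t \<in> carrier (spec_sec B TB)"
      using co_closed[OF f near_open[OF V] that] by (simp add: pre)
    then show ?thesis by (rule LB.spec_const_surj) blast
  qed
  \<comment> \<open>The element of \<open>B\<close> representing the pullback of \<open>t\<close>;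
    it exists and is unique because global sections over a local spectrum are constants.\<close>
  define \<beta> where "\<beta> t = (SOME b. b \<in> carrier B \<and> co f V t = spec_const B TB b)" for t
  have \<beta>: "\<beta> t \<in> carrier B" "co f V t = spec_const B TB (\<beta> t)" if "t \<in> carrier (sec X V)" for t
    using someI_ex[OF ex[OF that]] unfolding \<beta>_def by auto
  have const_inj: "b = b'" if "b \<in> carrier B" "b' \<in> carrier B" "spec_const B TB b = spec_const B TB b'" for b b'
    using LB.spec_const_inj[OF that(1,2) LB.m_in_pts] that(3) by simp
  have \<beta>D: "\<delta> (\<beta> t) = \<beta> (D V t)" if t: "t \<in> carrier (sec X V)" for t
  proof (rule const_inj[OF der_closed[OF \<beta>(1)[OF t]]])
    have Dt: "D V t \<in> carrier (sec X V)" by (rule D_closed[OF near_open[OF V] t])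
    show "\<beta> (D V t) \<in> carrier B" by (rule \<beta>(1)[OF Dt])
    show "spec_const B TB (\<delta> (\<beta> t)) = spec_const B TB (\<beta> (D V t))"
      using der[OF t] \<beta>(2)[OF t] \<beta>(2)[OF Dt] DB.spec_vector_field_const[OF T \<beta>(1)[OF t]]
      by (simp add: invariant_field_def)
  qed
  have \<beta>0: "\<beta> t (xpow K 0) = val V t" if t: "t \<in> carrier (sec X V)" for t
  proof -
    have "co (origin K) TB (co f V t) = co y V t"
      using co_eq_map[OF f0 near_open[OF V] t] pre by (simp add: comp_map_def)
    moreover have "co (origin K) TB (spec_const B TB (\<beta> t)) = spec_const K TK (\<beta> t \<one>\<^bsub>UP K\<^esub>)"
      using spec_hom.co_spec_const[OF spec_hom_ev T \<beta>(1)[OF t]] preim_pts[OF origin_spec(1)]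
      by (simp add: origin_def)
    ultimately have "co y V t = spec_const K TK (\<beta> t (xpow K 0))"
      using \<beta>(2)[OF t] by (simp add: xpow_0)
    then show ?thesis
      using val_eqI[OF V t, of "\<beta> t (xpow K 0)"] dual_closed[OF \<beta>(1)[OF t]] by simp
  qed
  have "\<beta> t (xpow K n) = val V ((D V ^^ n) t)" if "t \<in> carrier (sec X V)" for t n
    using that
  proof (induction n arbitrary: t)
    case 0
    then show ?case by (simp add: \<beta>0)
  next
    case (Suc n)
    have "\<beta> t (xpow K (Suc n)) = \<beta> (D V t) (xpow K n)"
      using der_xpow[OF \<beta>(1)[OF Suc.prems]] \<beta>D[OF Suc.prems] by simp
    then show ?case
      using Suc.IH[OF D_closed[OF near_open[OF V] Suc.prems]] unfolding Dn_Suc by simp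
  qed
  then have "\<beta> \<tau> = phi V \<tau>"
    using \<beta>(1)[OF \<tau>] phi_closed[OF V \<tau>] \<tau> by (intro dual_eqI) (simp_all add: phi_xpow[OF V])
  then show ?thesis using \<beta>(2)[OF \<tau>] by simp
qed

end

locale flow_chart = flow K X y D + chart X U A \<theta> \<theta>'
  for K :: "'k ring" (structure) and X :: "('a, 'b, 'k) space_over" and y D U
    and A :: "'r ring" and \<theta> \<theta>' +
  assumes y0_in: "y0 \<in> U"
begin

lemma near_U: "near U"
  using U_open y0_in by (simp add: near_def)

abbreviation \<Phi> where "\<Phi> a \<equiv> phi U (G a)"

abbreviation e where "e \<equiv> exp_on K X D y U A \<theta> \<theta>'"

lemma spec_hom_Phi: "spec_hom A B \<Phi>"
proof (intro spec_hom.intro spec_hom_axioms.intro A.cring_axioms D.cring_axioms)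
  show "\<Phi> \<in> ring_hom A B"
    using ring_hom_trans[OF G_hom phi_hom[OF near_U]] by (simp add: comp_def)
qed

sublocale S: spec_hom A "poly_dual K" \<Phi>
  by (rule spec_hom_Phi)

abbreviation \<sigma> where "\<sigma> \<equiv> spec_map A B \<Phi>"

text \<open>The formula in \<open>exp_on\<close> agrees with \<open>\<Phi>\<close> on the carrier of
  \<open>A\<close> only. The induced maps still agree up to \<open>eq_map\<close>, because the
  numerators and denominators to which they are applied come from fractions and lie in the
  carrier.\<close>

lemma e_eq: "eq_map (spec B) X e (comp_map X0 (incl_map X U) (comp_map (spec A) \<theta>' \<sigma>))"
proof -
  let ?\<psi> = "\<lambda>a. \<lambda>q\<in>carrier (UP K). value_at K y U (poly_of_field K X D U q (co \<theta> TA (spec_const A TA a)))"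
  have \<psi>: "?\<psi> a = \<Phi> a" if "a \<in> carrier A" for a
    using phi_poly_of_field[OF near_U G_closed[OF that]] by (simp add: G_def)
  have pt_eq: "pt (spec_map A B ?\<psi>) P = pt \<sigma> P" for P
    using \<psi> by (auto simp: spec_map_def)
  have co_eq: "co (spec_map A B ?\<psi>) V s = co \<sigma> V s"
    if V: "openin (zariski A) V" and s: "s \<in> carrier (spec_sec A V)" for V s
  proof -
    have contr: "{a \<in> carrier A. ?\<psi> a \<in> P} = {a \<in> carrier A. \<Phi> a \<in> P}" for P
      using \<psi> by auto
    have un: "(\<Union>(a, t)\<in>s Q. fraction_at B P (?\<psi> a) (?\<psi> t)) = (\<Union>(a, t)\<in>s Q. fraction_at B P (\<Phi> a) (\<Phi> t))"
      if Q: "Q \<in> V" for P Q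
    proof (rule SUP_cong[OF refl])
      fix x assume x: "x \<in> s Q"
      obtain b t where bt: "b \<in> carrier A" "t \<in> carrier A" "t \<notin> Q" "s Q = fraction_at A Q b t"
        by (rule A.spec_sec_fraction_at[OF V s Q])
      obtain a c where ac: "x = (a, c)" by (cases x)
      have "a \<in> carrier A" "c \<in> carrier A"
        using A.fraction_memD_at[OF A.zariski_prime[OF V Q] bt(1-3), of a c] x bt(4) ac by simp_all
      then show "(case x of (a, t) \<Rightarrow> fraction_at B P (?\<psi> a) (?\<psi> t))
        = (case x of (a, t) \<Rightarrow> fraction_at B P (\<Phi> a) (\<Phi> t))"
        using \<psi> ac by simp
    qed
    show ?thesis
      unfolding spec_map_def contr by (auto simp: fun_eq_iff un)
  qed
  show ?thesis
    unfolding eq_map_def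
  proof (intro conjI ballI allI impI)
    fix V s assume V: "opn X V" and s: "s \<in> carrier (sec X V)"
    have o: "opn X (U \<inter> V)" using U_open V by blast
    then have oX0: "opn X0 (U \<inter> V)" using opn_X0 by auto
    have i: "preim X0 (incl_map X U) V = U \<inter> V" by (rule preim_incl_map[OF V])
    have c: "res X V (U \<inter> V) s \<in> carrier (sec X0 (U \<inter> V))" using X.res_closed[OF V o Int_lower2 s] by simp
    note c' = co_closed[OF theta' oX0 c]
    have ci: "co (incl_map X U) V s = res X V (U \<inter> V) s" by (simp add: incl_map_def)
    show "co e V s = co (comp_map X0 (incl_map X U) (comp_map (spec A) \<theta>' \<sigma>)) V s"
      using co_eq[of "preim (spec A) \<theta>' (U \<inter> V)" "co \<theta>' (U \<inter> V) (res X V (U \<inter> V) s)"]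
        preim_open[OF theta' oX0] c'
      by (simp add: exp_on_def comp_map_def i ci)
  qed (simp add: exp_on_def comp_map_def pt_eq)
qed

end

section \<open>The curve in a chart: origin, intertwining, structure morphism, uniqueness\<close>

context flow_chart
begin

text \<open>Each of the three arrows of the composite is a premorphism that reflects units, and
  \<open>e_eq\<close> carries this over to \<open>e\<close>.\<close>

lemma e_props:
  shows e_premorphism: "premorphism (spec B) X e" and e_reflects: "reflects (spec B) X e"
proof -
  note p = S.premorphism_spec_map theta' premorphism_incl_map[OF X.presheaf_axioms U_open]
  note p2 = premorphism_comp[OF p(1,2)]
  note p3 = premorphism_comp[OF p2 p(3)]
  have r: "reflects (spec B) X (comp_map X0 (incl_map X U) (comp_map (spec A) \<theta>' \<sigma>))"
    by (intro reflects_comp[OF p2 p(3)] reflects_comp[OF p(1,2)] S.reflects_spec_map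
        reflects_theta' reflects_incl_map[OF X.presheaf_axioms U_open])
  show "premorphism (spec B) X e"
    by (rule premorphism_eq_map[OF X.presheaf_axioms p3 eq_map_sym[OF e_eq]])
  show "reflects (spec B) X e" by (rule reflects_eq_map[OF r eq_map_sym[OF e_eq]])
qed

lemma e_in_U:
  assumes P: "P \<in> TB"
  shows "pt e P \<in> U"
proof -
  have "pt (comp_map (spec A) \<theta>' \<sigma>) P \<in> pts X0"
    using premorphism_pt[OF premorphism_comp[OF S.premorphism_spec_map theta']] P by simp
  then show ?thesis
    unfolding pts_X0 using e_eq P by (simp add: eq_map_def comp_map_def incl_map_def)
qed

lemma preim_e_U: "preim (spec B) e U = TB"
  using e_in_U by (auto simp: mem_preim)

lemma co_e_G:
  assumes a: "a \<in> carrier A"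
  shows "co e U (G a) = spec_const B TB (\<Phi> a)"
proof -
  have i: "preim X0 (incl_map X U) U = U" using preim_incl_map[OF U_open] by simp
  have ci: "co (incl_map X U) U (G a) = G a"
    using X.res_id[OF U_open G_closed[OF a]] by (simp add: incl_map_def)
  have "co \<sigma> TA (spec_const A TA a) = spec_const B TB (\<Phi> a)"
    using S.co_spec_const[of TA a] a preim_pts[OF S.premorphism_spec_map] by simp
  then show ?thesis
    using co_eq_map[OF e_eq U_open G_closed[OF a]] co_theta'_G[OF a]
    by (simp add: comp_map_def i ci preim_theta'_U)
qed

text \<open>Both maps go from \<open>spec K\<close> into the chart, so the functions
  \<open>G a\<close> decide; there the composite gives \<open>\<Phi> a\<close> evaluated at
  \<open>1\<close>, the term of order zero, which is the value of \<open>G a\<close> at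
  \<open>y\<close>.\<close>

lemma e_origin: "eq_map (spec K) X (comp_map (spec B) e (origin K)) y"
proof (rule eq_map_from_spec[OF cring_axioms])
  show "premorphism (spec K) X (comp_map (spec B) e (origin K))"
    by (rule premorphism_comp[OF origin_spec(1) e_premorphism])
  show "reflects (spec K) X (comp_map (spec B) e (origin K))"
    by (rule reflects_comp[OF origin_spec(1) e_premorphism origin_spec(2) e_reflects])
  show "premorphism (spec K) X y" "reflects (spec K) X y" by (rule y_premorphism y_reflects)+
  show "pt (comp_map (spec B) e (origin K)) P \<in> U" if "P \<in> pts (spec K)" for P
    using premorphism_pt[OF origin_spec(1) that] e_in_U by (simp add: comp_map_def)
  show "pt y P \<in> U" if "P \<in> pts (spec K)" for P
    using that y0_in by (simp add: TK_eq y0_def)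
  fix a assume a: "a \<in> carrier A"
  have "co (comp_map (spec B) e (origin K)) U (G a) = co (origin K) TB (spec_const B TB (\<Phi> a))"
    using co_e_G[OF a] by (simp add: comp_map_def preim_e_U)
  also have "\<dots> = spec_const K TK (\<Phi> a \<one>\<^bsub>UP K\<^esub>)"
    using spec_hom.co_spec_const[OF spec_hom_ev, of TB "\<Phi> a"] phi_closed[OF near_U G_closed[OF a]]
      preim_pts[OF origin_spec(1)] by (simp add: origin_def)
  also have "\<dots> = co y U (G a)"
    using phi_one_poly[OF near_U G_closed[OF a]] co_y[OF near_U G_closed[OF a]] by simp
  finally show "co (comp_map (spec B) e (origin K)) U (G a) = co y U (G a)" .
qed

lemma e_m0: "pt e m0 = y0"
  by (rule pt_m0[OF e_origin])

lemma preim_e_near: "near V \<Longrightarrow> preim (spec B) e V = TB"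
  by (rule preim_near[OF e_premorphism e_m0])

lemma restrict_TB: "s \<in> carrier (spec_sec B TB) \<Longrightarrow> restrict s TB = s"
  using D.spec_sec_ext by (rule extensional_restrict)

text \<open>
  A section near \<open>y\<close> is a fraction \<open>a/s\<close> of functions on the chart in a neighbourhood of \<open>y\<close>, and
  the preimage of every such neighbourhood is the whole spectrum of the local ring \<open>K[x]\<^sup>*\<close>.
\<close>

lemma co_e_near:
  assumes V: "near V" and \<tau>: "\<tau> \<in> carrier (sec X V)"
  shows "co e V \<tau> = spec_const B TB (phi V \<tau>)"
proof -
  have VU: "near (V \<inter> U)" by (rule near_Int[OF V near_U])
  have y0VU: "y0 \<in> V \<inter> U" using VU by (simp add: near_def)
  obtain s a W where h: "s \<in> {G a |a. a \<in> carrier A}" "a \<in> {G a |a. a \<in> carrier A}"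
    "s \<in> carrier (sec X U)" "a \<in> carrier (sec X U)"
    "opn X W" "y0 \<in> W" "W \<subseteq> V \<inter> U" "res X U W s \<in> Units (sec X W)"
    "res X U W s \<otimes>\<^bsub>sec X W\<^esub> res X (V \<inter> U) W (res X V (V \<inter> U) \<tau>) = res X U W a"
    by (rule locally_fractionsE[OF locally_fractions_G near_open[OF VU] Int_lower2
          X.res_closed[OF near_open[OF V] near_open[OF VU] Int_lower1 \<tau>] y0VU])
  have W: "near W" "W \<subseteq> V" "W \<subseteq> U" using h by (auto simp: near_def)
  let ?s = "res X U W s" and ?t = "res X V W \<tau>"
  have c: "?s \<in> carrier (sec X W)" "?t \<in> carrier (sec X W)"
    using X.res_closed U_open near_open[OF V] h W \<tau> by auto
  have eq: "?s \<otimes>\<^bsub>sec X W\<^esub> ?t = res X U W a"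
    using h(9) X.res_res[OF near_open[OF V] near_open[OF VU] h(5) h(7) Int_lower1 \<tau>] by simp
  have coG: "co e W (res X U W g) = spec_const B TB (phi U g)"
    if g: "g \<in> {G a |a. a \<in> carrier A}" for g
  proof -
    obtain b where b: "b \<in> carrier A" "g = G b" using g by blast
    show ?thesis
      using co_res[OF e_premorphism U_open h(5) W(3) G_closed[OF b(1)]] co_e_G[OF b(1)]
        D.spec_const_closed[of TB "\<Phi> b"] phi_closed[OF near_U G_closed[OF b(1)]]
      by (simp add: preim_e_near W near_U b(2) restrict_TB)
  qed
  have hom: "co e W \<in> ring_hom (sec X W) (spec_sec B TB)"
    using co_hom[OF e_premorphism h(5)] by (simp add: preim_e_near[OF W(1)])
  have T: "openin (zariski B) TB" by simp
  interpret SB: cring "spec_sec B TB" by (rule D.cring_spec_sec[OF T])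
  have phi_c: "phi U s \<in> carrier B" "phi U a \<in> carrier B" "phi V \<tau> \<in> carrier B"
    using phi_closed near_U V h \<tau> by blast+
  \<comment> \<open>The relation \<open>s \<tau> = a\<close> holds on \<open>W\<close>;
    \<open>phi_res\<close> allows applying \<open>phi\<close> there and reading the result on
    \<open>U\<close> and \<open>V\<close>.\<close>
  have "phi U s \<otimes>\<^bsub>B\<^esub> phi V \<tau> = phi U a"
    using ring_hom_mult[OF phi_hom[OF W(1)] c] eq phi_res[OF near_U W(1,3) h(3)]
      phi_res[OF near_U W(1,3) h(4)] phi_res[OF V W(1,2) \<tau>] by simp
  then have "spec_const B TB (phi U s) \<otimes>\<^bsub>spec_sec B TB\<^esub> spec_const B TB (phi V \<tau>)
      = spec_const B TB (phi U a)"
    using D.spec_const_mult[OF T phi_c(1,3)] by simp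
  also have "\<dots> = co e W (?s \<otimes>\<^bsub>sec X W\<^esub> ?t)" using coG[OF h(2)] eq by simp
  also have "\<dots> = spec_const B TB (phi U s) \<otimes>\<^bsub>spec_sec B TB\<^esub> co e W ?t"
    using ring_hom_mult[OF hom c] coG[OF h(1)] by simp
  finally have eq2: "spec_const B TB (phi U s) \<otimes>\<^bsub>spec_sec B TB\<^esub> spec_const B TB (phi V \<tau>)
    = spec_const B TB (phi U s) \<otimes>\<^bsub>spec_sec B TB\<^esub> co e W ?t" .
  have u: "spec_const B TB (phi U s) \<in> Units (spec_sec B TB)"
    using ring_hom_Units[OF hom h(8)] coG[OF h(1)] by simp
  have "spec_const B TB (phi V \<tau>) = co e W ?t"
    using SB.Units_l_cancel[OF u D.spec_const_closed[OF T phi_c(3)] ring_hom_closed[OF hom c(2)]] eq2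
    by simp
  also have "\<dots> = co e V \<tau>"
    using co_res[OF e_premorphism near_open[OF V] h(5) W(2) \<tau>]
      co_closed[OF e_premorphism near_open[OF V] \<tau>]
    by (simp add: preim_e_near W V restrict_TB)
  finally show ?thesis ..
qed

text \<open>An arbitrary open \<open>V\<close> may miss \<open>y0\<close>, so its preimage can be a
  proper open set and the identity is checked prime by prime. With \<open>\<tau> = a/s\<close> near
  \<open>pt e P\<close>, the left side is the quotient rule for the pullback, and the right side is
  found by solving the Leibniz rule for \<open>s \<tau> = a\<close> in the local ring at
  \<open>P\<close>.\<close>

lemma e_derivation:
  assumes V: "opn X V" and \<tau>: "\<tau> \<in> carrier (sec X V)"
  shows "invariant_field K (preim (spec B) e V) (co e V \<tau>) = co e V (D V \<tau>)"
proof (rule extensionalityI[of _ "preim (spec B) e V"])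
  show "invariant_field K (preim (spec B) e V) (co e V \<tau>) \<in> extensional (preim (spec B) e V)"
    by (simp add: invariant_field_def spec_vector_field_def)
  show "co e V (D V \<tau>) \<in> extensional (preim (spec B) e V)"
    using co_closed[OF e_premorphism V D_closed[OF V \<tau>]] D.spec_sec_ext by simp
  fix P assume P: "P \<in> preim (spec B) e V"
  have PT: "P \<in> TB" using P by (simp add: mem_preim)
  have prime: "primeideal P B" using PT by (simp add: D.topspace_zariski)
  have o: "opn X (V \<inter> U)" using V U_open by blast
  have pVU: "pt e P \<in> V \<inter> U" using P e_in_U[OF PT] by (simp add: mem_preim)
  obtain s a W where h: "s \<in> {G a |a. a \<in> carrier A}" "a \<in> {G a |a. a \<in> carrier A}"
    "s \<in> carrier (sec X U)" "a \<in> carrier (sec X U)"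
    "opn X W" "pt e P \<in> W" "W \<subseteq> V \<inter> U" "res X U W s \<in> Units (sec X W)"
    "res X U W s \<otimes>\<^bsub>sec X W\<^esub> res X (V \<inter> U) W (res X V (V \<inter> U) \<tau>) = res X U W a"
    by (rule locally_fractionsE[OF locally_fractions_G o Int_lower2 X.res_closed[OF V o Int_lower1 \<tau>] pVU])
  have W: "W \<subseteq> V" "W \<subseteq> U" using h(7) by auto
  let ?s = "res X U W s" and ?t = "res X V W \<tau>" and ?a = "res X U W a"
  have c: "?s \<in> carrier (sec X W)" "?t \<in> carrier (sec X W)" "?a \<in> carrier (sec X W)"
    using X.res_closed U_open V h(3,4,5) W \<tau> by auto
  interpret SW: cring "sec X W" by (rule X.cring_sec[OF h(5)])
  have eq: "?s \<otimes>\<^bsub>sec X W\<^esub> ?t = ?a"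
    using h(9) X.res_res[OF V o h(5) h(7) Int_lower1 \<tau>] by simp
  let ?L = "localize_at B P"
  interpret M: mult_set B "carrier B - P" by (rule mult_set_prime[OF prime])
  interpret L: cring ?L by (rule M.cring_localize)
  let ?W = "preim (spec B) e W"
  have PW: "P \<in> ?W" using PT h(6) by (simp add: mem_preim)
  \<comment> \<open>Pullback followed by the value at \<open>P\<close>: a homomorphism from sections
    on \<open>W\<close> to the local ring, in which the computations below take place.\<close>
  define \<eta> where "\<eta> t = co e W t P" for t
  have \<eta>: "\<eta> \<in> ring_hom (sec X W) ?L"
  proof (rule ring_hom_memI)
    have k: "co e W \<in> ring_hom (sec X W) (spec_sec B ?W)" using co_hom[OF e_premorphism h(5)] by simp
    fix u v assume uv: "u \<in> carrier (sec X W)" "v \<in> carrier (sec X W)"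
    show "\<eta> u \<in> carrier ?L"
      unfolding \<eta>_def using D.spec_sec_at[OF ring_hom_closed[OF k uv(1)] PW] .
    show "\<eta> (u \<otimes>\<^bsub>sec X W\<^esub> v) = \<eta> u \<otimes>\<^bsub>?L\<^esub> \<eta> v"
      unfolding \<eta>_def ring_hom_mult[OF k uv] by (rule spec_sec_ops_at(3)[OF PW])
    show "\<eta> (u \<oplus>\<^bsub>sec X W\<^esub> v) = \<eta> u \<oplus>\<^bsub>?L\<^esub> \<eta> v"
      unfolding \<eta>_def ring_hom_add[OF k uv] by (rule spec_sec_ops_at(4)[OF PW])
  next
    have k: "co e W \<in> ring_hom (sec X W) (spec_sec B ?W)" using co_hom[OF e_premorphism h(5)] by simp
    show "\<eta> \<one>\<^bsub>sec X W\<^esub> = \<one>\<^bsub>?L\<^esub>"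
      unfolding \<eta>_def ring_hom_one[OF k] by (rule spec_sec_ops_at(1)[OF PW])
  qed
  have \<eta>_res: "\<eta> (res X V W t) = co e V t P" if "t \<in> carrier (sec X V)" for t
    unfolding \<eta>_def co_res[OF e_premorphism V h(5) W(1) that] using PW by simp
  have \<eta>_G: "\<eta> (res X U W g) = fraction_at B P (phi U g) \<one>\<^bsub>B\<^esub>" if "g \<in> carrier (sec X U)" for g
    unfolding \<eta>_def co_res[OF e_premorphism U_open h(5) W(2) that] co_e_near[OF near_U that]
    using PW PT by (simp add: spec_const_def)
  let ?f = "phi U s" and ?g = "phi U a"
  have fg: "?f \<in> carrier B" "?g \<in> carrier B" using phi_closed near_U h by blast+
  have D': "\<delta> ?f \<in> carrier B" "\<delta> ?g \<in> carrier B" using der_closed fg by blast+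
  have "fraction_at B P ?f \<one>\<^bsub>B\<^esub> \<in> Units ?L"
    using ring_hom_Units[OF \<eta> h(8)] \<eta>_G[OF h(3)] by simp
  then have fP: "?f \<in> carrier B - P"
    using primeideal.Units_localize_iff[OF prime fg(1) M.M_one] fg by simp
  \<comment> \<open>Solving a linear equation in the local ring. It is applied with \<open>t\<close>
    equal to one to find the value of \<open>\<tau>\<close>, and with \<open>t\<close> and
    \<open>u\<close> both the pulled back denominator to find that of
    \<open>D V \<tau>\<close>.\<close>
  have cancel: "x = fraction_at B P b (t \<otimes>\<^bsub>B\<^esub> u)"
    if xL: "x \<in> carrier ?L" and b: "b \<in> carrier B" and t: "t \<in> carrier B - P" and u: "u \<in> carrier B - P"
      and tux: "fraction_at B P t \<one>\<^bsub>B\<^esub> \<otimes>\<^bsub>?L\<^esub> (fraction_at B P u \<one>\<^bsub>B\<^esub> \<otimes>\<^bsub>?L\<^esub> x) = fraction_at B P b \<one>\<^bsub>B\<^esub>"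
    for x b t u
  proof -
    from xL obtain k l where kl: "k \<in> carrier B" "l \<in> carrier B - P" "x = fraction_at B P k l"
      by (rule M.fraction_cases)
    have tu: "t \<otimes>\<^bsub>B\<^esub> u \<in> carrier B - P" using t u by (rule M.M_mult)
    have cc: "t \<in> carrier B" "u \<in> carrier B" "l \<in> carrier B" using t u kl by blast+
    have "fraction_at B P (t \<otimes>\<^bsub>B\<^esub> (u \<otimes>\<^bsub>B\<^esub> k)) l = fraction_at B P b \<one>\<^bsub>B\<^esub>"
      using tux cc
      by (simp add: kl(3) M.fraction_mult[OF cc(2) M.M_one kl(1,2)]
          M.fraction_mult[OF cc(1) M.M_one D.m_closed[OF cc(2) kl(1)] kl(2)])
    then obtain v where v: "v \<in> carrier B - P" "v \<otimes>\<^bsub>B\<^esub> (\<one>\<^bsub>B\<^esub> \<otimes>\<^bsub>B\<^esub> (t \<otimes>\<^bsub>B\<^esub> (u \<otimes>\<^bsub>B\<^esub> k))) = v \<otimes>\<^bsub>B\<^esub> (l \<otimes>\<^bsub>B\<^esub> b)"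
      using M.fraction_eqD[OF D.m_closed[OF cc(1) D.m_closed[OF cc(2) kl(1)]] b kl(2) M.M_one] by blast
    have "v \<otimes>\<^bsub>B\<^esub> ((t \<otimes>\<^bsub>B\<^esub> u) \<otimes>\<^bsub>B\<^esub> k) = v \<otimes>\<^bsub>B\<^esub> (l \<otimes>\<^bsub>B\<^esub> b)"
      using v kl cc b by (simp add: D.m_assoc)
    then show ?thesis
      unfolding kl(3) by (rule M.fraction_eqI[OF kl(1) b kl(2) tu v(1)])
  qed
  have \<tau>P: "co e V \<tau> P = fraction_at B P ?g ?f"
  proof -
    have "fraction_at B P ?f \<one>\<^bsub>B\<^esub> \<otimes>\<^bsub>?L\<^esub> co e V \<tau> P = fraction_at B P ?g \<one>\<^bsub>B\<^esub>"
      using ring_hom_mult[OF \<eta> c(1,2)] eq \<eta>_res[OF \<tau>] \<eta>_G[OF h(3)] \<eta>_G[OF h(4)] by simp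
    moreover have x: "co e V \<tau> P \<in> carrier ?L"
      using ring_hom_closed[OF \<eta> c(2)] \<eta>_res[OF \<tau>] by simp
    ultimately have "fraction_at B P \<one>\<^bsub>B\<^esub> \<one>\<^bsub>B\<^esub> \<otimes>\<^bsub>?L\<^esub> (fraction_at B P ?f \<one>\<^bsub>B\<^esub> \<otimes>\<^bsub>?L\<^esub> co e V \<tau> P)
      = fraction_at B P ?g \<one>\<^bsub>B\<^esub>"
      using M.fraction_closed[OF fg(2) M.M_one] by (simp add: M.localize_one[symmetric])
    from cancel[OF x fg(2) M.M_one fP this] show ?thesis using fg by simp
  qed
  let ?q = "?f \<otimes>\<^bsub>B\<^esub> \<delta> ?g \<ominus>\<^bsub>B\<^esub> ?g \<otimes>\<^bsub>B\<^esub> \<delta> ?f"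
  have lhs: "invariant_field K (preim (spec B) e V) (co e V \<tau>) P = fraction_at B P ?q (?f \<otimes>\<^bsub>B\<^esub> ?f)"
    unfolding invariant_field_def using \<tau>P fP fg
    by (intro DB.spec_vector_field_at[OF P prime]) simp_all
  have D\<eta>: "\<eta> (D W (res X U W g)) = fraction_at B P (\<delta> (phi U g)) \<one>\<^bsub>B\<^esub>" if "g \<in> carrier (sec X U)" for g
    using D_res[OF U_open h(5) W(2) that] \<eta>_G[OF D_closed[OF U_open that]] phi_D[OF near_U that] by simp
  define x where "x = co e V (D V \<tau>) P"
  have x: "\<eta> (D W ?t) = x"
    using D_res[OF V h(5) W(1) \<tau>] \<eta>_res[OF D_closed[OF V \<tau>]] by (simp add: x_def)
  have Dc: "D W ?s \<in> carrier (sec X W)" "D W ?t \<in> carrier (sec X W)" using D_closed[OF h(5)] c by blast+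
  have xc: "x \<in> carrier ?L" using ring_hom_closed[OF \<eta> Dc(2)] x by simp
  let ?F = "fraction_at B P ?f \<one>\<^bsub>B\<^esub>" and ?H = "fraction_at B P ?g \<one>\<^bsub>B\<^esub>"
  let ?DF = "fraction_at B P (\<delta> ?f) \<one>\<^bsub>B\<^esub>" and ?DH = "fraction_at B P (\<delta> ?g) \<one>\<^bsub>B\<^esub>"
  have Lc: "?F \<in> carrier ?L" "?H \<in> carrier ?L" "?DF \<in> carrier ?L" "?DH \<in> carrier ?L"
    using fg D' M.M_one by (auto intro!: M.fraction_closed)
  have "D W ?a = ?s \<otimes>\<^bsub>sec X W\<^esub> D W ?t \<oplus>\<^bsub>sec X W\<^esub> D W ?s \<otimes>\<^bsub>sec X W\<^esub> ?t"
    using D_mult[OF h(5) c(1,2)] eq by simp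
  \<comment> \<open>Multiplying by \<open>s\<close> once more turns the factor \<open>\<tau>\<close>
    next to the derivative of \<open>s\<close> into \<open>a\<close>, so that beside known terms
    only the derivative of \<open>\<tau>\<close> remains.\<close>
  then have "?s \<otimes>\<^bsub>sec X W\<^esub> D W ?a
    = ?s \<otimes>\<^bsub>sec X W\<^esub> (?s \<otimes>\<^bsub>sec X W\<^esub> D W ?t) \<oplus>\<^bsub>sec X W\<^esub> D W ?s \<otimes>\<^bsub>sec X W\<^esub> (?s \<otimes>\<^bsub>sec X W\<^esub> ?t)"
    using c Dc by (simp add: SW.r_distr SW.m_lcomm)
  then have "\<eta> (?s \<otimes>\<^bsub>sec X W\<^esub> D W ?a)
    = \<eta> (?s \<otimes>\<^bsub>sec X W\<^esub> (?s \<otimes>\<^bsub>sec X W\<^esub> D W ?t) \<oplus>\<^bsub>sec X W\<^esub> D W ?s \<otimes>\<^bsub>sec X W\<^esub> ?a)"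
    by (simp add: eq)
  then have "?F \<otimes>\<^bsub>?L\<^esub> ?DH = ?F \<otimes>\<^bsub>?L\<^esub> (?F \<otimes>\<^bsub>?L\<^esub> x) \<oplus>\<^bsub>?L\<^esub> ?DF \<otimes>\<^bsub>?L\<^esub> ?H"
    using c Dc D_closed[OF h(5) c(3)]
    by (simp add: ring_hom_mult[OF \<eta>] ring_hom_add[OF \<eta>] x \<eta>_G[OF h(3)] \<eta>_G[OF h(4)] D\<eta>[OF h(3)] D\<eta>[OF h(4)])
  \<comment> \<open>The numerator of the quotient rule satisfies the same equation, so the common
    summand cancels and \<open>x\<close> is determined.\<close>
  moreover have "?F \<otimes>\<^bsub>?L\<^esub> ?DH = fraction_at B P ?q \<one>\<^bsub>B\<^esub> \<oplus>\<^bsub>?L\<^esub> ?DF \<otimes>\<^bsub>?L\<^esub> ?H"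
  proof -
    have "?q \<oplus>\<^bsub>B\<^esub> \<delta> ?f \<otimes>\<^bsub>B\<^esub> ?g = ?f \<otimes>\<^bsub>B\<^esub> \<delta> ?g" using fg D' by algebra
    then show ?thesis using fg D' by (simp add: M.fraction_const_mult M.fraction_const_add)
  qed
  ultimately have eq3: "?F \<otimes>\<^bsub>?L\<^esub> (?F \<otimes>\<^bsub>?L\<^esub> x) \<oplus>\<^bsub>?L\<^esub> ?DF \<otimes>\<^bsub>?L\<^esub> ?H
    = fraction_at B P ?q \<one>\<^bsub>B\<^esub> \<oplus>\<^bsub>?L\<^esub> ?DF \<otimes>\<^bsub>?L\<^esub> ?H"
    by (rule trans[OF sym])
  have qc: "?q \<in> carrier B" using fg D' by simp
  note cl = L.m_closed[OF Lc(3,2)] L.m_closed[OF Lc(1) L.m_closed[OF Lc(1) xc]] M.fraction_closed[OF qc M.M_one]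
  have "?F \<otimes>\<^bsub>?L\<^esub> (?F \<otimes>\<^bsub>?L\<^esub> x) = fraction_at B P ?q \<one>\<^bsub>B\<^esub>"
    using eq3 by (rule iffD1[OF L.add.right_cancel[OF cl]])
  then have "x = fraction_at B P ?q (?f \<otimes>\<^bsub>B\<^esub> ?f)"
    using fg D' by (intro cancel[OF xc _ fP fP]) simp_all
  then show "invariant_field K (preim (spec B) e V) (co e V \<tau>) P = co e V (D V \<tau>) P"
    using lhs by (simp add: x_def)
qed

text \<open>\<open>spec K\<close> has one point and its sections are locally fractions of constants,
  so it suffices to compare pullbacks of scalars, where \<open>phi_scalar\<close> applies.\<close>

lemma e_str: "eq_map (spec B) (spec K) (comp_map X (str X) e) (spec_map K B (\<lambda>c. c \<odot>\<^bsub>B\<^esub> \<one>\<^bsub>B\<^esub>))"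
proof (rule premorphisms_from_spec_eqI[OF D.cring_axioms presheaf_locale_spec locally_fractions_spec])
  let ?j = "spec_map K B (\<lambda>c. c \<odot>\<^bsub>B\<^esub> \<one>\<^bsub>B\<^esub>)"
  show 1: "premorphism (spec B) (spec K) (comp_map X (str X) e)"
    by (rule premorphism_comp[OF e_premorphism str_premorphism])
  show 2: "premorphism (spec B) (spec K) ?j"
    by (rule spec_hom.premorphism_spec_map[OF spec_hom_scalar])
  show "pt (comp_map X (str X) e) P = pt ?j P \<and> pt (comp_map X (str X) e) P \<in> pts (spec K)"
    if "P \<in> pts (spec B)" for P
    using premorphism_pt[OF 1 that] premorphism_pt[OF 2 that] by (simp add: TK_eq)
  fix u assume "u \<in> {spec_const K (pts (spec K)) c |c. c \<in> carrier K}"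
  then obtain c where c: "c \<in> carrier K" "u = spec_const K TK c" by auto
  have pts: "preim X (str X) TK = pts X" using preim_pts[OF str_premorphism] by simp
  have "co e (pts X) (co (str X) TK u) = spec_const B TB (c \<odot>\<^bsub>B\<^esub> \<one>\<^bsub>B\<^esub>)"
    using co_e_near[OF near_pts, of "scalar K X (pts X) c"] scalar_closed[OF openin_topspace c(1)]
      phi_scalar[OF near_pts c(1)] scalar_pts[OF c(1)] c(2) by simp
  moreover have "co ?j TK u = spec_const B TB (c \<odot>\<^bsub>B\<^esub> \<one>\<^bsub>B\<^esub>)"
    using spec_hom.co_spec_const[OF spec_hom_scalar, of TK c] c preim_pts[OF 2] by simp
  ultimately show "co (comp_map X (str X) e) (pts (spec K)) u = co ?j (pts (spec K)) u"
    by (simp add: comp_map_def pts)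
qed

lemma der_curve_e: "der_curve e"
  unfolding der_curve_def using e_premorphism e_reflects e_str e_origin e_derivation by blast

text \<open>The intertwining hypothesis concerns the neighbourhood \<open>U\<close> of
  \<open>y0\<close> alone. In this form the lemma serves both for curves given by tangent vectors
  and for curves built in other charts.\<close>

lemma curve_eq_e:
  assumes f: "premorphism (spec B) X f" "reflects (spec B) X f"
    and f0: "eq_map (spec K) X (comp_map (spec B) f (origin K)) y"
    and der: "\<And>\<tau>. \<tau> \<in> carrier (sec X U) \<Longrightarrow> invariant_field K TB (co f U \<tau>) = co f U (D U \<tau>)"
  shows "eq_map (spec B) X f e"
proof (rule eq_map_from_spec[OF D.cring_axioms f e_premorphism e_reflects])
  have pre: "preim (spec B) f U = TB" by (rule preim_near[OF f(1) pt_m0[OF f0] near_U])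
  show "pt f P \<in> U" if "P \<in> pts (spec B)" for P
    using that pre by (auto simp: preim_def)
  show "pt e P \<in> U" if "P \<in> pts (spec B)" for P using that e_in_U by simp
  show "co f U (G a) = co e U (G a)" if "a \<in> carrier A" for a
    using der_on_near[OF f(1) f0 near_U der G_closed[OF that]] co_e_G[OF that] by simp
qed

lemma der_curve_eq_e:
  assumes f: "der_curve f"
  shows "eq_map (spec B) X f e"
proof (rule curve_eq_e[OF der_curveD(1,2,4)[OF f]])
  have pre: "preim (spec B) f U = TB"
    by (rule preim_near[OF der_curveD(1)[OF f] pt_m0[OF der_curveD(4)[OF f]] near_U])
  show "invariant_field K TB (co f U \<tau>) = co f U (D U \<tau>)" if "\<tau> \<in> carrier (sec X U)" for \<tau>
    using der_curveD(5)[OF f U_open that] by (simp add: pre)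
qed

end

section \<open>Tangent vectors at the universal point\<close>

lemma cring_dual_numbers:
  fixes S :: "('k, 's, 'm) module_scheme"
  assumes "cring S"
  shows "cring (dual_numbers S)"
proof -
  interpret S: cring S by (rule assms)
  let ?E = "dual_numbers S"
  have opp: "\<exists>y\<in>carrier ?E. y \<oplus>\<^bsub>?E\<^esub> x = \<zero>\<^bsub>?E\<^esub>" if "x \<in> carrier ?E" for x
    using that by (intro bexI[of _ "(\<ominus>\<^bsub>S\<^esub> fst x, \<ominus>\<^bsub>S\<^esub> snd x)"])
      (auto simp: dual_numbers_def S.l_neg)
  show ?thesis
    by (intro cringI abelian_groupI comm_monoidI opp)
      (auto simp: dual_numbers_def S.a_ac S.m_ac S.r_distr S.l_distr)
qed

lemma spec_hom_dual_numbers: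
  fixes S :: "('k, 's, 'm) module_scheme"
  assumes "cring S"
  shows "spec_hom S (dual_numbers S) (\<lambda>s. (s, \<zero>\<^bsub>S\<^esub>))"
proof -
  interpret S: cring S by (rule assms)
  show ?thesis
    by (intro spec_hom.intro spec_hom_axioms.intro S.cring_axioms cring_dual_numbers[OF assms] ring_hom_memI)
      (auto simp: dual_numbers_def)
qed

lemma co_id_map: "co id_map V s = s"
  by (simp add: id_map_def)

lemma id_map_props:
  assumes "presheaf Y"
  shows premorphism_id_map: "premorphism Y Y id_map" and reflects_id_map: "reflects Y Y id_map"
proof -
  interpret Y: presheaf Y by (rule assms)
  have pre: "preim Y id_map V = V" if "opn Y V" for V
    using openin_subset[OF that] by (auto simp: preim_def id_map_def)
  have pt: "pt (id_map :: ('a, 'b, 'a, 'b) lrs_map) = (\<lambda>p. p)" and co: "\<And>V s. co (id_map :: ('a, 'b, 'a, 'b) lrs_map) V s = s"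
    by (simp_all add: id_map_def)
  show "premorphism Y Y id_map"
    unfolding premorphism_def
    by (auto simp: pt co pre intro!: ring_hom_memI cring.cring_simprules Y.cring_sec)
  show "reflects Y Y id_map"
    unfolding reflects_def by (auto simp: pt co pre)
qed

context flow
begin

lemma integral_curve_props:
  assumes f: "integral_curve TYPE('s) K X D y f"
  shows integral_curve_premorphism: "premorphism (spec B) X f"
    and integral_curve_reflects: "reflects (spec B) X f"
    and integral_curve_origin: "eq_map (spec K) X (comp_map (spec B) f (origin K)) y"
  using f D.lrs_from_spec_iff[OF X.presheaf_axioms, of f]
  by (simp_all add: integral_curve_def morphism_over_def dual_space_eq base_scheme_def)

text \<open>
  The tangent vector equation at the identity of \<open>Spec K[x]\<^sup>*\<close> contains all the others; its
  \<open>\<epsilon>\<close>-component is compared at the prime ideal \<open>m0 + (\<epsilon>)\<close>.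
\<close>

lemma integral_curve_derivation:
  assumes f: "integral_curve TYPE((nat \<Rightarrow> 'k) \<Rightarrow> 'k) K X D y f"
    and V: "near V" and \<tau>: "\<tau> \<in> carrier (sec X V)"
  shows "invariant_field K TB (co f V \<tau>) = co f V (D V \<tau>)"
proof -
  let ?E = "dual_numbers B" and ?i = "\<lambda>s. (s, \<zero>\<^bsub>B\<^esub>)"
  let ?\<rho> = "spec_map B ?E ?i"
  interpret E: spec_hom B ?E ?i by (rule spec_hom_dual_numbers[OF D.cring_axioms])
  let ?TE = "topspace (zariski ?E)"
  note pf = integral_curve_premorphism[OF f]
  note f0 = integral_curve_origin[OF f]
  have pre: "preim (spec B) f V = TB" by (rule preim_near[OF pf pt_m0[OF f0] V])
  have pre\<rho>: "preim (spec ?E) ?\<rho> TB = ?TE" using preim_pts[OF E.premorphism_spec_map] by simp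
  have prei: "preim (spec B) id_map TB = TB" by (auto simp: preim_def id_map_def)
  have preif: "preim (spec B) (comp_map (spec B) f id_map) V = TB"
    using pre by (simp add: preim_def comp_map_def id_map_def)
  have T: "openin (zariski B) TB" by simp
  have TE: "openin (zariski ?E) ?TE" by simp
  have \<tau>c: "co f V \<tau> \<in> carrier (spec_sec B TB)" "co f V (D V \<tau>) \<in> carrier (spec_sec B TB)"
    using co_closed[OF pf near_open[OF V]] \<tau> D_closed[OF near_open[OF V] \<tau>] by (simp_all add: pre)
  obtain b where b: "b \<in> carrier B" "co f V \<tau> = spec_const B TB b"
    by (rule LB.spec_const_surj[OF \<tau>c(1)])
  obtain b' where b': "b' \<in> carrier B" "co f V (D V \<tau>) = spec_const B TB b'"
    by (rule LB.spec_const_surj[OF \<tau>c(2)])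
  have inv: "invariant_field K TB (co f V \<tau>) = spec_const B TB (\<delta> b)"
    unfolding invariant_field_def b(2) by (rule DB.spec_vector_field_const[OF T b(1)])
  have \<delta>b: "\<delta> b \<in> carrier B" by (rule der_closed[OF b(1)])
  have id: "premorphism (spec B) (spec B) id_map" "reflects (spec B) (spec B) id_map"
    using id_map_props[OF D.presheaf_locale_spec] by blast+
  \<comment> \<open>The identity is the universal point, with values in
    \<open>S = B\<close>.\<close>
  have "morphism_over K (spec_over K B) (dual_space K) id_map"
    using id D.lrs_from_spec_iff[OF D.presheaf_locale_spec, of id_map]
    by (simp add: morphism_over_def dual_space_eq eq_map_def comp_map_def id_map_def)
  then have "eq_map (spec_over K ?E) X (comp_map (dual_space K) f (tangent_at B (invariant_field K) id_map))
      (tangent_at B D (comp_map (dual_space K) f id_map))"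
    using f algebra_dual unfolding integral_curve_def by blast
  then have "co (comp_map (spec B) f (tangent_at B (invariant_field K) id_map)) V \<tau>
    = co (tangent_at B D (comp_map (spec B) f id_map)) V \<tau>"
    using near_open[OF V] \<tau> by (simp add: eq_map_def dual_space_eq)
  moreover have c1: "co (comp_map (spec B) f g) V \<tau> = co g TB (co f V \<tau>)"
    for g :: "((((nat \<Rightarrow> 'k) \<Rightarrow> 'k) \<times> ((nat \<Rightarrow> 'k) \<Rightarrow> 'k)) set, _, _, _) lrs_map"
    by (simp add: comp_map_def pre)
  moreover have c2: "co (comp_map (spec B) f id_map) V s = co f V s" for s
    by (simp add: comp_map_def co_id_map)
  \<comment> \<open>On global sections the two tangent vectors are
    \<open>b + \<epsilon> \<delta> b\<close> and \<open>b + \<epsilon> b'\<close>.\<close>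
  ultimately have "co ?\<rho> TB (spec_const B TB b) \<oplus>\<^bsub>spec_sec ?E ?TE\<^esub>
      spec_const ?E ?TE (\<zero>\<^bsub>B\<^esub>, \<one>\<^bsub>B\<^esub>) \<otimes>\<^bsub>spec_sec ?E ?TE\<^esub> co ?\<rho> TB (spec_const B TB (\<delta> b))
    = co ?\<rho> TB (spec_const B TB b) \<oplus>\<^bsub>spec_sec ?E ?TE\<^esub>
      spec_const ?E ?TE (\<zero>\<^bsub>B\<^esub>, \<one>\<^bsub>B\<^esub>) \<otimes>\<^bsub>spec_sec ?E ?TE\<^esub> co ?\<rho> TB (spec_const B TB b')"
    using inv b b' by (simp add: c1 c2 co_id_map tangent_at_def Let_def prei preif pre\<rho>)
  moreover have "co ?\<rho> TB (spec_const B TB c) = spec_const ?E ?TE (c, \<zero>\<^bsub>B\<^esub>)" if "c \<in> carrier B" for c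
    using E.co_spec_const[OF T that] by (simp add: pre\<rho>)
  moreover have "spec_const ?E ?TE (b, \<zero>\<^bsub>B\<^esub>) \<oplus>\<^bsub>spec_sec ?E ?TE\<^esub>
      spec_const ?E ?TE (\<zero>\<^bsub>B\<^esub>, \<one>\<^bsub>B\<^esub>) \<otimes>\<^bsub>spec_sec ?E ?TE\<^esub> spec_const ?E ?TE (c, \<zero>\<^bsub>B\<^esub>)
    = spec_const ?E ?TE (b, c)" if c: "c \<in> carrier B" for c
  proof -
    have E: "(b, \<zero>\<^bsub>B\<^esub>) \<in> carrier ?E" "(\<zero>\<^bsub>B\<^esub>, \<one>\<^bsub>B\<^esub>) \<in> carrier ?E" "(c, \<zero>\<^bsub>B\<^esub>) \<in> carrier ?E"
      using b(1) c by (simp_all add: dual_numbers_def)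
    have "(b, \<zero>\<^bsub>B\<^esub>) \<oplus>\<^bsub>?E\<^esub> (\<zero>\<^bsub>B\<^esub>, \<one>\<^bsub>B\<^esub>) \<otimes>\<^bsub>?E\<^esub> (c, \<zero>\<^bsub>B\<^esub>) = (b, c)"
      using b(1) c by (simp add: dual_numbers_def)
    then show ?thesis
      using E.B.spec_const_mult[OF TE E(2,3)] E.B.spec_const_add[OF TE E(1) E.B.m_closed[OF E(2,3)]] by simp
  qed
  ultimately have eqE: "spec_const ?E ?TE (b, \<delta> b) = spec_const ?E ?TE (b, b')"
    using b(1) b'(1) \<delta>b by simp
  have fst_hom: "fst \<in> ring_hom ?E B"
    by (rule ring_hom_memI) (auto simp: dual_numbers_def)
  \<comment> \<open>The inverse image of \<open>m0\<close> under setting \<open>\<epsilon>\<close>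
    to zero. An element outside it has a first component outside \<open>m0\<close>, a unit of
    \<open>B\<close>, which lets denominators cancel.\<close>
  let ?M = "{x \<in> carrier ?E. fst x \<in> m0}"
  have M: "primeideal ?M ?E"
    by (rule ring_hom_ring.primeideal_vimage[OF ring_hom_ringI2[OF E.B.ring_axioms D.ring_axioms fst_hom]
        E.B.cring_axioms LB.m_prime])
  then have MT: "?M \<in> ?TE" by (simp add: E.B.topspace_zariski)
  interpret M: mult_set ?E "carrier ?E - ?M" by (rule mult_set_prime[OF M])
  have c: "(b, \<delta> b) \<in> carrier ?E" "(b, b') \<in> carrier ?E"
    using b(1) b'(1) \<delta>b by (simp_all add: dual_numbers_def)
  have "fraction_at ?E ?M (b, \<delta> b) \<one>\<^bsub>?E\<^esub> = fraction_at ?E ?M (b, b') \<one>\<^bsub>?E\<^esub>"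
    using fun_cong[OF eqE, of ?M] MT by (simp add: spec_const_def)
  then obtain u where u: "u \<in> carrier ?E - ?M"
    "u \<otimes>\<^bsub>?E\<^esub> (\<one>\<^bsub>?E\<^esub> \<otimes>\<^bsub>?E\<^esub> (b, \<delta> b)) = u \<otimes>\<^bsub>?E\<^esub> (\<one>\<^bsub>?E\<^esub> \<otimes>\<^bsub>?E\<^esub> (b, b'))"
    using M.fraction_eqD[OF c M.M_one M.M_one] by blast
  obtain u0 u1 where u01: "u = (u0, u1)" by (cases u)
  have uc: "u0 \<in> carrier B" "u1 \<in> carrier B" "u0 \<notin> m0"
    using u(1) u01 by (auto simp: dual_numbers_def)
  have "u \<otimes>\<^bsub>?E\<^esub> (b, \<delta> b) = u \<otimes>\<^bsub>?E\<^esub> (b, b')" using u(2) c by simp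
  \<comment> \<open>In the \<open>\<epsilon>\<close> component the terms with \<open>u1\<close>
    agree, since both first components are \<open>b\<close>; what remains is multiplied by the unit
    \<open>u0\<close>.\<close>
  then have "u0 \<otimes>\<^bsub>B\<^esub> \<delta> b \<oplus>\<^bsub>B\<^esub> u1 \<otimes>\<^bsub>B\<^esub> b = u0 \<otimes>\<^bsub>B\<^esub> b' \<oplus>\<^bsub>B\<^esub> u1 \<otimes>\<^bsub>B\<^esub> b"
    unfolding u01 by (simp add: dual_numbers_def)
  then have "u0 \<otimes>\<^bsub>B\<^esub> \<delta> b = u0 \<otimes>\<^bsub>B\<^esub> b'"
    by (rule iffD1[OF D.add.right_cancel[OF D.m_closed[OF uc(2) b(1)] D.m_closed[OF uc(1) \<delta>b] D.m_closed[OF uc(1) b'(1)]]])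
  then have "\<delta> b = b'"
    using D.Units_l_cancel[OF LB.m_units[OF uc(1,3)] \<delta>b b'(1)] by simp
  then show ?thesis using inv b'(2) by simp
qed

end

theorem theorem0p8:
  fixes K :: "'k ring"
    and X :: "('a, 'b, 'k) space_over"
    and y :: "('k set, 'k set \<Rightarrow> ('k \<times> 'k) set, 'a, 'b) lrs_map"
    and D :: "'a set \<Rightarrow> 'b \<Rightarrow> 'b"
  assumes "field K"
    and "scheme_over K X"
    and "rational_point K X y"
    and "vector_field K X D"
  shows "integral_curve TYPE('s) K X D y (exp_curve K X D y) \<and>
    (\<forall>f. integral_curve TYPE((nat \<Rightarrow> 'k) \<Rightarrow> 'k) K X D y f \<longrightarrow>
       eq_map (dual_space K) X f (exp_curve K X D y))"
proof -
  interpret flow K X y D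
    by (intro flow.intro dual_poly.intro flow_axioms.intro assms)
  have "y0 \<in> pts X" using near_pts by (simp add: near_def)
  then obtain U and A :: "'b ring" and \<theta> \<theta>' where c: "y0 \<in> U" "affine_chart X U A \<theta> \<theta>'"
    using assms(2) unfolding scheme_over_def scheme_def by blast
  interpret C: flow_chart K X y D U A \<theta> \<theta>'
    by (intro flow_chart.intro flow_axioms chart.intro X.presheaf_axioms chart_axioms.intro
        flow_chart_axioms.intro c)
  \<comment> \<open>Independence of the chart: the curve of the first chart satisfies
    \<open>der_curve\<close>, so uniqueness in the second chart identifies it with the curve
    there.\<close>
  have "eq_map (dual_space K) X C.e (exp_on K X D y U2 A2 \<theta>2 \<theta>2')"
    if h: "affine_chart X U2 A2 \<theta>2 \<theta>2' \<and> pt y ` pts (base_scheme K) \<subseteq> U2"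
    for U2 and A2 :: "'b ring" and \<theta>2 \<theta>2'
  proof -
    have "y0 \<in> U2" using h by (simp add: base_scheme_def TK_eq y0_def)
    then interpret C2: flow_chart K X y D U2 A2 \<theta>2 \<theta>2'
      using h by (intro flow_chart.intro flow_axioms chart.intro X.presheaf_axioms chart_axioms.intro
        flow_chart_axioms.intro) simp_all
    show ?thesis using C2.der_curve_eq_e[OF C.der_curve_e] by (simp add: dual_space_eq)
  qed
  then have "\<exists>e. \<forall>U (A :: 'b ring) \<theta> \<theta>'.
      affine_chart X U A \<theta> \<theta>' \<and> pt y ` pts (base_scheme K) \<subseteq> U \<longrightarrow>
      eq_map (dual_space K) X e (exp_on K X D y U A \<theta> \<theta>')"
    by blast
  \<comment> \<open>Some curve fits all charts around \<open>y\<close> at once, so the one chosen in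
    \<open>exp_curve\<close> does too.\<close>
  then have "\<forall>U (A :: 'b ring) \<theta> \<theta>'.
      affine_chart X U A \<theta> \<theta>' \<and> pt y ` pts (base_scheme K) \<subseteq> U \<longrightarrow>
      eq_map (dual_space K) X (exp_curve K X D y) (exp_on K X D y U A \<theta> \<theta>')"
    unfolding exp_curve_def by (rule someI_ex)
  moreover have "pt y ` pts (base_scheme K) \<subseteq> U"
    using c(1) by (simp add: base_scheme_def TK_eq y0_def)
  ultimately have exp_e: "eq_map (spec B) X (exp_curve K X D y) C.e"
    using c(2) by (simp add: dual_space_eq)
  have "der_curve (exp_curve K X D y)"
    using der_curve_eq_map[OF C.der_curve_e eq_map_sym[OF exp_e]] .
  then have "integral_curve TYPE('s) K X D y (exp_curve K X D y)"
    by (rule der_curve_imp_integral_curve)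
  moreover have "eq_map (dual_space K) X f (exp_curve K X D y)"
    if f: "integral_curve TYPE((nat \<Rightarrow> 'k) \<Rightarrow> 'k) K X D y f" for f
  proof -
    \<comment> \<open>For an arbitrary curve the intertwining was derived over neighbourhoods of
      \<open>y0\<close>; the chart \<open>U\<close> is one of them.\<close>
    have "eq_map (spec B) X f C.e"
      by (rule C.curve_eq_e[OF integral_curve_premorphism[OF f] integral_curve_reflects[OF f]
            integral_curve_origin[OF f] integral_curve_derivation[OF f C.near_U]])
    then show ?thesis using eq_map_trans[OF _ eq_map_sym[OF exp_e]] by (simp add: dual_space_eq)
  qed
  ultimately show ?thesis by blast
qed

end
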